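(* Let $R$ be a commutative ring and $\mathcal{P}$ an operad over $R$. Then $\mathcal{P}\text{-}\mathsf{POLY}$ is a Cartesian differential category where, for a map $P=\langle P_1,\dots,P_m\rangle:n\to m$ (with $P_i\in\mathsf{S}(\mathcal{P},R^n)$), its derivative $\mathsf{D}[P]:n\times n\to m$ is $$\mathsf{D}[\langle P_1,\dots,P_m\rangle]=\langle\partial_{R^n}(P_1),\dots,\partial_{R^n}(P_m)\rangle.$$
   Context: $R$ is a commutative ring. An operad $\mathcal{P}$ is a symmetric operad in $R$-modules: $R$-modules $\mathcal{P}(n)$, $n\ge0$, with right $\Sigma(n)$-actions, a unit $1_{\mathcal{P}}\in\mathcal{P}(1)$ and partial compositions with the usual axioms; $\mu(\nu_1,\dots,\nu_k)$ is the complete composition. Its monad on $\mathsf{MOD}_R$: $\mathsf{S}(\mathcal{P},V)=\bigoplus_{n\ge0}(\mathcal{P}(n)\otimes V^{\otimes n})_{\Sigma(n)}$, with $(\mu;v_1,\dots,v_n)$ the class of $\mu\otimes v_1\otimes\cdots\otimes v_n$; unit $\eta_V(v)=(1_{\mathcal{P}};v)$; multiplication $\gamma_V(\mu;(\nu_1;v_{1,1},\dots,v_{1,n_1}),\dots,(\nu_k;v_{k,1},\dots,v_{k,n_k}))=(\mu(\nu_1,\dots,\nu_k);v_{1,1},\dots,v_{k,n_k})$. Also $\partial_V:\mathsf{S}(\mathcal{P},V)\to\mathsf{S}(\mathcal{P},V\times V)$ is the $R$-linear map $\partial_V(\mu;v_1,\dots,v_n)=\sum_{i=1}^n(\mu;(v_1,0),\dots,(0,v_i),\dots,(v_n,0))$.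 $\mathcal{P}\text{-}\mathsf{POLY}$ is the category whose objects are the natural numbers and whose maps $n\to m$ are $m$-tuples $\langle P_1,\dots,P_m\rangle$ with $P_i\in\mathsf{S}(\mathcal{P},R^n)$, equivalently $R$-linear maps $R^m\to\mathsf{S}(\mathcal{P},R^n)$; identities and composition are those of the opposite of the Kleisli category of the monad $\mathsf{S}(\mathcal{P},-)$ (so $\mathcal{P}\text{-}\mathsf{POLY}$ is identified with the full subcategory of it on the modules $R^n$). The product of $n$ and $m$ is $n+m$ (so $n\times n$ corresponds to $R^n\times R^n$), and homsets have componentwise addition. A Cartesian left additive category is a category with finite products whose homsets are commutative monoids such that $(f+g)\circ h=f\circ h+g\circ h$, $0\circ h=0$, and projections satisfy $\pi_j\circ(f+g)=\pi_j\circ f+\pi_j\circ g$, $\pi_j\circ0=0$. A Cartesian differential category is a Cartesian left additive category with operators $\mathsf{D}:\mathbb{X}(A,B)\to\mathbb{X}(A\times A,B)$ such that: [CD.1] $\mathsf{D}[f+g]=\mathsf{D}[f]+\mathsf{D}[g]$, $\mathsf{D}[0]=0$; [CD.2] $\mathsf{D}[f]\circ\langle g,h+k\rangle=\mathsf{D}[f]\circ\langle g,h\rangle+\mathsf{D}[f]\circ\langle g,k\rangle$, $\mathsf{D}[f]\circ\langle g,0\rangle=0$; [CD.3] $\mathsf{D}[1_A]=\pi_2$, $\mathsf{D}[\pi_j]=\pi_j\circ\pi_2$; [CD.4] $\mathsf{D}[\langle f_1,\dots,f_n\rangle]=\langle\mathsf{D}[f_1],\dots,\mathsf{D}[f_n]\rangle$;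 [CD.5] $\mathsf{D}[g\circ f]=\mathsf{D}[g]\circ\langle f\circ\pi_1,\mathsf{D}[f]\rangle$; [CD.6] $\mathsf{D}[\mathsf{D}[f]]\circ\langle\langle g,0\rangle,\langle0,h\rangle\rangle=\mathsf{D}[f]\circ\langle g,h\rangle$; [CD.7] $\mathsf{D}[\mathsf{D}[f]]\circ\langle\langle g,h\rangle,\langle k,j\rangle\rangle=\mathsf{D}[\mathsf{D}[f]]\circ\langle\langle g,k\rangle,\langle h,j\rangle\rangle$. *)

theory Defs
  imports "HOL-Algebra.Module" "HOL-Algebra.AbelCoset" "HOL-Combinatorics.Permutations"
begin

section \<open>Linear algebra over a commutative ring\<close>

text \<open>
  Modules are records extending rings; the ring multiplication and unit of such a record are
  not part of the module structure, so they are left \<^const>\<open>undefined\<close> below.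
\<close>

text \<open>Linear maps are extensional, so that a linear map is determined by its values on the carrier.\<close>

definition lin_hom :: "'r ring \<Rightarrow> ('r, 'a) module \<Rightarrow> ('r, 'b) module \<Rightarrow> ('a \<Rightarrow> 'b) set" where
  "lin_hom R M N = {f \<in> carrier M \<rightarrow>\<^sub>E carrier N.
     (\<forall>x\<in>carrier M. \<forall>y\<in>carrier M. f (x \<oplus>\<^bsub>M\<^esub> y) = f x \<oplus>\<^bsub>N\<^esub> f y) \<and>
     (\<forall>r\<in>carrier R. \<forall>x\<in>carrier M. f (r \<odot>\<^bsub>M\<^esub> x) = r \<odot>\<^bsub>N\<^esub> f x)}"

definition span_module :: "'r ring \<Rightarrow> ('r, 'a) module \<Rightarrow> 'a set \<Rightarrow> 'a set" where
  "span_module R M X = \<Inter>{H. submodule H R M \<and> X \<subseteq> H}"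

definition quot_module :: "('r, 'a) module \<Rightarrow> 'a set \<Rightarrow> ('r, 'a set) module" where
  "quot_module M N =
     \<lparr>carrier = a_rcosets\<^bsub>M\<^esub> N, monoid.mult = undefined, one = undefined,
      zero = N, add = set_add M, smult = (\<lambda>r X. \<Union>x\<in>X. N +>\<^bsub>M\<^esub> (r \<odot>\<^bsub>M\<^esub> x))\<rparr>"

definition free_module :: "'r ring \<Rightarrow> 'x set \<Rightarrow> ('r, 'x \<Rightarrow> 'r) module" where
  "free_module R X =
     \<lparr>carrier = {f. (\<forall>x. f x \<in> carrier R) \<and> (\<forall>x. x \<notin> X \<longrightarrow> f x = \<zero>\<^bsub>R\<^esub>) \<and> finite {x. f x \<noteq> \<zero>\<^bsub>R\<^esub>}},
      monoid.mult = undefined, one = undefined,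
      zero = (\<lambda>x. \<zero>\<^bsub>R\<^esub>), add = (\<lambda>f g x. f x \<oplus>\<^bsub>R\<^esub> g x), smult = (\<lambda>r f x. r \<otimes>\<^bsub>R\<^esub> f x)\<rparr>"

definition free_basis :: "'r ring \<Rightarrow> 'x \<Rightarrow> 'x \<Rightarrow> 'r" where
  "free_basis R x = (\<lambda>y. if y = x then \<one>\<^bsub>R\<^esub> else \<zero>\<^bsub>R\<^esub>)"

definition direct_sum :: "('i \<Rightarrow> ('r, 'a) module) \<Rightarrow> ('r, 'i \<Rightarrow> 'a) module" where
  "direct_sum M =
     \<lparr>carrier = {s. (\<forall>i. s i \<in> carrier (M i)) \<and> finite {i. s i \<noteq> \<zero>\<^bsub>M i\<^esub>}},
      monoid.mult = undefined, one = undefined,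
      zero = (\<lambda>i. \<zero>\<^bsub>M i\<^esub>), add = (\<lambda>s t i. s i \<oplus>\<^bsub>M i\<^esub> t i), smult = (\<lambda>r s i. r \<odot>\<^bsub>M i\<^esub> s i)\<rparr>"

definition prod_module :: "('r, 'a) module \<Rightarrow> ('r, 'b) module \<Rightarrow> ('r, 'a \<times> 'b) module" where
  "prod_module M N =
     \<lparr>carrier = carrier M \<times> carrier N, monoid.mult = undefined, one = undefined,
      zero = (\<zero>\<^bsub>M\<^esub>, \<zero>\<^bsub>N\<^esub>),
      add = (\<lambda>(x, y) (x', y'). (x \<oplus>\<^bsub>M\<^esub> x', y \<oplus>\<^bsub>N\<^esub> y')),
      smult = (\<lambda>r (x, y). (r \<odot>\<^bsub>M\<^esub> x, r \<odot>\<^bsub>N\<^esub> y))\<rparr>"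

text \<open>The module \<open>R\<^sup>n\<close>: functions on \<^typ>\<open>nat\<close> that vanish from \<open>n\<close> on.\<close>

definition Rpow :: "'r ring \<Rightarrow> nat \<Rightarrow> ('r, nat \<Rightarrow> 'r) module" where
  "Rpow R n = free_module R {..<n}"

definition Rpow_append :: "nat \<Rightarrow> (nat \<Rightarrow> 'r) \<times> (nat \<Rightarrow> 'r) \<Rightarrow> nat \<Rightarrow> 'r" where
  "Rpow_append n = (\<lambda>(x, y) i. if i < n then x i else y (i - n))"


section \<open>Symmetric operads\<close>

text \<open>
  Inputs are numbered from 0, and \<open>\<Sigma>(n)\<close> is the group of permutations of \<open>{..<n}\<close>.
  \<open>pcomp P m n i \<mu> \<nu>\<close> is \<open>\<mu> \<circ>\<^sub>i \<nu>\<close> for \<open>\<mu> \<in> P(m)\<close>, \<open>\<nu> \<in> P(n)\<close>, \<open>i < m\<close>. The arities are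
  explicit arguments because the carriers of different \<open>P(n)\<close> may overlap.
\<close>

record ('r, 'p) operad_data =
  ops :: "nat \<Rightarrow> ('r, 'p) module"
  act :: "nat \<Rightarrow> 'p \<Rightarrow> (nat \<Rightarrow> nat) \<Rightarrow> 'p"
  op_unit :: "'p"
  pcomp :: "nat \<Rightarrow> nat \<Rightarrow> nat \<Rightarrow> 'p \<Rightarrow> 'p \<Rightarrow> 'p"

text \<open>
  The right action is read as \<open>(\<mu>\<cdot>\<sigma>)(x\<^sub>0,\<dots>) = \<mu>(x\<^bsub>\<sigma>\<^sup>-\<^sup>1(0)\<^esub>,\<dots>)\<close>, as in endomorphism operads:
  \<open>\<sigma>\<close> sends input \<open>k\<close> of \<open>\<mu>\<cdot>\<sigma>\<close> to input \<open>\<sigma>(k)\<close> of \<open>\<mu>\<close>. Accordingly, \<open>pcomp_perm m n i \<sigma> \<tau>\<close>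
  sends input \<open>k\<close> of \<open>(\<mu>\<cdot>\<sigma>) \<circ>\<^sub>i (\<nu>\<cdot>\<tau>)\<close> to the corresponding input of \<open>\<mu> \<circ>\<^bsub>\<sigma>(i)\<^esub> \<nu>\<close>.
\<close>

definition pcomp_perm ::
  "nat \<Rightarrow> nat \<Rightarrow> nat \<Rightarrow> (nat \<Rightarrow> nat) \<Rightarrow> (nat \<Rightarrow> nat) \<Rightarrow> nat \<Rightarrow> nat" where
  "pcomp_perm m n i \<sigma> \<tau> k =
     (if m + n - 1 \<le> k then k
      else if i \<le> k \<and> k < i + n then \<sigma> i + \<tau> (k - i)
      else let s = \<sigma> (if k < i then k else k + 1 - n)
           in if s < \<sigma> i then s else s + n - 1)"

locale operad = cring R for R :: "'r ring" (structure) +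
  fixes P :: "('r, 'p) operad_data"
  assumes ops_module: "module R (ops P n)"
    and act_lin: "\<sigma> permutes {..<n} \<Longrightarrow>
      restrict (\<lambda>\<mu>. act P n \<mu> \<sigma>) (carrier (ops P n)) \<in> lin_hom R (ops P n) (ops P n)"
    and act_id: "\<mu> \<in> carrier (ops P n) \<Longrightarrow> act P n \<mu> id = \<mu>"
    and act_comp: "\<sigma> permutes {..<n} \<Longrightarrow> \<tau> permutes {..<n} \<Longrightarrow> \<mu> \<in> carrier (ops P n) \<Longrightarrow>
      act P n \<mu> (\<sigma> \<circ> \<tau>) = act P n (act P n \<mu> \<sigma>) \<tau>"
    and op_unit_closed: "op_unit P \<in> carrier (ops P 1)"
    and pcomp_lin_left: "i < m \<Longrightarrow> \<nu> \<in> carrier (ops P n) \<Longrightarrow>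
      restrict (\<lambda>\<mu>. pcomp P m n i \<mu> \<nu>) (carrier (ops P m)) \<in> lin_hom R (ops P m) (ops P (m + n - 1))"
    and pcomp_lin_right: "i < m \<Longrightarrow> \<mu> \<in> carrier (ops P m) \<Longrightarrow>
      restrict (\<lambda>\<nu>. pcomp P m n i \<mu> \<nu>) (carrier (ops P n)) \<in> lin_hom R (ops P n) (ops P (m + n - 1))"
    and pcomp_unit_left: "\<nu> \<in> carrier (ops P n) \<Longrightarrow> pcomp P 1 n 0 (op_unit P) \<nu> = \<nu>"
    and pcomp_unit_right: "i < m \<Longrightarrow> \<mu> \<in> carrier (ops P m) \<Longrightarrow> pcomp P m 1 i \<mu> (op_unit P) = \<mu>"
    and pcomp_sequential: "i < l \<Longrightarrow> j < m \<Longrightarrow>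
      \<kappa> \<in> carrier (ops P l) \<Longrightarrow> \<mu> \<in> carrier (ops P m) \<Longrightarrow> \<nu> \<in> carrier (ops P n) \<Longrightarrow>
      pcomp P (l + m - 1) n (i + j) (pcomp P l m i \<kappa> \<mu>) \<nu>
      = pcomp P l (m + n - 1) i \<kappa> (pcomp P m n j \<mu> \<nu>)"
    and pcomp_parallel: "i < k \<Longrightarrow> k < l \<Longrightarrow>
      \<kappa> \<in> carrier (ops P l) \<Longrightarrow> \<mu> \<in> carrier (ops P m) \<Longrightarrow> \<nu> \<in> carrier (ops P n) \<Longrightarrow>
      pcomp P (l + m - 1) n (k + m - 1) (pcomp P l m i \<kappa> \<mu>) \<nu>
      = pcomp P (l + n - 1) m i (pcomp P l n k \<kappa> \<nu>) \<mu>"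
    and pcomp_equivariant: "i < m \<Longrightarrow> \<sigma> permutes {..<m} \<Longrightarrow> \<tau> permutes {..<n} \<Longrightarrow>
      \<mu> \<in> carrier (ops P m) \<Longrightarrow> \<nu> \<in> carrier (ops P n) \<Longrightarrow>
      pcomp P m n i (act P m \<mu> \<sigma>) (act P n \<nu> \<tau>)
      = act P (m + n - 1) (pcomp P m n (\<sigma> i) \<mu> \<nu>) (pcomp_perm m n i \<sigma> \<tau>)"

text \<open>
  Complete composition \<open>\<mu>(\<nu>\<^sub>0,\<dots>,\<nu>\<^bsub>k-1\<^esub>)\<close>, for a list of operations paired with their arities.
  Composing at the last input first leaves the positions of the remaining inputs unchanged,
  so \<open>pcomp_rev\<close> takes the reversed list; its first argument is the current arity of \<open>\<mu>\<close>.
\<close>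

fun pcomp_rev :: "('r, 'p) operad_data \<Rightarrow> nat \<Rightarrow> 'p \<Rightarrow> (nat \<times> 'p) list \<Rightarrow> 'p" where
  "pcomp_rev P m \<mu> [] = \<mu>"
| "pcomp_rev P m \<mu> ((n, \<nu>) # ns) = pcomp_rev P (m + n - 1) (pcomp P m n (length ns) \<mu> \<nu>) ns"

definition full_comp :: "('r, 'p) operad_data \<Rightarrow> 'p \<Rightarrow> (nat \<times> 'p) list \<Rightarrow> 'p" where
  "full_comp P \<mu> ns = pcomp_rev P (length ns) \<mu> (rev ns)"


section \<open>The monad of an operad\<close>

text \<open>
  \<open>P(n) \<otimes> V\<^sup>\<otimes>\<^sup>n\<close> is rendered as the tensor product of the \<open>n + 1\<close> modules \<open>P(n), V, \<dots>, V\<close>: the free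
  module on \<open>P(n) \<times> V\<^sup>n\<close> modulo multilinearity.
\<close>

definition tensor_gens :: "('r, 'p) module \<Rightarrow> ('r, 'v) module \<Rightarrow> nat \<Rightarrow> ('p \<times> 'v list) set" where
  "tensor_gens M V n = carrier M \<times> {vs. length vs = n \<and> set vs \<subseteq> carrier V}"

definition tensor_rels ::
  "'r ring \<Rightarrow> ('r, 'p) module \<Rightarrow> ('r, 'v) module \<Rightarrow> nat \<Rightarrow> ('p \<times> 'v list \<Rightarrow> 'r) set" where
  "tensor_rels R M V n =
    (let F = free_module R (tensor_gens M V n); b = (\<lambda>\<mu> vs. free_basis R (\<mu>, vs)) in
       {b (\<mu> \<oplus>\<^bsub>M\<^esub> \<nu>) vs \<ominus>\<^bsub>F\<^esub> (b \<mu> vs \<oplus>\<^bsub>F\<^esub> b \<nu> vs) | \<mu> \<nu> vs.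
          (\<mu>, vs) \<in> tensor_gens M V n \<and> \<nu> \<in> carrier M}
     \<union> {b (r \<odot>\<^bsub>M\<^esub> \<mu>) vs \<ominus>\<^bsub>F\<^esub> (r \<odot>\<^bsub>F\<^esub> b \<mu> vs) | r \<mu> vs.
          r \<in> carrier R \<and> (\<mu>, vs) \<in> tensor_gens M V n}
     \<union> {b \<mu> (vs[i := v \<oplus>\<^bsub>V\<^esub> w]) \<ominus>\<^bsub>F\<^esub> (b \<mu> (vs[i := v]) \<oplus>\<^bsub>F\<^esub> b \<mu> (vs[i := w])) | \<mu> vs i v w.
          (\<mu>, vs) \<in> tensor_gens M V n \<and> i < n \<and> v \<in> carrier V \<and> w \<in> carrier V}
     \<union> {b \<mu> (vs[i := r \<odot>\<^bsub>V\<^esub> v]) \<ominus>\<^bsub>F\<^esub> (r \<odot>\<^bsub>F\<^esub> b \<mu> (vs[i := v])) | \<mu> vs i r v.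
          (\<mu>, vs) \<in> tensor_gens M V n \<and> i < n \<and> r \<in> carrier R \<and> v \<in> carrier V})"

definition tensor_sub ::
  "'r ring \<Rightarrow> ('r, 'p) module \<Rightarrow> ('r, 'v) module \<Rightarrow> nat \<Rightarrow> ('p \<times> 'v list \<Rightarrow> 'r) set" where
  "tensor_sub R M V n = span_module R (free_module R (tensor_gens M V n)) (tensor_rels R M V n)"

definition tensor ::
  "'r ring \<Rightarrow> ('r, 'p) module \<Rightarrow> ('r, 'v) module \<Rightarrow> nat \<Rightarrow> ('r, ('p \<times> 'v list \<Rightarrow> 'r) set) module" where
  "tensor R M V n = quot_module (free_module R (tensor_gens M V n)) (tensor_sub R M V n)"

definition pure_tensor ::
  "'r ring \<Rightarrow> ('r, 'p) module \<Rightarrow> ('r, 'v) module \<Rightarrow> nat \<Rightarrow> 'p \<Rightarrow> 'v list \<Rightarrow> ('p \<times> 'v list \<Rightarrow> 'r) set" where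
  "pure_tensor R M V n \<mu> vs =
     tensor_sub R M V n +>\<^bsub>free_module R (tensor_gens M V n)\<^esub> free_basis R (\<mu>, vs)"

text \<open>
  Coinvariants: \<open>\<sigma>\<close> maps the pure tensor of \<open>\<mu>\<close> and \<open>v\<^sub>0,\<dots>,v\<^bsub>n-1\<^esub>\<close> to that of \<open>\<mu>\<cdot>\<sigma>\<close> and
  \<open>v\<^bsub>\<sigma>(0)\<^esub>,\<dots>,v\<^bsub>\<sigma>(n-1)\<^esub>\<close>. Since pure tensors generate, identifying these suffices.
\<close>

definition coinv_sub ::
  "'r ring \<Rightarrow> ('r, 'p) operad_data \<Rightarrow> ('r, 'v) module \<Rightarrow> nat \<Rightarrow> ('p \<times> 'v list \<Rightarrow> 'r) set set" where
  "coinv_sub R P V n = (let T = tensor R (ops P n) V n in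
     span_module R T
       {pure_tensor R (ops P n) V n (act P n \<mu> \<sigma>) (permute_list \<sigma> vs)
          \<ominus>\<^bsub>T\<^esub> pure_tensor R (ops P n) V n \<mu> vs | \<mu> vs \<sigma>.
        (\<mu>, vs) \<in> tensor_gens (ops P n) V n \<and> \<sigma> permutes {..<n}})"

type_synonym ('r, 'p, 'v) schur = "nat \<Rightarrow> ('p \<times> 'v list \<Rightarrow> 'r) set set"

definition schur ::
  "'r ring \<Rightarrow> ('r, 'p) operad_data \<Rightarrow> ('r, 'v) module \<Rightarrow> ('r, ('r, 'p, 'v) schur) module" where
  "schur R P V = direct_sum (\<lambda>n. quot_module (tensor R (ops P n) V n) (coinv_sub R P V n))"

text \<open>The element \<open>(\<mu>; v\<^sub>0,\<dots>,v\<^bsub>n-1\<^esub>)\<close>, for \<open>\<mu> \<in> P(n)\<close> with \<open>n\<close> the length of the list.\<close>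

definition schur_elt ::
  "'r ring \<Rightarrow> ('r, 'p) operad_data \<Rightarrow> ('r, 'v) module \<Rightarrow> 'p \<Rightarrow> 'v list \<Rightarrow> ('r, 'p, 'v) schur" where
  "schur_elt R P V \<mu> vs = (\<lambda>n.
     if n = length vs
     then coinv_sub R P V n +>\<^bsub>tensor R (ops P n) V n\<^esub> pure_tensor R (ops P n) V n \<mu> vs
     else coinv_sub R P V n)"

text \<open>
  The elements \<open>(\<mu>; v\<^sub>0,\<dots>,v\<^bsub>n-1\<^esub>)\<close> generate \<^const>\<open>schur\<close>, so the linear maps below are determined
  by their values on them.
\<close>

definition schur_map ::
  "'r ring \<Rightarrow> ('r, 'p) operad_data \<Rightarrow> ('r, 'v) module \<Rightarrow> ('r, 'w) module \<Rightarrow> ('v \<Rightarrow> 'w)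
     \<Rightarrow> ('r, 'p, 'v) schur \<Rightarrow> ('r, 'p, 'w) schur" where
  "schur_map R P V W f = (THE F. F \<in> lin_hom R (schur R P V) (schur R P W) \<and>
     (\<forall>vs. \<forall>\<mu>\<in>carrier (ops P (length vs)). set vs \<subseteq> carrier V \<longrightarrow>
        F (schur_elt R P V \<mu> vs) = schur_elt R P W \<mu> (map f vs)))"

definition schur_unit ::
  "'r ring \<Rightarrow> ('r, 'p) operad_data \<Rightarrow> ('r, 'v) module \<Rightarrow> 'v \<Rightarrow> ('r, 'p, 'v) schur" where
  "schur_unit R P V v = schur_elt R P V (op_unit P) [v]"

text \<open>In \<open>schur_mult\<close>, the list \<open>ys\<close> consists of the pairs \<open>(\<nu>\<^sub>i, [v\<^bsub>i,0\<^esub>,\<dots>])\<close>.\<close>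

definition schur_mult ::
  "'r ring \<Rightarrow> ('r, 'p) operad_data \<Rightarrow> ('r, 'v) module
     \<Rightarrow> ('r, 'p, ('r, 'p, 'v) schur) schur \<Rightarrow> ('r, 'p, 'v) schur" where
  "schur_mult R P V = (THE G. G \<in> lin_hom R (schur R P (schur R P V)) (schur R P V) \<and>
     (\<forall>ys. \<forall>\<mu>\<in>carrier (ops P (length ys)).
        (\<forall>(\<nu>, vs)\<in>set ys. \<nu> \<in> carrier (ops P (length vs)) \<and> set vs \<subseteq> carrier V) \<longrightarrow>
        G (schur_elt R P (schur R P V) \<mu> (map (\<lambda>(\<nu>, vs). schur_elt R P V \<nu> vs) ys))
        = schur_elt R P V (full_comp P \<mu> (map (\<lambda>(\<nu>, vs). (length vs, \<nu>)) ys)) (concat (map snd ys))))"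

definition schur_deriv ::
  "'r ring \<Rightarrow> ('r, 'p) operad_data \<Rightarrow> ('r, 'v) module
     \<Rightarrow> ('r, 'p, 'v) schur \<Rightarrow> ('r, 'p, 'v \<times> 'v) schur" where
  "schur_deriv R P V = (let VV = prod_module V V in
     THE d. d \<in> lin_hom R (schur R P V) (schur R P VV) \<and>
     (\<forall>vs. \<forall>\<mu>\<in>carrier (ops P (length vs)). set vs \<subseteq> carrier V \<longrightarrow>
        d (schur_elt R P V \<mu> vs) =
          (\<Oplus>\<^bsub>schur R P VV\<^esub>i\<in>{..<length vs}. schur_elt R P VV \<mu>
             (map (\<lambda>j. if j = i then (\<zero>\<^bsub>V\<^esub>, vs ! j) else (vs ! j, \<zero>\<^bsub>V\<^esub>)) [0..<length vs]))))"


section \<open>Cartesian differential categories\<close>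

text \<open>
  Finite products are chosen and indexed by lists of objects; projections are numbered from 0,
  so \<open>\<pi>\<^sub>1, \<pi>\<^sub>2 : A \<times> A \<rightarrow> A\<close> are \<open>Proj C [A, A] 0\<close> and \<open>Proj C [A, A] 1\<close>.
\<close>

record ('o, 'm) cat_data =
  Ob :: "'o set"
  Hom :: "'o \<Rightarrow> 'o \<Rightarrow> 'm set"
  Id :: "'o \<Rightarrow> 'm"
  Comp :: "'m \<Rightarrow> 'm \<Rightarrow> 'm"  (infixl \<open>\<bullet>\<index>\<close> 65)
  Prod :: "'o list \<Rightarrow> 'o"
  Proj :: "'o list \<Rightarrow> nat \<Rightarrow> 'm"
  Add :: "'m \<Rightarrow> 'm \<Rightarrow> 'm"  (infixl \<open>\<boxplus>\<index>\<close> 60)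
  Zero :: "'o \<Rightarrow> 'o \<Rightarrow> 'm"

locale category =
  fixes C :: "('o, 'm) cat_data" (structure)
  assumes Hom_disjoint: "A \<in> Ob C \<Longrightarrow> B \<in> Ob C \<Longrightarrow> A' \<in> Ob C \<Longrightarrow> B' \<in> Ob C \<Longrightarrow>
      f \<in> Hom C A B \<Longrightarrow> f \<in> Hom C A' B' \<Longrightarrow> A = A' \<and> B = B'"
    and Id_Hom: "A \<in> Ob C \<Longrightarrow> Id C A \<in> Hom C A A"
    and Comp_Hom: "A \<in> Ob C \<Longrightarrow> B \<in> Ob C \<Longrightarrow> E \<in> Ob C \<Longrightarrow>
      f \<in> Hom C A B \<Longrightarrow> g \<in> Hom C B E \<Longrightarrow> g \<bullet> f \<in> Hom C A E"
    and Comp_Id: "A \<in> Ob C \<Longrightarrow> B \<in> Ob C \<Longrightarrow> f \<in> Hom C A B \<Longrightarrow> f \<bullet> Id C A = f"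
    and Id_Comp: "A \<in> Ob C \<Longrightarrow> B \<in> Ob C \<Longrightarrow> f \<in> Hom C A B \<Longrightarrow> Id C B \<bullet> f = f"
    and Comp_assoc: "A \<in> Ob C \<Longrightarrow> B \<in> Ob C \<Longrightarrow> E \<in> Ob C \<Longrightarrow> F \<in> Ob C \<Longrightarrow>
      f \<in> Hom C A B \<Longrightarrow> g \<in> Hom C B E \<Longrightarrow> h \<in> Hom C E F \<Longrightarrow> (h \<bullet> g) \<bullet> f = h \<bullet> (g \<bullet> f)"

definition is_tuple :: "('o, 'm) cat_data \<Rightarrow> 'o \<Rightarrow> 'o list \<Rightarrow> 'm list \<Rightarrow> 'm \<Rightarrow> bool" where
  "is_tuple C X As fs h \<longleftrightarrow> h \<in> Hom C X (Prod C As) \<and> (\<forall>j<length As. Proj C As j \<bullet>\<^bsub>C\<^esub> h = fs ! j)"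

text \<open>\<open>\<langle>f\<^sub>0,\<dots>,f\<^bsub>k-1\<^esub>\<rangle>\<close>, for maps \<open>f\<^sub>j\<close> from \<open>X\<close> to \<open>As ! j\<close>.\<close>

definition tuple :: "('o, 'm) cat_data \<Rightarrow> 'o \<Rightarrow> 'o list \<Rightarrow> 'm list \<Rightarrow> 'm" where
  "tuple C X As fs = (THE h. is_tuple C X As fs h)"

locale category_with_finite_products = category +
  assumes Prod_Ob: "set As \<subseteq> Ob C \<Longrightarrow> Prod C As \<in> Ob C"
    and Proj_Hom: "set As \<subseteq> Ob C \<Longrightarrow> j < length As \<Longrightarrow> Proj C As j \<in> Hom C (Prod C As) (As ! j)"
    and Prod_universal: "X \<in> Ob C \<Longrightarrow> set As \<subseteq> Ob C \<Longrightarrow>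
      list_all2 (\<lambda>f A. f \<in> Hom C X A) fs As \<Longrightarrow> \<exists>!h. is_tuple C X As fs h"

locale cartesian_left_additive_category = category_with_finite_products +
  assumes Hom_comm_monoid: "A \<in> Ob C \<Longrightarrow> B \<in> Ob C \<Longrightarrow>
      comm_monoid \<lparr>carrier = Hom C A B, monoid.mult = Add C, one = Zero C A B\<rparr>"
    and Add_Comp: "A \<in> Ob C \<Longrightarrow> B \<in> Ob C \<Longrightarrow> E \<in> Ob C \<Longrightarrow>
      f \<in> Hom C B E \<Longrightarrow> g \<in> Hom C B E \<Longrightarrow> h \<in> Hom C A B \<Longrightarrow>
      (f \<boxplus> g) \<bullet> h = f \<bullet> h \<boxplus> g \<bullet> h"
    and Zero_Comp: "A \<in> Ob C \<Longrightarrow> B \<in> Ob C \<Longrightarrow> E \<in> Ob C \<Longrightarrow> h \<in> Hom C A B \<Longrightarrow>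
      Zero C B E \<bullet> h = Zero C A E"
    and Proj_Add: "X \<in> Ob C \<Longrightarrow> set As \<subseteq> Ob C \<Longrightarrow> j < length As \<Longrightarrow>
      f \<in> Hom C X (Prod C As) \<Longrightarrow> g \<in> Hom C X (Prod C As) \<Longrightarrow>
      Proj C As j \<bullet> (f \<boxplus> g) = Proj C As j \<bullet> f \<boxplus> Proj C As j \<bullet> g"
    and Proj_Zero: "X \<in> Ob C \<Longrightarrow> set As \<subseteq> Ob C \<Longrightarrow> j < length As \<Longrightarrow>
      Proj C As j \<bullet> Zero C X (Prod C As) = Zero C X (As ! j)"

locale cartesian_differential_category = cartesian_left_additive_category +
  fixes D :: "'b \<Rightarrow> 'b"
  assumes D_Hom: "A \<in> Ob C \<Longrightarrow> B \<in> Ob C \<Longrightarrow> f \<in> Hom C A B \<Longrightarrow> D f \<in> Hom C (Prod C [A, A]) B"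
    and CD1_add: "A \<in> Ob C \<Longrightarrow> B \<in> Ob C \<Longrightarrow> f \<in> Hom C A B \<Longrightarrow> g \<in> Hom C A B \<Longrightarrow>
      D (f \<boxplus> g) = D f \<boxplus> D g"
    and CD1_zero: "A \<in> Ob C \<Longrightarrow> B \<in> Ob C \<Longrightarrow> D (Zero C A B) = Zero C (Prod C [A, A]) B"
    and CD2_add: "X \<in> Ob C \<Longrightarrow> A \<in> Ob C \<Longrightarrow> B \<in> Ob C \<Longrightarrow> f \<in> Hom C A B \<Longrightarrow>
      g \<in> Hom C X A \<Longrightarrow> h \<in> Hom C X A \<Longrightarrow> k \<in> Hom C X A \<Longrightarrow>
      D f \<bullet> tuple C X [A, A] [g, h \<boxplus> k]
      = D f \<bullet> tuple C X [A, A] [g, h] \<boxplus> D f \<bullet> tuple C X [A, A] [g, k]"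
    and CD2_zero: "X \<in> Ob C \<Longrightarrow> A \<in> Ob C \<Longrightarrow> B \<in> Ob C \<Longrightarrow> f \<in> Hom C A B \<Longrightarrow> g \<in> Hom C X A \<Longrightarrow>
      D f \<bullet> tuple C X [A, A] [g, Zero C X A] = Zero C X B"
    and CD3_Id: "A \<in> Ob C \<Longrightarrow> D (Id C A) = Proj C [A, A] 1"
    and CD3_Proj: "set As \<subseteq> Ob C \<Longrightarrow> j < length As \<Longrightarrow>
      D (Proj C As j) = Proj C As j \<bullet> Proj C [Prod C As, Prod C As] 1"
    and CD4: "X \<in> Ob C \<Longrightarrow> set As \<subseteq> Ob C \<Longrightarrow> list_all2 (\<lambda>f A. f \<in> Hom C X A) fs As \<Longrightarrow>
      D (tuple C X As fs) = tuple C (Prod C [X, X]) As (map D fs)"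
    and CD5: "A \<in> Ob C \<Longrightarrow> B \<in> Ob C \<Longrightarrow> E \<in> Ob C \<Longrightarrow> f \<in> Hom C A B \<Longrightarrow> g \<in> Hom C B E \<Longrightarrow>
      D (g \<bullet> f) = D g \<bullet> tuple C (Prod C [A, A]) [B, B] [f \<bullet> Proj C [A, A] 0, D f]"
    and CD6: "X \<in> Ob C \<Longrightarrow> A \<in> Ob C \<Longrightarrow> B \<in> Ob C \<Longrightarrow> f \<in> Hom C A B \<Longrightarrow>
      g \<in> Hom C X A \<Longrightarrow> h \<in> Hom C X A \<Longrightarrow>
      D (D f) \<bullet> tuple C X [Prod C [A, A], Prod C [A, A]]
         [tuple C X [A, A] [g, Zero C X A], tuple C X [A, A] [Zero C X A, h]]
      = D f \<bullet> tuple C X [A, A] [g, h]"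
    and CD7: "X \<in> Ob C \<Longrightarrow> A \<in> Ob C \<Longrightarrow> B \<in> Ob C \<Longrightarrow> f \<in> Hom C A B \<Longrightarrow>
      g \<in> Hom C X A \<Longrightarrow> h \<in> Hom C X A \<Longrightarrow> k \<in> Hom C X A \<Longrightarrow> l \<in> Hom C X A \<Longrightarrow>
      D (D f) \<bullet> tuple C X [Prod C [A, A], Prod C [A, A]]
         [tuple C X [A, A] [g, h], tuple C X [A, A] [k, l]]
      = D (D f) \<bullet> tuple C X [Prod C [A, A], Prod C [A, A]]
         [tuple C X [A, A] [g, k], tuple C X [A, A] [h, l]]"


section \<open>The category \<open>P\<close>-POLY\<close>

text \<open>A map \<open>n \<rightarrow> m\<close> is the triple of \<open>n\<close>, \<open>m\<close> and the list of its \<open>m\<close> components.\<close>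

type_synonym ('r, 'p) poly_map = "nat \<times> nat \<times> ('r, 'p, nat \<Rightarrow> 'r) schur list"

definition poly_hom :: "'r ring \<Rightarrow> ('r, 'p) operad_data \<Rightarrow> nat \<Rightarrow> nat \<Rightarrow> ('r, 'p) poly_map set" where
  "poly_hom R P n m =
     {(n, m, Ps) | Ps. length Ps = m \<and> set Ps \<subseteq> carrier (schur R P (Rpow R n))}"

text \<open>The linear map \<open>R\<^sup>m \<rightarrow> S(P, R\<^sup>n)\<close> that sends the \<open>i\<close>-th basis vector to the \<open>i\<close>-th component.\<close>

definition kleisli_of ::
  "'r ring \<Rightarrow> ('r, 'p) operad_data \<Rightarrow> ('r, 'p) poly_map \<Rightarrow> (nat \<Rightarrow> 'r) \<Rightarrow> ('r, 'p, nat \<Rightarrow> 'r) schur" where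
  "kleisli_of R P = (\<lambda>(n, m, Ps). \<lambda>x\<in>carrier (Rpow R m).
     (\<Oplus>\<^bsub>schur R P (Rpow R n)\<^esub>i\<in>{..<m}. x i \<odot>\<^bsub>schur R P (Rpow R n)\<^esub> Ps ! i))"

text \<open>
  The composite \<open>g \<circ> f\<close> of \<open>f : n \<rightarrow> m\<close> and \<open>g : m \<rightarrow> l\<close> is the Kleisli composite
  \<open>R\<^sup>l \<rightarrow> S(P, R\<^sup>m) \<rightarrow> S(P, S(P, R\<^sup>n)) \<rightarrow> S(P, R\<^sup>n)\<close>.
\<close>

definition poly_comp ::
  "'r ring \<Rightarrow> ('r, 'p) operad_data \<Rightarrow> ('r, 'p) poly_map \<Rightarrow> ('r, 'p) poly_map \<Rightarrow> ('r, 'p) poly_map" where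
  "poly_comp R P = (\<lambda>(_, l, Qs) (n, m, Ps).
     (n, l, map (\<lambda>Q. schur_mult R P (Rpow R n)
        (schur_map R P (Rpow R m) (schur R P (Rpow R n)) (kleisli_of R P (n, m, Ps)) Q)) Qs))"

text \<open>The variable \<open>x\<^sub>i\<close> in \<open>n\<close> variables: the unit of the monad at the \<open>i\<close>-th basis vector.\<close>

definition poly_var :: "'r ring \<Rightarrow> ('r, 'p) operad_data \<Rightarrow> nat \<Rightarrow> nat \<Rightarrow> ('r, 'p, nat \<Rightarrow> 'r) schur" where
  "poly_var R P n i = schur_unit R P (Rpow R n) (free_basis R i)"

definition POLY :: "'r ring \<Rightarrow> ('r, 'p) operad_data \<Rightarrow> (nat, ('r, 'p) poly_map) cat_data" where
  "POLY R P =
     \<lparr>Ob = UNIV,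
      Hom = poly_hom R P,
      Id = (\<lambda>n. (n, n, map (poly_var R P n) [0..<n])),
      Comp = poly_comp R P,
      Prod = sum_list,
      Proj = (\<lambda>ns j. (sum_list ns, ns ! j,
        map (\<lambda>i. poly_var R P (sum_list ns) (sum_list (take j ns) + i)) [0..<ns ! j])),
      Add = (\<lambda>(n, m, Ps) (_, _, Qs). (n, m, map2 (add (schur R P (Rpow R n))) Ps Qs)),
      Zero = (\<lambda>n m. (n, m, replicate m \<zero>\<^bsub>schur R P (Rpow R n)\<^esub>))\<rparr>"

text \<open>
  \<open>\<partial>\<close> at \<open>R\<^sup>n\<close>, with values in \<open>S(P, R\<^bsup>n+n\<^esup>)\<close> via \<open>R\<^sup>n \<times> R\<^sup>n \<cong> R\<^bsup>n+n\<^esup>\<close>.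
\<close>

definition poly_partial ::
  "'r ring \<Rightarrow> ('r, 'p) operad_data \<Rightarrow> nat \<Rightarrow> ('r, 'p, nat \<Rightarrow> 'r) schur \<Rightarrow> ('r, 'p, nat \<Rightarrow> 'r) schur" where
  "poly_partial R P n p =
     schur_map R P (prod_module (Rpow R n) (Rpow R n)) (Rpow R (n + n)) (Rpow_append n)
       (schur_deriv R P (Rpow R n) p)"

end

theory Submission
  imports Defs
begin

text \<open>
  The module \<open>S(P,V)\<close> represents the families of maps \<open>P(n) \<times> V\<^sup>n \<rightarrow> N\<close> that are multilinear and
  invariant under \<open>\<Sigma>(n)\<close>; hence \<open>\<partial>\<close> and the functorial action of \<open>S(P,-)\<close> exist, and linear maps out of
  \<open>S(P,V)\<close> may be compared on the generators \<open>(\<mu>; v\<^sub>0,\<dots>)\<close>. The multiplication comes from an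
  invariant multilinear composition \<open>\<mu>(y\<^sub>0,\<dots>)\<close> of an operation \<open>\<mu>\<close> with elements \<open>y\<^sub>i\<close> of \<open>S(P,V)\<close>,
  which is built by plugging in one \<open>y\<^sub>i\<close> at a time with the partial compositions. Then \<open>S(P,-)\<close> is a monad,
  and \<open>\<partial>\<close> satisfies the Leibniz rule \<open>\<partial>(\<mu>(y\<^sub>0,\<dots>)) = \<Sum>\<^sub>i \<mu>(y\<^sub>0,\<dots>,\<partial>y\<^sub>i,\<dots>)\<close>, where the other \<open>y\<^sub>j\<close>
  are moved to \<open>S(P,V \<times> V)\<close> along \<open>v \<mapsto> (v,0)\<close>. This is the chain rule [CD.5]. Evaluating a twice
  differentiated generator gives a double sum over the two inputs that are differentiated, from which
  [CD.6] (only the diagonal survives) and [CD.7] (the sum is symmetric) are read off.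
\<close>

section \<open>Linear maps, quotients, free modules and direct sums\<close>

text \<open>\<open>schur_map\<close>, \<open>schur_mult\<close> and \<open>schur_deriv\<close> are
  definite descriptions, so each needs existence and uniqueness before it can be evaluated. For the
  multiplication, existence is the obstacle: its defining equation mentions only entries that are
  generators, and these have many presentations, so a value on arbitrary entries must come from
  nested uses of the universal property. A generator inserted into one input brings its own vectors
  along; hence the recursion carries a tail of vectors that already occupy the last inputs, and each
  lift must be linear in all data that the next lift varies. Derivations are studied for an
  arbitrary pair of linear maps f, g : V -> W, because a Kleisli extension of \<kappa>, applied to a
  derivative, depends on \<kappa> only through its composites with f and with g. With f and g the
  two inclusions of R^n into R^(n+n), the differential axioms reduce to identities on these two
  parts, and those about second derivatives to identities on the four composites of
  inclusions.\<close>

definition is_lin :: "'r ring \<Rightarrow> ('r, 'a) module \<Rightarrow> ('r, 'b) module \<Rightarrow> ('a \<Rightarrow> 'b) \<Rightarrow> bool" where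
  "is_lin R M N f \<longleftrightarrow> (\<forall>x\<in>carrier M. f x \<in> carrier N) \<and>
     (\<forall>x\<in>carrier M. \<forall>y\<in>carrier M. f (x \<oplus>\<^bsub>M\<^esub> y) = f x \<oplus>\<^bsub>N\<^esub> f y) \<and>
     (\<forall>r\<in>carrier R. \<forall>x\<in>carrier M. f (r \<odot>\<^bsub>M\<^esub> x) = r \<odot>\<^bsub>N\<^esub> f x)"

lemma is_linI:
  assumes "\<And>x. x \<in> carrier M \<Longrightarrow> f x \<in> carrier N"
    and "\<And>x y. x \<in> carrier M \<Longrightarrow> y \<in> carrier M \<Longrightarrow> f (x \<oplus>\<^bsub>M\<^esub> y) = f x \<oplus>\<^bsub>N\<^esub> f y"
    and "\<And>r x. r \<in> carrier R \<Longrightarrow> x \<in> carrier M \<Longrightarrow> f (r \<odot>\<^bsub>M\<^esub> x) = r \<odot>\<^bsub>N\<^esub> f x"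
  shows "is_lin R M N f"
  using assms by (simp add: is_lin_def)

lemma is_lin_closed: "is_lin R M N f \<Longrightarrow> x \<in> carrier M \<Longrightarrow> f x \<in> carrier N"
  and is_lin_add: "is_lin R M N f \<Longrightarrow> x \<in> carrier M \<Longrightarrow> y \<in> carrier M \<Longrightarrow>
    f (x \<oplus>\<^bsub>M\<^esub> y) = f x \<oplus>\<^bsub>N\<^esub> f y"
  and is_lin_smult: "is_lin R M N f \<Longrightarrow> r \<in> carrier R \<Longrightarrow> x \<in> carrier M \<Longrightarrow>
    f (r \<odot>\<^bsub>M\<^esub> x) = r \<odot>\<^bsub>N\<^esub> f x"
  by (simp_all add: is_lin_def)

lemma lin_hom_iff: "f \<in> lin_hom R M N \<longleftrightarrow> is_lin R M N f \<and> f \<in> extensional (carrier M)"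
  by (auto simp: lin_hom_def is_lin_def PiE_def)

text \<open>The module structure of \<open>M\<close> closes its carrier under sums and multiples, so
  agreement on the carrier covers every argument that occurs in linearity.\<close>

lemma is_lin_cong:
  assumes "is_lin R M N f" "module R M" "\<And>x. x \<in> carrier M \<Longrightarrow> g x = f x"
  shows "is_lin R M N g"
proof -
  interpret M: module R M by fact
  show ?thesis using assms(1,3) by (simp add: is_lin_def)
qed

text \<open>Extensionality is restored by \<open>restrict\<close> only where a definite description
  has to be met; everywhere else \<open>is_lin\<close> admits plain lambda terms and their
  composites.\<close>

lemma restrict_lin_hom: "is_lin R M N f \<Longrightarrow> module R M \<Longrightarrow> restrict f (carrier M) \<in> lin_hom R M N"
  by (auto simp: lin_hom_iff intro: is_lin_cong)

lemma is_lin_restrictD: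
  assumes "restrict f (carrier M) \<in> lin_hom R M N" "module R M"
  shows "is_lin R M N f"
  using assms by (auto simp: lin_hom_iff intro: is_lin_cong)

lemma is_lin_comp: "is_lin R M N f \<Longrightarrow> is_lin R N L g \<Longrightarrow> is_lin R M L (\<lambda>x. g (f x))"
  by (simp add: is_lin_def)

lemma is_lin_id: "is_lin R M M (\<lambda>x. x)"
  by (simp add: is_lin_def)

lemma is_lin_zero:
  assumes "is_lin R M N f" "module R M" "module R N"
  shows "f \<zero>\<^bsub>M\<^esub> = \<zero>\<^bsub>N\<^esub>"
proof -
  interpret M: module R M by fact
  interpret N: module R N by fact
  have "f \<zero>\<^bsub>M\<^esub> = f (\<zero>\<^bsub>R\<^esub> \<odot>\<^bsub>M\<^esub> \<zero>\<^bsub>M\<^esub>)" by simp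
  also have "\<dots> = \<zero>\<^bsub>R\<^esub> \<odot>\<^bsub>N\<^esub> f \<zero>\<^bsub>M\<^esub>" by (rule is_lin_smult[OF assms(1)]) auto
  also have "\<dots> = \<zero>\<^bsub>N\<^esub>" using is_lin_closed[OF assms(1)] by simp
  finally show ?thesis .
qed

lemma is_lin_minus:
  assumes "is_lin R M N f" "module R M" "module R N" "x \<in> carrier M" "y \<in> carrier M"
  shows "f (x \<ominus>\<^bsub>M\<^esub> y) = f x \<ominus>\<^bsub>N\<^esub> f y"
proof -
  interpret M: module R M by fact
  interpret N: module R N by fact
  have c: "f x \<in> carrier N" "f y \<in> carrier N" "f (\<ominus>\<^bsub>M\<^esub> y) \<in> carrier N"
    using assms by (auto intro!: is_lin_closed[OF assms(1)])
  have "f (\<ominus>\<^bsub>M\<^esub> y) \<oplus>\<^bsub>N\<^esub> f y = f (\<ominus>\<^bsub>M\<^esub> y \<oplus>\<^bsub>M\<^esub> y)"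
    using assms by (simp add: is_lin_add)
  also have "\<dots> = \<zero>\<^bsub>N\<^esub>" using assms by (simp add: is_lin_zero M.l_neg)
  finally have "f (\<ominus>\<^bsub>M\<^esub> y) = \<ominus>\<^bsub>N\<^esub> f y" using c N.minus_equality by metis
  then show ?thesis using assms by (simp add: a_minus_def is_lin_add)
qed

lemma is_lin_finsum:
  assumes "is_lin R M N f" "module R M" "module R N" "g \<in> A \<rightarrow> carrier M"
  shows "f (\<Oplus>\<^bsub>M\<^esub>i\<in>A. g i) = (\<Oplus>\<^bsub>N\<^esub>i\<in>A. f (g i))"
proof -
  interpret M: module R M by fact
  interpret N: module R N by fact
  show ?thesis using assms(4)
  proof (induct A rule: infinite_finite_induct)
    case (insert a A)
    then have "g a \<in> carrier M" "g \<in> A \<rightarrow> carrier M" by auto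
    moreover from this have "f (g a) \<in> carrier N" "(\<lambda>i. f (g i)) \<in> A \<rightarrow> carrier N"
      using is_lin_closed[OF assms(1)] by auto
    ultimately show ?case using insert by (simp add: is_lin_add[OF assms(1)])
  qed (simp_all add: is_lin_zero[OF assms(1-3)])
qed

lemma is_lin_zero_fun:
  assumes "module R N" shows "is_lin R M N (\<lambda>_. \<zero>\<^bsub>N\<^esub>)"
proof -
  interpret N: module R N by fact
  show ?thesis by (simp add: is_lin_def)
qed

lemma is_lin_add_fun:
  assumes "is_lin R M N f" "is_lin R M N g" "module R N"
  shows "is_lin R M N (\<lambda>x. f x \<oplus>\<^bsub>N\<^esub> g x)"
proof -
  interpret N: module R N by fact
  show ?thesis using assms(1,2)
    by (simp add: is_lin_def N.smult_r_distr N.a_ac)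
qed

lemma is_lin_finsum_fun:
  assumes "\<And>i. i \<in> A \<Longrightarrow> is_lin R M N (f i)" "module R M" "module R N"
  shows "is_lin R M N (\<lambda>x. \<Oplus>\<^bsub>N\<^esub>i\<in>A. f i x)"
  using assms(1)
proof (induct A rule: infinite_finite_induct)
  interpret N: module R N by fact
  case (insert a A)
  have "is_lin R M N (\<lambda>x. f a x \<oplus>\<^bsub>N\<^esub> (\<Oplus>\<^bsub>N\<^esub>i\<in>A. f i x))"
    using insert assms by (intro is_lin_add_fun) auto
  moreover have "(\<Oplus>\<^bsub>N\<^esub>i\<in>insert a A. f i x) = f a x \<oplus>\<^bsub>N\<^esub> (\<Oplus>\<^bsub>N\<^esub>i\<in>A. f i x)" if "x \<in> carrier M" for x
    using insert that by (intro N.finsum_insert) (auto intro: is_lin_closed[OF _ that])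
  ultimately show ?case by (rule is_lin_cong[OF _ assms(2)])
next
  interpret N: module R N by fact
  case (infinite A)
  \<comment> \<open>A sum over an infinite index set is zero by convention, so this is the zero
    map.\<close>
  then show ?case using is_lin_zero_fun[OF assms(3)] by simp
next
  interpret N: module R N by fact
  case empty
  then show ?case using is_lin_zero_fun[OF assms(3)] by simp
qed

section \<open>Spans, kernels and quotient modules\<close>

locale plain_module = module R M for R :: "'r ring" (structure) and M :: "('r, 'm) module" (structure)
begin

lemma span_submodule:
  assumes "X \<subseteq> carrier M"
  shows "submodule (span_module R M X) R M"
proof (rule submoduleI)
  show "span_module R M X \<subseteq> carrier M"
    using assms carrier_is_submodule by (auto simp: span_module_def)
  show "\<zero>\<^bsub>M\<^esub> \<in> span_module R M X"
    unfolding span_module_def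
    using subgroup.one_closed[OF submodule.axioms(1)] by fastforce
qed (use submoduleE in \<open>auto simp: span_module_def\<close>)

lemma span_base: "X \<subseteq> span_module R M X"
  by (auto simp: span_module_def)

lemma span_least: "submodule H R M \<Longrightarrow> X \<subseteq> H \<Longrightarrow> span_module R M X \<subseteq> H"
  by (auto simp: span_module_def)

lemma kernel_submodule:
  assumes "is_lin R M N f" "module R N"
  shows "submodule {x \<in> carrier M. f x = \<zero>\<^bsub>N\<^esub>} R M"
proof -
  interpret N: module R N by fact
  have z: "f \<zero>\<^bsub>M\<^esub> = \<zero>\<^bsub>N\<^esub>" by (rule is_lin_zero) (use assms module_axioms in auto)
  have i: "f (\<ominus>\<^bsub>M\<^esub> x) = \<zero>\<^bsub>N\<^esub>" if "x \<in> carrier M" "f x = \<zero>\<^bsub>N\<^esub>" for x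
    using is_lin_minus[OF assms(1) module_axioms assms(2), of "\<zero>\<^bsub>M\<^esub>" x] that z
    by (simp add: a_minus_def)
  show ?thesis
    using z i by (intro submoduleI) (auto simp: is_lin_add[OF assms(1)] is_lin_smult[OF assms(1)])
qed

text \<open>The kernel is a submodule, hence contains the span of any set of generators it contains.
  This is how a map is seen to descend to the tensor product and to the coinvariants.\<close>

lemma lin_vanishes_on_span:
  assumes "is_lin R M N f" "module R N" "X \<subseteq> carrier M" "\<And>x. x \<in> X \<Longrightarrow> f x = \<zero>\<^bsub>N\<^esub>"
    and "y \<in> span_module R M X"
  shows "f y = \<zero>\<^bsub>N\<^esub>"
  using span_least[OF kernel_submodule[OF assms(1,2)], of X] assms(3-5) by blast

context
  fixes H assumes H: "submodule H R M"
begin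

lemma submodule_abelian_subgroup: "abelian_subgroup H M"
  using abelian_subgroupI3 additive_subgroupI submodule.axioms(1)[OF H] M.abelian_group_axioms
  by blast

interpretation H: abelian_subgroup H M by (rule submodule_abelian_subgroup)

lemma quot_carrier: "carrier (quot_module M H) = {H +>\<^bsub>M\<^esub> x | x. x \<in> carrier M}"
  by (auto simp: quot_module_def A_RCOSETS_defs a_r_coset_defs)

lemma quot_zero: "\<zero>\<^bsub>quot_module M H\<^esub> = H"
  by (simp add: quot_module_def)

lemma quot_add: "x \<in> carrier M \<Longrightarrow> y \<in> carrier M \<Longrightarrow>
    (H +>\<^bsub>M\<^esub> x) \<oplus>\<^bsub>quot_module M H\<^esub> (H +>\<^bsub>M\<^esub> y) = H +>\<^bsub>M\<^esub> (x \<oplus>\<^bsub>M\<^esub> y)"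
  by (simp add: quot_module_def H.a_rcos_sum)

lemma coset_absorb: "h \<in> H \<Longrightarrow> x \<in> carrier M \<Longrightarrow> H +>\<^bsub>M\<^esub> (h \<oplus>\<^bsub>M\<^esub> x) = H +>\<^bsub>M\<^esub> x"
  using M.a_repr_independence[of "h \<oplus>\<^bsub>M\<^esub> x" H x] M.a_rcosI[of h H x] H.a_subset H.a_subgroup by auto

lemma coset_eqI:
  assumes "x \<in> carrier M" "y \<in> carrier M" "x \<ominus>\<^bsub>M\<^esub> y \<in> H"
  shows "H +>\<^bsub>M\<^esub> x = H +>\<^bsub>M\<^esub> y"
proof -
  have "x \<ominus>\<^bsub>M\<^esub> y \<oplus>\<^bsub>M\<^esub> y = x"
    using assms by (simp add: a_minus_def M.a_assoc M.l_neg)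
  then show ?thesis using coset_absorb[OF assms(3,2)] by simp
qed

text \<open>The scalar multiple in \<open>quot_module\<close> is a union over all representatives.
  They all produce the same coset, and since a coset is nonempty the union collapses to it.\<close>

lemma quot_smult:
  assumes "r \<in> carrier R" "x \<in> carrier M"
  shows "r \<odot>\<^bsub>quot_module M H\<^esub> (H +>\<^bsub>M\<^esub> x) = H +>\<^bsub>M\<^esub> (r \<odot>\<^bsub>M\<^esub> x)"
proof -
  have eq: "H +>\<^bsub>M\<^esub> (r \<odot>\<^bsub>M\<^esub> y) = H +>\<^bsub>M\<^esub> (r \<odot>\<^bsub>M\<^esub> x)" if y: "y \<in> H +>\<^bsub>M\<^esub> x" for y
  proof -
    obtain h where "h \<in> H" "y = h \<oplus>\<^bsub>M\<^esub> x" using y by (auto simp: a_r_coset_defs)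
    then show ?thesis
      using assms H.a_subset submodule.smult_closed[OF H]
      by (auto simp: smult_r_distr subset_iff intro!: coset_absorb)
  qed
  moreover have "H +>\<^bsub>M\<^esub> x \<noteq> {}" using H.a_rcos_self[OF assms(2)] by auto
  ultimately show ?thesis by (simp add: quot_module_def)
qed

lemma quot_is_module: "module R (quot_module M H)"
proof (rule moduleI)
  let ?Q = "quot_module M H"
  have z: "\<zero>\<^bsub>?Q\<^esub> = H +>\<^bsub>M\<^esub> \<zero>\<^bsub>M\<^esub>" by (simp add: quot_zero H.a_subset)
  show "abelian_group ?Q"
  proof (rule abelian_groupI)
    fix X Y Z assume "X \<in> carrier ?Q" "Y \<in> carrier ?Q" "Z \<in> carrier ?Q"
    then obtain x y z where "X = H +>\<^bsub>M\<^esub> x" "Y = H +>\<^bsub>M\<^esub> y" "Z = H +>\<^bsub>M\<^esub> z"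
      "x \<in> carrier M" "y \<in> carrier M" "z \<in> carrier M"
      unfolding quot_carrier by blast
    then show "X \<oplus>\<^bsub>?Q\<^esub> Y \<oplus>\<^bsub>?Q\<^esub> Z = X \<oplus>\<^bsub>?Q\<^esub> (Y \<oplus>\<^bsub>?Q\<^esub> Z)"
      by (simp add: quot_add M.a_assoc)
  next
    fix X Y assume "X \<in> carrier ?Q" "Y \<in> carrier ?Q"
    then obtain x y where xy: "X = H +>\<^bsub>M\<^esub> x" "Y = H +>\<^bsub>M\<^esub> y" "x \<in> carrier M" "y \<in> carrier M"
      unfolding quot_carrier by blast
    then show "X \<oplus>\<^bsub>?Q\<^esub> Y = Y \<oplus>\<^bsub>?Q\<^esub> X" by (simp add: quot_add M.a_comm)
    have "X \<oplus>\<^bsub>?Q\<^esub> Y = H +>\<^bsub>M\<^esub> (x \<oplus>\<^bsub>M\<^esub> y)" using xy by (simp add: quot_add)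
    then show "X \<oplus>\<^bsub>?Q\<^esub> Y \<in> carrier ?Q"
      unfolding quot_carrier using M.a_closed[OF xy(3,4)] by blast
  next
    fix X assume "X \<in> carrier ?Q"
    then obtain x where x: "X = H +>\<^bsub>M\<^esub> x" "x \<in> carrier M" unfolding quot_carrier by blast
    then show "\<zero>\<^bsub>?Q\<^esub> \<oplus>\<^bsub>?Q\<^esub> X = X" by (simp add: z quot_add)
    have "(H +>\<^bsub>M\<^esub> \<ominus>\<^bsub>M\<^esub> x) \<oplus>\<^bsub>?Q\<^esub> X = \<zero>\<^bsub>?Q\<^esub>"
      using x by (simp add: z quot_add M.l_neg)
    then show "\<exists>Y\<in>carrier ?Q. Y \<oplus>\<^bsub>?Q\<^esub> X = \<zero>\<^bsub>?Q\<^esub>"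
      unfolding quot_carrier using M.a_inv_closed[OF x(2)] by blast
  qed (unfold z quot_carrier, blast)
next
  let ?Q = "quot_module M H"
  fix r X assume r: "r \<in> carrier R" and "X \<in> carrier ?Q"
  then obtain x where x: "X = H +>\<^bsub>M\<^esub> x" "x \<in> carrier M" unfolding quot_carrier by blast
  then show "r \<odot>\<^bsub>?Q\<^esub> X \<in> carrier ?Q"
    using r unfolding quot_carrier by (auto simp: quot_smult)
next
  let ?Q = "quot_module M H"
  fix r s X assume rs: "r \<in> carrier R" "s \<in> carrier R" and "X \<in> carrier ?Q"
  then obtain x where x: "X = H +>\<^bsub>M\<^esub> x" "x \<in> carrier M" unfolding quot_carrier by blast
  show "(r \<oplus> s) \<odot>\<^bsub>?Q\<^esub> X = r \<odot>\<^bsub>?Q\<^esub> X \<oplus>\<^bsub>?Q\<^esub> s \<odot>\<^bsub>?Q\<^esub> X"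
    using rs x by (simp add: quot_smult quot_add smult_l_distr)
  show "(r \<otimes> s) \<odot>\<^bsub>?Q\<^esub> X = r \<odot>\<^bsub>?Q\<^esub> (s \<odot>\<^bsub>?Q\<^esub> X)"
    using rs x by (simp add: quot_smult smult_assoc1)
next
  let ?Q = "quot_module M H"
  fix r X Y assume r: "r \<in> carrier R" and "X \<in> carrier ?Q" "Y \<in> carrier ?Q"
  then obtain x y where xy: "X = H +>\<^bsub>M\<^esub> x" "Y = H +>\<^bsub>M\<^esub> y" "x \<in> carrier M" "y \<in> carrier M"
    unfolding quot_carrier by blast
  show "r \<odot>\<^bsub>?Q\<^esub> (X \<oplus>\<^bsub>?Q\<^esub> Y) = r \<odot>\<^bsub>?Q\<^esub> X \<oplus>\<^bsub>?Q\<^esub> r \<odot>\<^bsub>?Q\<^esub> Y"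
    using r xy by (simp add: quot_smult quot_add smult_r_distr)
next
  fix X assume "X \<in> carrier (quot_module M H)"
  then obtain x where x: "X = H +>\<^bsub>M\<^esub> x" "x \<in> carrier M" unfolding quot_carrier by blast
  then show "\<one> \<odot>\<^bsub>quot_module M H\<^esub> X = X" by (simp add: quot_smult)
qed (rule R.cring_axioms)

lemma is_lin_coset: "is_lin R M (quot_module M H) (\<lambda>x. H +>\<^bsub>M\<^esub> x)"
  by (rule is_linI) (auto simp: quot_carrier quot_add quot_smult)

lemma quot_lift:
  assumes "is_lin R M N f" "module R N" "\<And>h. h \<in> H \<Longrightarrow> f h = \<zero>\<^bsub>N\<^esub>"
  shows "\<exists>g. is_lin R (quot_module M H) N g \<and> (\<forall>x\<in>carrier M. g (H +>\<^bsub>M\<^esub> x) = f x)"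
proof -
  interpret N: module R N by fact
  \<comment> \<open>Any representative will do: two of them differ by an element of
    \<open>H\<close>, on which \<open>f\<close> vanishes.\<close>
  define g where "g X = f (SOME x. x \<in> X)" for X
  have g: "g (H +>\<^bsub>M\<^esub> x) = f x" if x: "x \<in> carrier M" for x
  proof -
    have "(SOME y. y \<in> H +>\<^bsub>M\<^esub> x) \<in> H +>\<^bsub>M\<^esub> x"
      using H.a_rcos_self[OF x] by (rule someI)
    then obtain h where h: "h \<in> H" "(SOME y. y \<in> H +>\<^bsub>M\<^esub> x) = h \<oplus>\<^bsub>M\<^esub> x"
      by (auto simp: a_r_coset_defs)
    have "f (h \<oplus>\<^bsub>M\<^esub> x) = f h \<oplus>\<^bsub>N\<^esub> f x"
      using h x H.a_subset by (intro is_lin_add[OF assms(1)]) auto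
    also have "\<dots> = f x" using assms(3)[OF h(1)] is_lin_closed[OF assms(1) x] by simp
    finally show ?thesis using h(2) by (simp add: g_def)
  qed
  have "is_lin R (quot_module M H) N g"
    by (rule is_linI)
      (auto simp: quot_carrier quot_add quot_smult g is_lin_closed[OF assms(1)]
        is_lin_add[OF assms(1)] is_lin_smult[OF assms(1)])
  with g show ?thesis by blast
qed

end

end

section \<open>Free modules\<close>

locale plain_cring = cring R for R :: "'r ring" (structure)
begin

lemma free_module_is_module: "module R (free_module R (X :: 'x set))"
proof (rule moduleI)
  have fin: "finite {x. f x \<oplus> g x \<noteq> \<zero>}" if "finite {x. f x \<noteq> \<zero>}" "finite {x. g x \<noteq> \<zero>}"
    for f g :: "'x \<Rightarrow> 'r"
    by (rule finite_subset[OF _ finite_UnI[OF that]]) auto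
  have fins: "finite {x. r \<otimes> f x \<noteq> \<zero>}" if "finite {x. f x \<noteq> \<zero>}" "r \<in> carrier R"
    for f :: "'x \<Rightarrow> 'r" and r
    by (rule finite_subset[OF _ that(1)]) (use that in auto)
  show "abelian_group (free_module R X)"
  proof (rule abelian_groupI)
    fix f assume f: "f \<in> carrier (free_module R X)"
    then have c: "f x \<in> carrier R" for x by (simp add: free_module_def)
    have "{x. \<ominus> f x \<noteq> \<zero>} = {x. f x \<noteq> \<zero>}" using c by (metis minus_zero minus_minus)
    then have "(\<lambda>x. \<ominus> f x) \<in> carrier (free_module R X)"
      using f by (simp add: free_module_def)
    moreover have "(\<lambda>x. \<ominus> f x) \<oplus>\<^bsub>free_module R X\<^esub> f = \<zero>\<^bsub>free_module R X\<^esub>"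
      using c by (simp add: free_module_def l_neg)
    ultimately show "\<exists>g\<in>carrier (free_module R X). g \<oplus>\<^bsub>free_module R X\<^esub> f = \<zero>\<^bsub>free_module R X\<^esub>"
      by blast
  qed (auto simp: free_module_def a_ac fin)
  show "r \<odot>\<^bsub>free_module R X\<^esub> f \<in> carrier (free_module R X)"
    if "r \<in> carrier R" "f \<in> carrier (free_module R X)" for r f
    using that by (auto simp: free_module_def fins)
qed (auto simp: free_module_def cring_axioms l_distr r_distr m_assoc)

lemma free_basis_closed: "x \<in> X \<Longrightarrow> free_basis R x \<in> carrier (free_module R X)"
  by (auto simp: free_basis_def free_module_def)

text \<open>Induction on the support: the value at one point is split off as a multiple of a basis
  vector, and the rest has smaller support. Scalars occur only in front of single basis vectors,
  which lets \<open>schur_induct\<close> absorb them into the operation.\<close>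

lemma free_module_induct [consumes 1, case_names zero add smult]:
  assumes f: "f \<in> carrier (free_module R X)"
    and zero: "Q (\<lambda>_. \<zero>)"
    and add: "\<And>f g. f \<in> carrier (free_module R X) \<Longrightarrow> g \<in> carrier (free_module R X) \<Longrightarrow> Q f \<Longrightarrow> Q g \<Longrightarrow>
      Q (f \<oplus>\<^bsub>free_module R X\<^esub> g)"
    and smult: "\<And>r x. r \<in> carrier R \<Longrightarrow> x \<in> X \<Longrightarrow> Q (r \<odot>\<^bsub>free_module R X\<^esub> free_basis R x)"
  shows "Q f"
proof -
  have "finite {x. f x \<noteq> \<zero>}" using f by (simp add: free_module_def)
  then show ?thesis using f
  proof (induct "{x. f x \<noteq> \<zero>}" arbitrary: f rule: finite_induct)
    case empty
    then have "f = (\<lambda>_. \<zero>)" by auto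
    then show ?case using zero by simp
  next
    case (insert x F)
    define g where "g = (\<lambda>y. if y = x then \<zero> else f y)"
    have c: "f y \<in> carrier R" for y using insert.prems by (simp add: free_module_def)
    have x: "x \<in> X" using insert.prems insert.hyps(4) by (auto simp: free_module_def)
    have F: "F = {y. g y \<noteq> \<zero>}" using insert.hyps(2,4) by (auto simp: g_def)
    have gc: "g \<in> carrier (free_module R X)"
      using insert.prems insert.hyps(1) F by (auto simp: free_module_def g_def)
    have "f = (f x \<odot>\<^bsub>free_module R X\<^esub> free_basis R x) \<oplus>\<^bsub>free_module R X\<^esub> g"
      using c by (auto simp: free_module_def free_basis_def g_def)
    moreover have "f x \<odot>\<^bsub>free_module R X\<^esub> free_basis R x \<in> carrier (free_module R X)"
      using module.smult_closed[OF free_module_is_module] c free_basis_closed[OF x] by blast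
    ultimately show ?case
      using add[OF _ gc smult[OF c x] insert.hyps(3)[OF F gc]] by metis
  qed
qed

lemma free_lift:
  assumes N: "module R N" and \<phi>: "\<And>x. x \<in> X \<Longrightarrow> \<phi> x \<in> carrier N"
  shows "\<exists>g. is_lin R (free_module R X) N g \<and> (\<forall>x\<in>X. g (free_basis R x) = \<phi> x)"
proof -
  interpret N: module R N by (rule N)
  define g where "g f = (\<Oplus>\<^bsub>N\<^esub>x\<in>{x. f x \<noteq> \<zero>}. f x \<odot>\<^bsub>N\<^esub> \<phi> x)" for f
  \<comment> \<open>The support depends on the function. Allowing any finite index set between the
    support and \<open>X\<close> makes it possible to add two functions over a common index
    set.\<close>
  have sup: "g f = (\<Oplus>\<^bsub>N\<^esub>x\<in>A. f x \<odot>\<^bsub>N\<^esub> \<phi> x)"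
    if "finite A" "A \<subseteq> X" "{x. f x \<noteq> \<zero>} \<subseteq> A" "f \<in> carrier (free_module R X)" for f A
    unfolding g_def
    using that \<phi> by (intro N.add.finprod_mono_neutral_cong_left) (auto simp: free_module_def subset_iff)
  have supX: "x \<in> X" if "f x \<noteq> \<zero>" "f \<in> carrier (free_module R X)" for f x
    using that by (auto simp: free_module_def)
  have fc: "f x \<in> carrier R" if "f \<in> carrier (free_module R X)" for f x
    using that by (auto simp: free_module_def)
  have fin: "finite {x. f x \<noteq> \<zero>}" if "f \<in> carrier (free_module R X)" for f
    using that by (auto simp: free_module_def)
  have lin: "is_lin R (free_module R X) N g"
  proof (rule is_linI)
    fix f assume f: "f \<in> carrier (free_module R X)"
    then show "g f \<in> carrier N"
      using \<phi> supX fc by (auto simp: g_def intro!: N.finsum_closed)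
    fix r assume r: "r \<in> carrier R"
    let ?A = "{x. f x \<noteq> \<zero>}"
    have "g (r \<odot>\<^bsub>free_module R X\<^esub> f) = (\<Oplus>\<^bsub>N\<^esub>x\<in>?A. (r \<otimes> f x) \<odot>\<^bsub>N\<^esub> \<phi> x)"
      using module.smult_closed[OF free_module_is_module r f] f r
      by (subst sup[of "?A"]) (auto simp: free_module_def)
    also have "\<dots> = (\<Oplus>\<^bsub>N\<^esub>x\<in>?A. r \<odot>\<^bsub>N\<^esub> (f x \<odot>\<^bsub>N\<^esub> \<phi> x))"
      using \<phi> f r supX fc by (intro N.finsum_cong') (auto simp: N.smult_assoc1)
    also have "\<dots> = r \<odot>\<^bsub>N\<^esub> g f"
      unfolding g_def using \<phi> f r supX fc fin
      by (intro N.finsum_smult_ldistr[symmetric]) auto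
    finally show "g (r \<odot>\<^bsub>free_module R X\<^esub> f) = r \<odot>\<^bsub>N\<^esub> g f" .
  next
    fix f f' assume f: "f \<in> carrier (free_module R X)" "f' \<in> carrier (free_module R X)"
    let ?A = "{x. f x \<noteq> \<zero>} \<union> {x. f' x \<noteq> \<zero>}"
    have A: "finite ?A" "?A \<subseteq> X" using f by (auto simp: free_module_def)
    have "g (f \<oplus>\<^bsub>free_module R X\<^esub> f') = (\<Oplus>\<^bsub>N\<^esub>x\<in>?A. (f x \<oplus> f' x) \<odot>\<^bsub>N\<^esub> \<phi> x)"
      using abelian_monoid.a_closed[OF abelian_group.axioms(1)[OF module.axioms(2)[OF free_module_is_module]] f] A
      by (subst sup[of "?A"]) (auto simp: free_module_def)
    also have "\<dots> = (\<Oplus>\<^bsub>N\<^esub>x\<in>?A. f x \<odot>\<^bsub>N\<^esub> \<phi> x \<oplus>\<^bsub>N\<^esub> f' x \<odot>\<^bsub>N\<^esub> \<phi> x)"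
      using \<phi> f A fc by (intro N.finsum_cong') (auto simp: N.smult_l_distr subset_iff)
    also have "\<dots> = g f \<oplus>\<^bsub>N\<^esub> g f'"
      using \<phi> f A fc sup[OF A(1,2) _ f(1)] sup[OF A(1,2) _ f(2)]
      by (auto simp: subset_iff intro!: N.finsum_addf)
    finally show "g (f \<oplus>\<^bsub>free_module R X\<^esub> f') = g f \<oplus>\<^bsub>N\<^esub> g f'" .
  qed
  have "g (free_basis R x) = \<phi> x" if x: "x \<in> X" for x
  proof -
    have "g (free_basis R x) = (\<Oplus>\<^bsub>N\<^esub>y\<in>{x}. free_basis R x y \<odot>\<^bsub>N\<^esub> \<phi> y)"
      using x free_basis_closed[OF x] by (intro sup) (auto simp: free_basis_def)
    also have "\<dots> = \<phi> x" using \<phi>[OF x] by (simp add: free_basis_def)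
    finally show ?thesis .
  qed
  with lin show ?thesis by blast
qed

lemma is_lin_free_eqI:
  assumes "is_lin R (free_module R X) N f" "is_lin R (free_module R X) N g" "module R N"
    and "\<And>x. x \<in> X \<Longrightarrow> f (free_basis R x) = g (free_basis R x)"
    and "y \<in> carrier (free_module R X)"
  shows "f y = g y"
  using assms(5)
proof (induct rule: free_module_induct)
  case zero
  have "(\<lambda>_. \<zero>) = \<zero>\<^bsub>free_module R X\<^esub>" by (simp add: free_module_def)
  then show ?case using assms(1-3) free_module_is_module by (metis is_lin_zero)
next
  case (add f' g')
  then show ?case by (simp add: is_lin_add[OF assms(1)] is_lin_add[OF assms(2)])
next
  case (smult r x)
  then show ?case
    by (simp add: is_lin_smult[OF assms(1)] is_lin_smult[OF assms(2)] free_basis_closed assms(4))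
qed

section \<open>Direct sums\<close>

lemma direct_sum_is_module:
  assumes "\<And>i. module R (M i)"
  shows "module R (direct_sum M)"
proof (rule moduleI)
  interpret M: module R "M i" for i by (rule assms)
  have fin: "finite {i. f i \<oplus>\<^bsub>M i\<^esub> g i \<noteq> \<zero>\<^bsub>M i\<^esub>}"
    if "finite {i. f i \<noteq> \<zero>\<^bsub>M i\<^esub>}" "finite {i. g i \<noteq> \<zero>\<^bsub>M i\<^esub>}" for f g
    by (rule finite_subset[OF _ finite_UnI[OF that]]) auto
  have fins: "finite {i. r \<odot>\<^bsub>M i\<^esub> f i \<noteq> \<zero>\<^bsub>M i\<^esub>}" if "finite {i. f i \<noteq> \<zero>\<^bsub>M i\<^esub>}" "r \<in> carrier R" for f r
    by (rule finite_subset[OF _ that(1)]) (use that in auto)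
  show "abelian_group (direct_sum M)"
  proof (rule abelian_groupI)
    fix f assume f: "f \<in> carrier (direct_sum M)"
    then have c: "f i \<in> carrier (M i)" for i by (simp add: direct_sum_def)
    have "{i. \<ominus>\<^bsub>M i\<^esub> f i \<noteq> \<zero>\<^bsub>M i\<^esub>} \<subseteq> {i. f i \<noteq> \<zero>\<^bsub>M i\<^esub>}"
      using M.M.add.inv_one by (fastforce simp: a_inv_def)
    then have "finite {i. \<ominus>\<^bsub>M i\<^esub> f i \<noteq> \<zero>\<^bsub>M i\<^esub>}"
      using f by (auto simp: direct_sum_def intro: finite_subset)
    then have "(\<lambda>i. \<ominus>\<^bsub>M i\<^esub> f i) \<in> carrier (direct_sum M)"
      using f by (simp add: direct_sum_def)
    moreover have "(\<lambda>i. \<ominus>\<^bsub>M i\<^esub> f i) \<oplus>\<^bsub>direct_sum M\<^esub> f = \<zero>\<^bsub>direct_sum M\<^esub>"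
      using c by (simp add: direct_sum_def M.M.l_neg)
    ultimately show "\<exists>g\<in>carrier (direct_sum M). g \<oplus>\<^bsub>direct_sum M\<^esub> f = \<zero>\<^bsub>direct_sum M\<^esub>"
      by blast
  qed (auto simp: direct_sum_def M.M.a_ac fin)
  show "r \<odot>\<^bsub>direct_sum M\<^esub> f \<in> carrier (direct_sum M)"
    if "r \<in> carrier R" "f \<in> carrier (direct_sum M)" for r f
    using that by (auto simp: direct_sum_def fins)
qed (auto simp: direct_sum_def cring_axioms module.smult_l_distr[OF assms] module.smult_r_distr[OF assms]
  module.smult_assoc1[OF assms] module.smult_one[OF assms])

definition summand :: "('i \<Rightarrow> ('r, 'a) module) \<Rightarrow> 'i \<Rightarrow> 'a \<Rightarrow> 'i \<Rightarrow> 'a" where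
  "summand M i x = (\<lambda>j. if j = i then x else \<zero>\<^bsub>M j\<^esub>)"

lemma is_lin_summand:
  assumes "\<And>i. module R (M i)"
  shows "is_lin R (M i) (direct_sum M) (summand M i)"
proof (rule is_linI)
  interpret M: module R "M i" for i by (rule assms)
  show "summand M i x \<in> carrier (direct_sum M)" if "x \<in> carrier (M i)" for x
    using that by (auto simp: summand_def direct_sum_def)
qed (auto simp: summand_def direct_sum_def fun_eq_iff module.smult_r_null[OF assms]
   abelian_monoid.l_zero[OF abelian_group.axioms(1)[OF module.axioms(2)[OF assms]]]
   abelian_monoid.zero_closed[OF abelian_group.axioms(1)[OF module.axioms(2)[OF assms]]])

lemma direct_sum_induct [consumes 2, case_names zero add summand]:
  assumes M: "\<And>i. module R (M i)" and s: "s \<in> carrier (direct_sum M)"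
    and zero: "Q \<zero>\<^bsub>direct_sum M\<^esub>"
    and add: "\<And>s t. s \<in> carrier (direct_sum M) \<Longrightarrow> t \<in> carrier (direct_sum M) \<Longrightarrow> Q s \<Longrightarrow> Q t \<Longrightarrow>
      Q (s \<oplus>\<^bsub>direct_sum M\<^esub> t)"
    and summand: "\<And>i x. x \<in> carrier (M i) \<Longrightarrow> Q (summand M i x)"
  shows "Q s"
proof -
  interpret M: module R "M i" for i by (rule M)
  have "finite {i. s i \<noteq> \<zero>\<^bsub>M i\<^esub>}" using s by (simp add: direct_sum_def)
  then show ?thesis using s
  proof (induct "{i. s i \<noteq> \<zero>\<^bsub>M i\<^esub>}" arbitrary: s rule: finite_induct)
    case empty
    then have "s = \<zero>\<^bsub>direct_sum M\<^esub>" by (auto simp: direct_sum_def)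
    then show ?case using zero by simp
  next
    case (insert i F)
    define t where "t = (\<lambda>j. if j = i then \<zero>\<^bsub>M j\<^esub> else s j)"
    have c: "s j \<in> carrier (M j)" for j using insert.prems by (simp add: direct_sum_def)
    have F: "F = {j. t j \<noteq> \<zero>\<^bsub>M j\<^esub>}" using insert.hyps(2,4) by (auto simp: t_def)
    have tc: "t \<in> carrier (direct_sum M)"
      using insert.prems insert.hyps(1) F by (auto simp: direct_sum_def t_def)
    have "s = summand M i (s i) \<oplus>\<^bsub>direct_sum M\<^esub> t"
      using c by (auto simp: direct_sum_def summand_def t_def)
    moreover have "summand M i (s i) \<in> carrier (direct_sum M)"
      using is_lin_closed[OF is_lin_summand[of M, OF M] c] .
    ultimately show ?case
      using add[OF _ tc summand[OF c] insert.hyps(3)[OF F tc]] by metis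
  qed
qed

lemma direct_sum_lift:
  assumes M: "\<And>i. module R (M i)" and N: "module R N" and F: "\<And>i. is_lin R (M i) N (F i)"
  shows "\<exists>g. is_lin R (direct_sum M) N g \<and> (\<forall>i. \<forall>x\<in>carrier (M i). g (summand M i x) = F i x)"
proof -
  interpret M: module R "M i" for i by (rule M)
  interpret N: module R N by (rule N)
  define g where "g s = (\<Oplus>\<^bsub>N\<^esub>i\<in>{i. s i \<noteq> \<zero>\<^bsub>M i\<^esub>}. F i (s i))" for s
  note Fz = is_lin_zero[OF F M N] and Fc = is_lin_closed[OF F]
  have sup: "g s = (\<Oplus>\<^bsub>N\<^esub>i\<in>A. F i (s i))"
    if "finite A" "{i. s i \<noteq> \<zero>\<^bsub>M i\<^esub>} \<subseteq> A" "s \<in> carrier (direct_sum M)" for s A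
    unfolding g_def
    using that Fz Fc by (intro N.add.finprod_mono_neutral_cong_left) (auto simp: direct_sum_def)
  interpret DS: module R "direct_sum M" by (rule direct_sum_is_module[OF M])
  have lin: "is_lin R (direct_sum M) N g"
  proof (rule is_linI)
    fix s assume s: "s \<in> carrier (direct_sum M)"
    then show "g s \<in> carrier N"
      using Fc by (auto simp: g_def direct_sum_def intro!: N.finsum_closed)
    fix r assume r: "r \<in> carrier R"
    let ?A = "{i. s i \<noteq> \<zero>\<^bsub>M i\<^esub>}"
    have "g (r \<odot>\<^bsub>direct_sum M\<^esub> s) = (\<Oplus>\<^bsub>N\<^esub>i\<in>?A. F i (r \<odot>\<^bsub>M i\<^esub> s i))"
      using DS.smult_closed[OF r s] s r
      by (subst sup[of "?A"]) (auto simp: direct_sum_def)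
    also have "\<dots> = (\<Oplus>\<^bsub>N\<^esub>i\<in>?A. r \<odot>\<^bsub>N\<^esub> F i (s i))"
      using s r Fc by (intro N.finsum_cong') (auto simp: direct_sum_def is_lin_smult[OF F])
    also have "\<dots> = r \<odot>\<^bsub>N\<^esub> g s"
      unfolding g_def using s r Fc by (intro N.finsum_smult_ldistr[symmetric]) (auto simp: direct_sum_def)
    finally show "g (r \<odot>\<^bsub>direct_sum M\<^esub> s) = r \<odot>\<^bsub>N\<^esub> g s" .
  next
    fix s t assume s: "s \<in> carrier (direct_sum M)" "t \<in> carrier (direct_sum M)"
    let ?A = "{i. s i \<noteq> \<zero>\<^bsub>M i\<^esub>} \<union> {i. t i \<noteq> \<zero>\<^bsub>M i\<^esub>}"
    have A: "finite ?A" using s by (auto simp: direct_sum_def)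
    have "g (s \<oplus>\<^bsub>direct_sum M\<^esub> t) = (\<Oplus>\<^bsub>N\<^esub>i\<in>?A. F i (s i \<oplus>\<^bsub>M i\<^esub> t i))"
      using DS.M.a_closed[OF s] A
      by (subst sup[of "?A"]) (auto simp: direct_sum_def)
    also have "\<dots> = (\<Oplus>\<^bsub>N\<^esub>i\<in>?A. F i (s i) \<oplus>\<^bsub>N\<^esub> F i (t i))"
      using s Fc by (intro N.finsum_cong') (auto simp: direct_sum_def is_lin_add[OF F])
    also have "\<dots> = g s \<oplus>\<^bsub>N\<^esub> g t"
      using s Fc sup[OF A _ s(1)] sup[OF A _ s(2)]
      by (auto simp: direct_sum_def intro!: N.finsum_addf)
    finally show "g (s \<oplus>\<^bsub>direct_sum M\<^esub> t) = g s \<oplus>\<^bsub>N\<^esub> g t" .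
  qed
  have "g (summand M i x) = F i x" if x: "x \<in> carrier (M i)" for i x
  proof -
    have "g (summand M i x) = (\<Oplus>\<^bsub>N\<^esub>j\<in>{i}. F j (summand M i x j))"
      using is_lin_closed[OF is_lin_summand[of M, OF M] x] by (intro sup) (auto simp: summand_def)
    also have "\<dots> = F i x" using Fc[OF x] by (simp add: summand_def)
    finally show ?thesis .
  qed
  with lin show ?thesis by blast
qed

end

section \<open>The universal property of \<open>S(P,V)\<close>\<close>

lemma set_list_update_closed: "set vs \<subseteq> A \<Longrightarrow> v \<in> A \<Longrightarrow> set (vs[i := v]) \<subseteq> A"
  using set_update_subset_insert[of vs i v] by auto

text \<open>The varying slot is marked by splitting the list, so no index bound is carried along and
  inductions on lists fit directly. Lists of other lengths are unconstrained, because the arity is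
  not visible in \<open>L\<close>; for \<open>n = 0\<close> the condition is empty.\<close>

definition multilin ::
  "'r ring \<Rightarrow> ('r, 'v) module \<Rightarrow> ('r, 'b) module \<Rightarrow> nat \<Rightarrow> ('v list \<Rightarrow> 'b) \<Rightarrow> bool" where
  "multilin R V N n L \<longleftrightarrow> (\<forall>as bs. Suc (length as + length bs) = n \<longrightarrow>
     set as \<subseteq> carrier V \<longrightarrow> set bs \<subseteq> carrier V \<longrightarrow> is_lin R V N (\<lambda>v. L (as @ v # bs)))"

lemma multilinI:
  assumes "\<And>as bs. Suc (length as + length bs) = n \<Longrightarrow> set as \<subseteq> carrier V \<Longrightarrow> set bs \<subseteq> carrier V \<Longrightarrow>
    is_lin R V N (\<lambda>v. L (as @ v # bs))"
  shows "multilin R V N n L"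
  using assms by (simp add: multilin_def)

lemma multilinD:
  "multilin R V N n L \<Longrightarrow> Suc (length as + length bs) = n \<Longrightarrow> set as \<subseteq> carrier V \<Longrightarrow> set bs \<subseteq> carrier V \<Longrightarrow>
    is_lin R V N (\<lambda>v. L (as @ v # bs))"
  by (simp add: multilin_def)

lemma multilin_comp: "multilin R V N n L \<Longrightarrow> is_lin R N N' f \<Longrightarrow> multilin R V N' n (\<lambda>vs. f (L vs))"
  by (auto intro!: multilinI dest: multilinD intro: is_lin_comp)

lemma multilin_map:
  assumes L: "multilin R W N n L" and f: "is_lin R V W f"
  shows "multilin R V N n (\<lambda>vs. L (map f vs))"
proof (rule multilinI)
  fix as bs assume "Suc (length as + length bs) = n" and c: "set as \<subseteq> carrier V" "set bs \<subseteq> carrier V"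
  then have "is_lin R W N (\<lambda>v. L (map f as @ v # map f bs))"
    by (intro multilinD[OF L]) (auto intro: is_lin_closed[OF f])
  from is_lin_comp[OF f this] show "is_lin R V N (\<lambda>v. L (map f (as @ v # bs)))" by simp
qed

text \<open>\<phi> takes no arity argument: as in \<open>schur_elt\<close>, the length of the list
  plays that role. The invariance clause uses the same convention for \<sigma> as
  \<open>coinv_sub\<close>.\<close>

definition schur_form ::
  "'r ring \<Rightarrow> ('r, 'p) operad_data \<Rightarrow> ('r, 'v) module \<Rightarrow> ('r, 'b) module \<Rightarrow> ('p \<Rightarrow> 'v list \<Rightarrow> 'b) \<Rightarrow> bool" where
  "schur_form R P V N \<phi> \<longleftrightarrow>
     (\<forall>vs. set vs \<subseteq> carrier V \<longrightarrow> is_lin R (ops P (length vs)) N (\<lambda>\<mu>. \<phi> \<mu> vs)) \<and>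
     (\<forall>n. \<forall>\<mu>\<in>carrier (ops P n). multilin R V N n (\<phi> \<mu>)) \<and>
     (\<forall>\<sigma> vs. \<forall>\<mu>\<in>carrier (ops P (length vs)). set vs \<subseteq> carrier V \<longrightarrow> \<sigma> permutes {..<length vs} \<longrightarrow>
        \<phi> (act P (length vs) \<mu> \<sigma>) (permute_list \<sigma> vs) = \<phi> \<mu> vs)"

lemma schur_formI:
  assumes "\<And>vs. set vs \<subseteq> carrier V \<Longrightarrow> is_lin R (ops P (length vs)) N (\<lambda>\<mu>. \<phi> \<mu> vs)"
    and "\<And>n \<mu>. \<mu> \<in> carrier (ops P n) \<Longrightarrow> multilin R V N n (\<phi> \<mu>)"
    and "\<And>\<sigma> vs \<mu>. \<mu> \<in> carrier (ops P (length vs)) \<Longrightarrow> set vs \<subseteq> carrier V \<Longrightarrow> \<sigma> permutes {..<length vs} \<Longrightarrow>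
        \<phi> (act P (length vs) \<mu> \<sigma>) (permute_list \<sigma> vs) = \<phi> \<mu> vs"
  shows "schur_form R P V N \<phi>"
  using assms by (simp add: schur_form_def)

lemma schur_formD:
  assumes "schur_form R P V N \<phi>"
  shows "set vs \<subseteq> carrier V \<Longrightarrow> is_lin R (ops P (length vs)) N (\<lambda>\<mu>. \<phi> \<mu> vs)"
    and "\<mu> \<in> carrier (ops P n) \<Longrightarrow> multilin R V N n (\<phi> \<mu>)"
    and "\<mu> \<in> carrier (ops P (length vs)) \<Longrightarrow> set vs \<subseteq> carrier V \<Longrightarrow> \<sigma> permutes {..<length vs} \<Longrightarrow>
        \<phi> (act P (length vs) \<mu> \<sigma>) (permute_list \<sigma> vs) = \<phi> \<mu> vs"
    and "\<mu> \<in> carrier (ops P (length vs)) \<Longrightarrow> set vs \<subseteq> carrier V \<Longrightarrow> \<phi> \<mu> vs \<in> carrier N"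
  using assms by (auto simp: schur_form_def intro: is_lin_closed)

lemma schur_form_map:
  assumes "schur_form R P W N \<phi>" "is_lin R V W f"
  shows "schur_form R P V N (\<lambda>\<mu> vs. \<phi> \<mu> (map f vs))"
proof (rule schur_formI)
  fix vs assume vs: "set vs \<subseteq> carrier V"
  then have c: "set (map f vs) \<subseteq> carrier W" using is_lin_closed[OF assms(2)] by auto
  from schur_formD(1)[OF assms(1) c] show "is_lin R (ops P (length vs)) N (\<lambda>\<mu>. \<phi> \<mu> (map f vs))" by simp
  fix \<mu> \<sigma> assume "\<mu> \<in> carrier (ops P (length vs))" "\<sigma> permutes {..<length vs}"
  with schur_formD(3)[OF assms(1) _ c, of \<mu> \<sigma>]
  show "\<phi> (act P (length vs) \<mu> \<sigma>) (map f (permute_list \<sigma> vs)) = \<phi> \<mu> (map f vs)"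
    by (simp add: permute_list_map)
qed (rule multilin_map[OF schur_formD(2)[OF assms(1)] assms(2)])

sublocale operad \<subseteq> plain_cring ..

section \<open>Tensor products, coinvariants and the generators of S(P,V)\<close>

context operad
begin

context
  fixes V :: "('r, 'v) module" assumes V: "module R V"
begin

interpretation V: module R V by (rule V)
interpretation O: module R "ops P n" for n by (rule ops_module)

private abbreviation (input) "FF n \<equiv> free_module R (tensor_gens (ops P n) V n)"
private abbreviation (input) "TS n \<equiv> tensor_sub R (ops P n) V n"
private abbreviation (input) "TT n \<equiv> tensor R (ops P n) V n"
private abbreviation (input) "CS n \<equiv> coinv_sub R P V n"
private abbreviation (input) "PT n \<equiv> pure_tensor R (ops P n) V n"

interpretation F: plain_module R "FF n" for n
  by (intro plain_module.intro free_module_is_module)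

lemma tensor_gens_iff: "(\<mu>, vs) \<in> tensor_gens (ops P n) V n \<longleftrightarrow>
    \<mu> \<in> carrier (ops P n) \<and> length vs = n \<and> set vs \<subseteq> carrier V"
  by (simp add: tensor_gens_def)

lemma tensor_rels_subset: "tensor_rels R (ops P n) V n \<subseteq> carrier (FF n)"
  unfolding tensor_rels_def Let_def
  by (auto simp: tensor_gens_iff set_list_update_closed
      intro!: F.M.minus_closed F.M.a_closed F.smult_closed free_basis_closed)

lemma tensor_sub_submodule: "submodule (TS n) R (FF n)"
  unfolding tensor_sub_def by (rule F.span_submodule[OF tensor_rels_subset])

lemma tensor_is_module: "module R (TT n)"
  unfolding tensor_def by (rule F.quot_is_module[OF tensor_sub_submodule])

interpretation T: plain_module R "TT n" for n
  by (intro plain_module.intro tensor_is_module)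

lemma is_lin_free_to_tensor: "is_lin R (FF n) (TT n) (\<lambda>x. TS n +>\<^bsub>FF n\<^esub> x)"
  unfolding tensor_def by (rule F.is_lin_coset[OF tensor_sub_submodule])

lemma pure_tensor_closed: "\<mu> \<in> carrier (ops P n) \<Longrightarrow> length vs = n \<Longrightarrow> set vs \<subseteq> carrier V \<Longrightarrow> PT n \<mu> vs \<in> carrier (TT n)"
  unfolding pure_tensor_def
  by (intro is_lin_closed[OF is_lin_free_to_tensor] free_basis_closed) (simp add: tensor_gens_iff)

lemma tensor_relI: 
  assumes "x \<ominus>\<^bsub>FF n\<^esub> y \<in> tensor_rels R (ops P n) V n" "x \<in> carrier (FF n)" "y \<in> carrier (FF n)"
  shows "TS n +>\<^bsub>FF n\<^esub> x = TS n +>\<^bsub>FF n\<^esub> y"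
proof -
  have "x \<ominus>\<^bsub>FF n\<^esub> y \<in> TS n"
    unfolding tensor_sub_def using assms(1) F.span_base by blast
  then show ?thesis using F.coset_eqI[OF tensor_sub_submodule assms(2,3)] by blast
qed

lemma is_lin_pure_tensor_op:
  assumes "length vs = n" "set vs \<subseteq> carrier V"
  shows "is_lin R (ops P n) (TT n) (\<lambda>\<mu>. PT n \<mu> vs)"
proof (rule is_linI)
  let ?b = "\<lambda>\<mu>. free_basis R (\<mu>, vs)"
  have b: "?b \<mu> \<in> carrier (FF n)" if "\<mu> \<in> carrier (ops P n)" for \<mu>
    using assms that by (intro free_basis_closed) (simp add: tensor_gens_iff)
  fix \<mu> assume \<mu>: "\<mu> \<in> carrier (ops P n)"
  then show "PT n \<mu> vs \<in> carrier (TT n)" using assms by (rule pure_tensor_closed)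
  {
    fix \<nu> assume \<nu>: "\<nu> \<in> carrier (ops P n)"
    have "?b (\<mu> \<oplus>\<^bsub>ops P n\<^esub> \<nu>) \<ominus>\<^bsub>FF n\<^esub> (?b \<mu> \<oplus>\<^bsub>FF n\<^esub> ?b \<nu>) \<in> tensor_rels R (ops P n) V n"
      unfolding tensor_rels_def Let_def
      by (rule UnI1, rule UnI1, rule UnI1, rule CollectI, intro exI conjI, rule refl)
        (use \<mu> \<nu> assms in \<open>simp_all add: tensor_gens_iff\<close>)
    from tensor_relI[OF this]
    show "PT n (\<mu> \<oplus>\<^bsub>ops P n\<^esub> \<nu>) vs = PT n \<mu> vs \<oplus>\<^bsub>TT n\<^esub> PT n \<nu> vs"
      unfolding pure_tensor_def using b \<mu> \<nu> by (simp add: is_lin_add[OF is_lin_free_to_tensor])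
  }
  fix r assume r: "r \<in> carrier R"
  have "?b (r \<odot>\<^bsub>ops P n\<^esub> \<mu>) \<ominus>\<^bsub>FF n\<^esub> (r \<odot>\<^bsub>FF n\<^esub> ?b \<mu>) \<in> tensor_rels R (ops P n) V n"
    unfolding tensor_rels_def Let_def
    by (rule UnI1, rule UnI1, rule UnI2, rule CollectI, intro exI conjI, rule refl)
      (use \<mu> r assms in \<open>simp_all add: tensor_gens_iff\<close>)
  from tensor_relI[OF this]
  show "PT n (r \<odot>\<^bsub>ops P n\<^esub> \<mu>) vs = r \<odot>\<^bsub>TT n\<^esub> PT n \<mu> vs"
    unfolding pure_tensor_def using b \<mu> r by (simp add: is_lin_smult[OF is_lin_free_to_tensor])
qed

lemma multilin_pure_tensor:
  assumes \<mu>: "\<mu> \<in> carrier (ops P n)"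
  shows "multilin R V (TT n) n (PT n \<mu>)"
proof (intro multilinI is_linI)
  fix as bs assume n: "Suc (length as + length bs) = n" and c: "set as \<subseteq> carrier V" "set bs \<subseteq> carrier V"
  let ?b = "\<lambda>v. free_basis R (\<mu>, as @ v # bs)"
  have b: "?b v \<in> carrier (FF n)" if "v \<in> carrier V" for v
    using n c \<mu> that by (intro free_basis_closed) (simp add: tensor_gens_iff)
  fix v assume v: "v \<in> carrier V"
  then show "PT n \<mu> (as @ v # bs) \<in> carrier (TT n)" using n c \<mu> by (intro pure_tensor_closed) auto
  \<comment> \<open>The relations in \<open>tensor_rels\<close> are phrased with list updates,
    \<open>multilin\<close> with split lists; updating position \<open>length as\<close> translates
    between the two.\<close>
  have upd: "as @ w # bs = (as @ v # bs)[length as := w]" for w by simp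
  {
    fix w assume w: "w \<in> carrier V"
    have "?b (v \<oplus>\<^bsub>V\<^esub> w) \<ominus>\<^bsub>FF n\<^esub> (?b v \<oplus>\<^bsub>FF n\<^esub> ?b w) \<in> tensor_rels R (ops P n) V n"
      unfolding tensor_rels_def Let_def
    proof (rule UnI1, rule UnI2, rule CollectI, intro exI conjI)
      show "?b (v \<oplus>\<^bsub>V\<^esub> w) \<ominus>\<^bsub>FF n\<^esub> (?b v \<oplus>\<^bsub>FF n\<^esub> ?b w) =
         free_basis R (\<mu>, (as @ v # bs)[length as := v \<oplus>\<^bsub>V\<^esub> w]) \<ominus>\<^bsub>FF n\<^esub>
         (free_basis R (\<mu>, (as @ v # bs)[length as := v]) \<oplus>\<^bsub>FF n\<^esub> free_basis R (\<mu>, (as @ v # bs)[length as := w]))"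
        by simp
    qed (use n c v w \<mu> in \<open>auto simp: tensor_gens_iff\<close>)
    from tensor_relI[OF this]
    show "PT n \<mu> (as @ (v \<oplus>\<^bsub>V\<^esub> w) # bs) = PT n \<mu> (as @ v # bs) \<oplus>\<^bsub>TT n\<^esub> PT n \<mu> (as @ w # bs)"
      unfolding pure_tensor_def using b v w by (simp add: is_lin_add[OF is_lin_free_to_tensor])
  }
  fix r assume r: "r \<in> carrier R"
  have "?b (r \<odot>\<^bsub>V\<^esub> v) \<ominus>\<^bsub>FF n\<^esub> (r \<odot>\<^bsub>FF n\<^esub> ?b v) \<in> tensor_rels R (ops P n) V n"
    unfolding tensor_rels_def Let_def
  proof (rule UnI2, rule CollectI, intro exI conjI)
    show "?b (r \<odot>\<^bsub>V\<^esub> v) \<ominus>\<^bsub>FF n\<^esub> (r \<odot>\<^bsub>FF n\<^esub> ?b v) =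
       free_basis R (\<mu>, (as @ v # bs)[length as := r \<odot>\<^bsub>V\<^esub> v]) \<ominus>\<^bsub>FF n\<^esub>
       (r \<odot>\<^bsub>FF n\<^esub> free_basis R (\<mu>, (as @ v # bs)[length as := v]))"
      by simp
  qed (use n c v r \<mu> in \<open>auto simp: tensor_gens_iff\<close>)
  from tensor_relI[OF this]
  show "PT n \<mu> (as @ (r \<odot>\<^bsub>V\<^esub> v) # bs) = r \<odot>\<^bsub>TT n\<^esub> PT n \<mu> (as @ v # bs)"
    unfolding pure_tensor_def using b v r by (simp add: is_lin_smult[OF is_lin_free_to_tensor])
qed

lemma act_closed: "\<mu> \<in> carrier (ops P n) \<Longrightarrow> \<sigma> permutes {..<n} \<Longrightarrow> act P n \<mu> \<sigma> \<in> carrier (ops P n)"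
  using is_lin_closed[OF is_lin_restrictD[OF act_lin ops_module]] by blast

lemma coinv_rels_subset:
  "{PT n (act P n \<mu> \<sigma>) (permute_list \<sigma> vs) \<ominus>\<^bsub>TT n\<^esub> PT n \<mu> vs | \<mu> vs \<sigma>.
     (\<mu>, vs) \<in> tensor_gens (ops P n) V n \<and> \<sigma> permutes {..<n}} \<subseteq> carrier (TT n)"
  by (auto simp: tensor_gens_iff intro!: T.M.minus_closed pure_tensor_closed act_closed)

lemma coinv_sub_submodule: "submodule (CS n) R (TT n)"
  unfolding coinv_sub_def Let_def by (rule T.span_submodule[OF coinv_rels_subset])

lemma coinv_is_module: "module R (quot_module (TT n) (CS n))"
  by (rule T.quot_is_module[OF coinv_sub_submodule])

lemma schur_is_module: "module R (schur R P V)"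
  unfolding schur_def by (rule direct_sum_is_module[OF coinv_is_module])

lemma is_lin_tensor_to_coinv: "is_lin R (TT n) (quot_module (TT n) (CS n)) (\<lambda>x. CS n +>\<^bsub>TT n\<^esub> x)"
  by (rule T.is_lin_coset[OF coinv_sub_submodule])

definition "schur_in n x = summand (\<lambda>n. quot_module (TT n) (CS n)) n (CS n +>\<^bsub>TT n\<^esub> x)"

lemma is_lin_schur_in: "is_lin R (TT n) (schur R P V) (schur_in n)"
  unfolding schur_def schur_in_def
  by (rule is_lin_comp[OF is_lin_tensor_to_coinv is_lin_summand[of "\<lambda>n. quot_module (TT n) (CS n)", OF coinv_is_module]])

lemma schur_elt_eq: "length vs = n \<Longrightarrow> schur_elt R P V \<mu> vs = schur_in n (PT n \<mu> vs)"
  by (auto simp: schur_elt_def schur_in_def summand_def T.quot_zero[OF coinv_sub_submodule] fun_eq_iff)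

lemma schur_form_schur_elt: "schur_form R P V (schur R P V) (schur_elt R P V)"
proof (rule schur_formI)
  show "is_lin R (ops P (length vs)) (schur R P V) (\<lambda>\<mu>. schur_elt R P V \<mu> vs)" if "set vs \<subseteq> carrier V" for vs
    unfolding schur_elt_eq[OF refl] using that
    by (intro is_lin_comp[OF is_lin_pure_tensor_op is_lin_schur_in]) auto
next
  fix n \<mu> assume "\<mu> \<in> carrier (ops P n)"
  note pt = multilin_comp[OF multilin_pure_tensor[OF this] is_lin_schur_in]
  show "multilin R V (schur R P V) n (schur_elt R P V \<mu>)"
  proof (rule multilinI)
    fix as bs assume n: "Suc (length as + length bs) = n" and c: "set as \<subseteq> carrier V" "set bs \<subseteq> carrier V"
    have "schur_elt R P V \<mu> (as @ v # bs) = schur_in n (PT n \<mu> (as @ v # bs))" for v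
      using n by (intro schur_elt_eq) simp
    then show "is_lin R V (schur R P V) (\<lambda>v. schur_elt R P V \<mu> (as @ v # bs))"
      using multilinD[OF pt n c] by simp
  qed
next
  fix \<sigma> vs \<mu> assume a: "\<mu> \<in> carrier (ops P (length vs))" "set vs \<subseteq> carrier V" "\<sigma> permutes {..<length vs}"
  let ?n = "length vs"
  have "PT ?n (act P ?n \<mu> \<sigma>) (permute_list \<sigma> vs) \<ominus>\<^bsub>TT ?n\<^esub> PT ?n \<mu> vs \<in> CS ?n"
    unfolding coinv_sub_def Let_def using a
    by (intro subsetD[OF T.span_base]) (auto simp: tensor_gens_iff)
  then have "CS ?n +>\<^bsub>TT ?n\<^esub> PT ?n (act P ?n \<mu> \<sigma>) (permute_list \<sigma> vs) = CS ?n +>\<^bsub>TT ?n\<^esub> PT ?n \<mu> vs"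
    using a by (intro T.coset_eqI[OF coinv_sub_submodule] pure_tensor_closed act_closed) auto
  then have "schur_in ?n (PT ?n (act P ?n \<mu> \<sigma>) (permute_list \<sigma> vs)) = schur_in ?n (PT ?n \<mu> vs)"
    by (simp only: schur_in_def)
  then show "schur_elt R P V (act P ?n \<mu> \<sigma>) (permute_list \<sigma> vs) = schur_elt R P V \<mu> vs"
    by (simp only: schur_elt_eq length_permute_list)
qed

text \<open>Zero is itself a generator, one whose operation is zero; this removes the zero case from
  \<open>schur_induct\<close>.\<close>

lemma schur_zero: "schur_elt R P V \<zero>\<^bsub>ops P 0\<^esub> [] = \<zero>\<^bsub>schur R P V\<^esub>"
  using is_lin_zero[OF schur_formD(1)[OF schur_form_schur_elt, of "[]"] ops_module schur_is_module] by simp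

text \<open>Every element is a sum of generators: a scalar in front of a pure tensor moves into the
  operation, and both quotient maps are surjective, so the induction principles of the free module
  and of the direct sum suffice.\<close>

lemma schur_induct [consumes 1, case_names add elt]:
  assumes s: "s \<in> carrier (schur R P V)"
    and add: "\<And>s t. s \<in> carrier (schur R P V) \<Longrightarrow> t \<in> carrier (schur R P V) \<Longrightarrow> Q s \<Longrightarrow> Q t \<Longrightarrow>
      Q (s \<oplus>\<^bsub>schur R P V\<^esub> t)"
    and elt: "\<And>\<mu> vs. \<mu> \<in> carrier (ops P (length vs)) \<Longrightarrow> set vs \<subseteq> carrier V \<Longrightarrow> Q (schur_elt R P V \<mu> vs)"
  shows "Q s"
proof -
  have zero: "Q \<zero>\<^bsub>schur R P V\<^esub>" using elt[of "\<zero>\<^bsub>ops P 0\<^esub>" "[]"] by (simp add: schur_zero)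
  have free: "Q (schur_in n (TS n +>\<^bsub>FF n\<^esub> f))" if "f \<in> carrier (FF n)" for n f
    using that
  proof (induct rule: free_module_induct)
    case zero
    have "(\<lambda>_. \<zero>) = \<zero>\<^bsub>FF n\<^esub>" by (simp add: free_module_def)
    then have "schur_in n (TS n +>\<^bsub>FF n\<^esub> (\<lambda>_. \<zero>)) = \<zero>\<^bsub>schur R P V\<^esub>"
      using is_lin_zero[OF is_lin_comp[OF is_lin_free_to_tensor is_lin_schur_in] F.module_axioms schur_is_module]
      by simp
    then show ?case using \<open>Q \<zero>\<^bsub>schur R P V\<^esub>\<close> by simp
  next
    case (add f g)
    note L = is_lin_comp[OF is_lin_free_to_tensor is_lin_schur_in]
    show ?case
      using assms(2)[OF is_lin_closed[OF L add(1)] is_lin_closed[OF L add(2)] add(3,4)] add(1,2)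
      by (simp add: is_lin_add[OF L])
  next
    case (smult r x)
    obtain \<mu> vs where x: "x = (\<mu>, vs)" by (cases x)
    with smult have a: "\<mu> \<in> carrier (ops P n)" "length vs = n" "set vs \<subseteq> carrier V"
      by (auto simp: tensor_gens_iff)
    have "schur_in n (TS n +>\<^bsub>FF n\<^esub> (r \<odot>\<^bsub>FF n\<^esub> free_basis R x)) = schur_in n (r \<odot>\<^bsub>TT n\<^esub> PT n \<mu> vs)"
      using smult by (simp add: is_lin_smult[OF is_lin_free_to_tensor] free_basis_closed x pure_tensor_def)
    also have "r \<odot>\<^bsub>TT n\<^esub> PT n \<mu> vs = PT n (r \<odot>\<^bsub>ops P n\<^esub> \<mu>) vs"
      using a smult by (simp add: is_lin_smult[OF is_lin_pure_tensor_op])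
    also have "schur_in n \<dots> = schur_elt R P V (r \<odot>\<^bsub>ops P n\<^esub> \<mu>) vs"
      using a by (simp add: schur_elt_eq)
    finally show ?case using elt[of "r \<odot>\<^bsub>ops P n\<^esub> \<mu>" vs] a smult by simp
  qed
  show ?thesis
  proof (rule direct_sum_induct[of "\<lambda>n. quot_module (TT n) (CS n)" s Q, OF coinv_is_module s[unfolded schur_def]])
    fix n x assume "x \<in> carrier (quot_module (TT n) (CS n))"
    then obtain t where t: "x = CS n +>\<^bsub>TT n\<^esub> t" "t \<in> carrier (TT n)"
      unfolding T.quot_carrier[OF coinv_sub_submodule] by blast
    then obtain f where f: "t = TS n +>\<^bsub>FF n\<^esub> f" "f \<in> carrier (FF n)"
      using F.quot_carrier[OF tensor_sub_submodule] unfolding tensor_def by blast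
    show "Q (summand (\<lambda>n. quot_module (TT n) (CS n)) n x)"
      using free[OF f(2)] unfolding t(1) f(1) schur_in_def .
  qed (rule zero[unfolded schur_def], rule add[unfolded schur_def])
qed

lemma schur_eqI:
  assumes F: "is_lin R (schur R P V) N F" and G: "is_lin R (schur R P V) N G"
    and eq: "\<And>\<mu> vs. \<mu> \<in> carrier (ops P (length vs)) \<Longrightarrow> set vs \<subseteq> carrier V \<Longrightarrow>
      F (schur_elt R P V \<mu> vs) = G (schur_elt R P V \<mu> vs)"
    and s: "s \<in> carrier (schur R P V)"
  shows "F s = G s"
  using s
proof (induct rule: schur_induct)
  case (add s t)
  then show ?case by (simp add: is_lin_add[OF F] is_lin_add[OF G])
next
  case (elt \<mu> vs)
  then show ?case by (rule eq)
qed

text \<open>The map is built along the layers of the construction: a lift from the free module,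
  descent to the tensor product by linearity in each slot, descent to the coinvariants by
  invariance, and assembly over all arities.\<close>

lemma schur_universal:
  assumes N: "module R N" and \<phi>: "schur_form R P V N \<phi>"
  shows "\<exists>F. is_lin R (schur R P V) N F \<and>
    (\<forall>vs. \<forall>\<mu>\<in>carrier (ops P (length vs)). set vs \<subseteq> carrier V \<longrightarrow> F (schur_elt R P V \<mu> vs) = \<phi> \<mu> vs)"
proof -
  interpret N: module R N by (rule N)
  note \<phi>c = schur_formD(4)[OF \<phi>]
  have upd: "vs[i := v] = take i vs @ v # drop (Suc i) vs" "set (take i vs) \<subseteq> carrier V"
    "set (drop (Suc i) vs) \<subseteq> carrier V" "Suc (length (take i vs) + length (drop (Suc i) vs)) = length vs"
    if "i < length vs" "set vs \<subseteq> carrier V" for i v and vs :: "'v list"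
    using that by (auto simp: upd_conv_take_nth_drop dest: in_set_takeD in_set_dropD)
  have "\<exists>h. is_lin R (TT n) N h \<and> (\<forall>\<mu> vs. \<mu> \<in> carrier (ops P n) \<longrightarrow> length vs = n \<longrightarrow> set vs \<subseteq> carrier V \<longrightarrow>
      h (PT n \<mu> vs) = \<phi> \<mu> vs)" for n
  proof -
    obtain g where g: "is_lin R (FF n) N g"
      and gb: "\<And>x. x \<in> tensor_gens (ops P n) V n \<Longrightarrow> g (free_basis R x) = (case x of (\<mu>, vs) \<Rightarrow> \<phi> \<mu> vs)"
      using free_lift[OF N, of "tensor_gens (ops P n) V n" "\<lambda>(\<mu>, vs). \<phi> \<mu> vs"] \<phi>c
      by (auto simp: tensor_gens_def)
    have gb': "g (free_basis R (\<mu>, vs)) = \<phi> \<mu> vs"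
      if "\<mu> \<in> carrier (ops P n)" "length vs = n" "set vs \<subseteq> carrier V" for \<mu> vs
      using gb[of "(\<mu>, vs)"] that by (simp add: tensor_gens_iff)
    note gm = is_lin_minus[OF g F.module_axioms N]
    have bc: "free_basis R (\<mu>, vs) \<in> carrier (FF n)"
      if "\<mu> \<in> carrier (ops P n)" "length vs = n" "set vs \<subseteq> carrier V" for \<mu> vs
      using that by (intro free_basis_closed) (simp add: tensor_gens_iff)
    \<comment> \<open>The four cases are the families in \<open>tensor_rels\<close>: two express
      linearity in the operation, two express linearity in one of the vectors.\<close>
    have rel: "g x = \<zero>\<^bsub>N\<^esub>" if "x \<in> tensor_rels R (ops P n) V n" for x
      using that unfolding tensor_rels_def Let_def
    proof (elim UnE CollectE exE conjE)
      fix \<mu> \<nu> vs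
      assume x: "x = free_basis R (\<mu> \<oplus>\<^bsub>ops P n\<^esub> \<nu>, vs) \<ominus>\<^bsub>FF n\<^esub> (free_basis R (\<mu>, vs) \<oplus>\<^bsub>FF n\<^esub> free_basis R (\<nu>, vs))"
        and a: "(\<mu>, vs) \<in> tensor_gens (ops P n) V n" "\<nu> \<in> carrier (ops P n)"
      then show ?thesis
        using is_lin_add[OF schur_formD(1)[OF \<phi>, of vs], of \<mu> \<nu>] \<phi>c[of _ vs]
        by (auto simp: tensor_gens_iff bc gm is_lin_add[OF g] gb' N.M.r_neg a_minus_def[of N])
    next
      fix r \<mu> vs
      assume x: "x = free_basis R (r \<odot>\<^bsub>ops P n\<^esub> \<mu>, vs) \<ominus>\<^bsub>FF n\<^esub> (r \<odot>\<^bsub>FF n\<^esub> free_basis R (\<mu>, vs))"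
        and a: "(\<mu>, vs) \<in> tensor_gens (ops P n) V n" "r \<in> carrier R"
      then show ?thesis
        using is_lin_smult[OF schur_formD(1)[OF \<phi>, of vs], of r \<mu>] \<phi>c[of _ vs]
        by (auto simp: tensor_gens_iff bc gm is_lin_smult[OF g] gb' N.M.r_neg a_minus_def[of N])
    next
      fix \<mu> vs i v w
      assume x: "x = free_basis R (\<mu>, vs[i := v \<oplus>\<^bsub>V\<^esub> w]) \<ominus>\<^bsub>FF n\<^esub>
          (free_basis R (\<mu>, vs[i := v]) \<oplus>\<^bsub>FF n\<^esub> free_basis R (\<mu>, vs[i := w]))"
        and a: "(\<mu>, vs) \<in> tensor_gens (ops P n) V n" "i < n" "v \<in> carrier V" "w \<in> carrier V"
      have a': "\<mu> \<in> carrier (ops P n)" "length vs = n" "set vs \<subseteq> carrier V" using a by (auto simp: tensor_gens_iff)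
      have L: "is_lin R V N (\<lambda>v. \<phi> \<mu> (vs[i := v]))"
        using multilinD[OF schur_formD(2)[OF \<phi> a'(1)]] upd[of i vs] a' a(2) by simp
      show ?thesis
        unfolding x
        using a a' is_lin_add[OF L a(3,4)] is_lin_closed[OF L]
        by (simp add: bc gm is_lin_add[OF g] gb' N.M.r_neg a_minus_def[of N] set_list_update_closed)
    next
      fix \<mu> vs i r v
      assume x: "x = free_basis R (\<mu>, vs[i := r \<odot>\<^bsub>V\<^esub> v]) \<ominus>\<^bsub>FF n\<^esub> (r \<odot>\<^bsub>FF n\<^esub> free_basis R (\<mu>, vs[i := v]))"
        and a: "(\<mu>, vs) \<in> tensor_gens (ops P n) V n" "i < n" "r \<in> carrier R" "v \<in> carrier V"
      have a': "\<mu> \<in> carrier (ops P n)" "length vs = n" "set vs \<subseteq> carrier V" using a by (auto simp: tensor_gens_iff)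
      have L: "is_lin R V N (\<lambda>v. \<phi> \<mu> (vs[i := v]))"
        using multilinD[OF schur_formD(2)[OF \<phi> a'(1)]] upd[of i vs] a' a(2) by simp
      show ?thesis
        unfolding x
        using a a' is_lin_smult[OF L a(3,4)] is_lin_closed[OF L]
        by (simp add: bc gm is_lin_smult[OF g] gb' N.M.r_neg a_minus_def[of N] set_list_update_closed)
    qed
    have "g x = \<zero>\<^bsub>N\<^esub>" if "x \<in> TS n" for x
      by (rule F.lin_vanishes_on_span[OF g N tensor_rels_subset rel that[unfolded tensor_sub_def]])
    from F.quot_lift[OF tensor_sub_submodule g N this] obtain h where h: "is_lin R (TT n) N h"
      and hx: "\<And>x. x \<in> carrier (FF n) \<Longrightarrow> h (TS n +>\<^bsub>FF n\<^esub> x) = g x"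
      unfolding tensor_def by blast
    show ?thesis using h hx[OF bc] gb' unfolding pure_tensor_def by auto
  qed
  then obtain h where h: "\<And>n. is_lin R (TT n) N (h n)"
    and hp: "\<And>n \<mu> vs. \<mu> \<in> carrier (ops P n) \<Longrightarrow> length vs = n \<Longrightarrow> set vs \<subseteq> carrier V \<Longrightarrow> h n (PT n \<mu> vs) = \<phi> \<mu> vs"
    by metis
  have "\<exists>k. is_lin R (quot_module (TT n) (CS n)) N k \<and> (\<forall>x\<in>carrier (TT n). k (CS n +>\<^bsub>TT n\<^esub> x) = h n x)" for n
  proof (rule T.quot_lift[OF coinv_sub_submodule h N])
    fix x assume x: "x \<in> CS n"
    show "h n x = \<zero>\<^bsub>N\<^esub>"
    proof (rule T.lin_vanishes_on_span[OF h N coinv_rels_subset _ x[unfolded coinv_sub_def Let_def]])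
      fix y assume "y \<in> {PT n (act P n \<mu> \<sigma>) (permute_list \<sigma> vs) \<ominus>\<^bsub>TT n\<^esub> PT n \<mu> vs | \<mu> vs \<sigma>.
        (\<mu>, vs) \<in> tensor_gens (ops P n) V n \<and> \<sigma> permutes {..<n}}"
      then obtain \<mu> vs \<sigma> where y: "y = PT n (act P n \<mu> \<sigma>) (permute_list \<sigma> vs) \<ominus>\<^bsub>TT n\<^esub> PT n \<mu> vs"
        and a: "\<mu> \<in> carrier (ops P n)" "length vs = n" "set vs \<subseteq> carrier V" "\<sigma> permutes {..<n}"
        by (auto simp: tensor_gens_iff)
      then show "h n y = \<zero>\<^bsub>N\<^esub>"
        using schur_formD(3)[OF \<phi>, of \<mu> vs \<sigma>] \<phi>c[of \<mu> vs]
        by (simp add: is_lin_minus[OF h T.module_axioms N] pure_tensor_closed act_closed hp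
            N.M.r_neg a_minus_def[of N])
    qed
  qed
  then obtain k where k: "\<And>n. is_lin R (quot_module (TT n) (CS n)) N (k n)"
    and kx: "\<And>n x. x \<in> carrier (TT n) \<Longrightarrow> k n (CS n +>\<^bsub>TT n\<^esub> x) = h n x"
    by metis
  from direct_sum_lift[of "\<lambda>n. quot_module (TT n) (CS n)", OF coinv_is_module N k]
  obtain F where F: "is_lin R (schur R P V) N F"
    and Fx: "\<And>n x. x \<in> carrier (quot_module (TT n) (CS n)) \<Longrightarrow>
      F (summand (\<lambda>n. quot_module (TT n) (CS n)) n x) = k n x"
    unfolding schur_def by blast
  have "F (schur_elt R P V \<mu> vs) = \<phi> \<mu> vs" if "\<mu> \<in> carrier (ops P (length vs))" "set vs \<subseteq> carrier V" for \<mu> vs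
    using that pure_tensor_closed[OF that(1) refl that(2)]
    by (simp add: schur_elt_eq schur_in_def Fx is_lin_closed[OF is_lin_tensor_to_coinv] kx hp)
  with F show ?thesis by blast
qed

end

text \<open>A definite description of the same shape as \<open>schur_map\<close> and
  \<open>schur_deriv\<close>, so that these become instances of it by unfolding and inherit its
  existence and uniqueness.\<close>

definition schur_lift where
  "schur_lift V N \<phi> = (THE F. F \<in> lin_hom R (schur R P V) N \<and>
     (\<forall>vs. \<forall>\<mu>\<in>carrier (ops P (length vs)). set vs \<subseteq> carrier V \<longrightarrow> F (schur_elt R P V \<mu> vs) = \<phi> \<mu> vs))"

lemma schur_lift:
  assumes V: "module R V" and N: "module R N" and \<phi>: "schur_form R P V N \<phi>"
  shows is_lin_schur_lift: "is_lin R (schur R P V) N (schur_lift V N \<phi>)"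
    and schur_lift_elt: "\<And>\<mu> vs. \<mu> \<in> carrier (ops P (length vs)) \<Longrightarrow> set vs \<subseteq> carrier V \<Longrightarrow>
      schur_lift V N \<phi> (schur_elt R P V \<mu> vs) = \<phi> \<mu> vs"
proof -
  let ?Q = "\<lambda>F. F \<in> lin_hom R (schur R P V) N \<and>
     (\<forall>vs. \<forall>\<mu>\<in>carrier (ops P (length vs)). set vs \<subseteq> carrier V \<longrightarrow> F (schur_elt R P V \<mu> vs) = \<phi> \<mu> vs)"
  note S = schur_is_module[OF V]
  from schur_universal[OF V N \<phi>] obtain F where F: "is_lin R (schur R P V) N F"
    and Fe: "\<And>\<mu> vs. \<mu> \<in> carrier (ops P (length vs)) \<Longrightarrow> set vs \<subseteq> carrier V \<Longrightarrow> F (schur_elt R P V \<mu> vs) = \<phi> \<mu> vs"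
    by blast
  have "?Q (restrict F (carrier (schur R P V)))"
    using restrict_lin_hom[OF F S] Fe schur_formD(4)[OF schur_form_schur_elt[OF V]] by auto
  moreover have "G = restrict F (carrier (schur R P V))" if G: "?Q G" for G
  proof (rule extensionalityI)
    show "G \<in> extensional (carrier (schur R P V))" using G by (simp add: lin_hom_iff)
    have G': "is_lin R (schur R P V) N G" using G by (simp add: lin_hom_iff)
    fix s assume s: "s \<in> carrier (schur R P V)"
    have "G s = F s" using G Fe by (intro schur_eqI[OF V G' F _ s]) simp
    then show "G s = restrict F (carrier (schur R P V)) s" using s by simp
  qed simp
  ultimately have "?Q (schur_lift V N \<phi>)"
    unfolding schur_lift_def by (rule theI)
  then show "is_lin R (schur R P V) N (schur_lift V N \<phi>)"
    and "\<And>\<mu> vs. \<mu> \<in> carrier (ops P (length vs)) \<Longrightarrow> set vs \<subseteq> carrier V \<Longrightarrow>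
      schur_lift V N \<phi> (schur_elt R P V \<mu> vs) = \<phi> \<mu> vs"
    by (auto simp: lin_hom_iff)
qed

end

section \<open>Permutations and partial composition\<close>

text \<open>The block sum of the identity on \<open>k\<close> letters with \<tau>.\<close>

definition shift_perm :: "nat \<Rightarrow> (nat \<Rightarrow> nat) \<Rightarrow> nat \<Rightarrow> nat" where
  "shift_perm k \<tau> = (\<lambda>j. if j < k then j else k + \<tau> (j - k))"

lemma shift_perm_permutes:
  assumes "\<tau> permutes {..<n}" shows "shift_perm k \<tau> permutes {..<k + n}"
proof (rule bij_imp_permutes)
  have lt: "\<tau> j < n" if "j < n" for j using permutes_in_image[OF assms, of j] that by simp
  have eq: "\<tau> i = \<tau> j \<longleftrightarrow> i = j" for i j using permutes_inj[OF assms] by (auto simp: inj_def)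
  have "inj_on (shift_perm k \<tau>) {..<k + n}"
    by (rule inj_onI) (auto simp: eq shift_perm_def split: if_splits)
  moreover have "shift_perm k \<tau> ` {..<k + n} \<subseteq> {..<k + n}"
    using lt by (auto simp: shift_perm_def)
  ultimately show "bij_betw (shift_perm k \<tau>) {..<k + n} {..<k + n}"
    by (simp add: bij_betw_def endo_inj_surj)
  show "shift_perm k \<tau> j = j" if "j \<notin> {..<k + n}" for j
    using that permutes_not_in[OF assms, of "j - k"] by (simp add: shift_perm_def)
qed

lemma shift_perm_shift_perm: "shift_perm k (shift_perm n \<tau>) = shift_perm (k + n) \<tau>"
  by (auto simp: shift_perm_def fun_eq_iff)

lemma permute_list_shift_perm:
  assumes "\<tau> permutes {..<length bs}"
  shows "permute_list (shift_perm (length as) \<tau>) (as @ bs) = as @ permute_list \<tau> bs"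
  using permutes_in_image[OF assms] shift_perm_permutes[OF assms, of "length as"]
  by (intro nth_equalityI) (auto simp: permute_list_nth shift_perm_def nth_append permute_list_nth[OF assms])

lemma permute_list_append_left:
  assumes "\<tau> permutes {..<length as}"
  shows "permute_list \<tau> (as @ bs) = permute_list \<tau> as @ bs"
proof -
  have t: "\<tau> permutes {..<length as + length bs}" by (rule permutes_subset[OF assms]) auto
  have "\<tau> i < length as \<longleftrightarrow> i < length as" for i using permutes_in_image[OF assms, of i] by simp
  moreover have "\<tau> i = i" if "\<not> i < length as" for i using permutes_not_in[OF assms] that by simp
  ultimately show ?thesis using t assms
    by (intro nth_equalityI) (auto simp: permute_list_nth nth_append)
qed

text \<open>With the identity on the outer operation only the inputs of the inserted one move, and
  they form the block that starts at \<open>k\<close>. Behind this block \<open>shift_perm\<close>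
  is the identity because \<tau> fixes everything from \<open>n\<close> on.\<close>

lemma pcomp_perm_id_left:
  assumes "\<tau> permutes {..<n}"
  shows "pcomp_perm (Suc (k + b)) n k id \<tau> = shift_perm k \<tau>"
  using permutes_not_in[OF assms] by (auto simp: pcomp_perm_def shift_perm_def fun_eq_iff Let_def)

text \<open>The outer permutation moves only inputs behind position \<open>k\<close>. Replacing
  input \<open>k\<close> by \<open>n\<close> inputs shifts the start of the moved part from
  \<open>Suc k\<close> to \<open>k + n\<close>.\<close>

lemma pcomp_perm_shift_perm:
  assumes "\<tau> permutes {..<b}"
  shows "pcomp_perm (Suc (k + b)) n k (shift_perm (Suc k) \<tau>) id = shift_perm (k + n) \<tau>"
proof
  fix j
  show "pcomp_perm (Suc (k + b)) n k (shift_perm (Suc k) \<tau>) id j = shift_perm (k + n) \<tau> j"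
  proof (cases "j < k + n")
    case True
    then show ?thesis by (auto simp: pcomp_perm_def shift_perm_def)
  next
    case False
    then obtain d where "j = k + n + d" by (metis le_add_diff_inverse linorder_not_less)
    then show ?thesis using permutes_not_in[OF assms, of d]
      by (auto simp: pcomp_perm_def shift_perm_def Let_def Suc_diff_le)
  qed
qed

text \<open>The inserted block goes to the \<open>n\<close> positions starting at
  \<open>\<sigma> i\<close>, and all other positions land outside these. Injectivity can thus be
  checked for the two kinds separately, and surjectivity follows by finiteness.\<close>

lemma pcomp_perm_permutes:
  assumes \<sigma>: "\<sigma> permutes {..<m}" and i: "i < m"
  shows "pcomp_perm m n i \<sigma> id permutes {..<m + n - 1}"
proof (rule bij_imp_permutes)
  have lt: "\<sigma> j < m" if "j < m" for j using permutes_in_image[OF \<sigma>, of j] that by simp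
  have inj: "\<sigma> j = \<sigma> k \<longleftrightarrow> j = k" for j k using permutes_inj[OF \<sigma>] by (auto simp: inj_def)
  \<comment> \<open>For a position outside the inserted block, \<open>?u k\<close> is the input of
    the outer operation that it belongs to; it is never \<open>i\<close>.\<close>
  let ?u = "\<lambda>k. if k < i then k else k + 1 - n"
  have u: "?u k < m" "?u k \<noteq> i" if "k < m + n - 1" "\<not> (i \<le> k \<and> k < i + n)" for k
    using that i by auto
  have v: "\<sigma> (?u k) < m" "\<sigma> (?u k) \<noteq> \<sigma> i" if "k < m + n - 1" "\<not> (i \<le> k \<and> k < i + n)" for k
    using u[OF that] lt inj by blast+
  have "inj_on (pcomp_perm m n i \<sigma> id) {..<m + n - 1}"
  proof (rule inj_onI)
    fix j k assume a: "j \<in> {..<m + n - 1}" "k \<in> {..<m + n - 1}" and eq: "pcomp_perm m n i \<sigma> id j = pcomp_perm m n i \<sigma> id k"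
    let ?J = "i \<le> j \<and> j < i + n" and ?K = "i \<le> k \<and> k < i + n"
    consider "?J" "?K" | "?J" "\<not> ?K" | "\<not> ?J" "?K" | "\<not> ?J" "\<not> ?K" by blast
    then show "j = k"
    proof cases
      case 1
      then show ?thesis using eq a by (auto simp: pcomp_perm_def)
    next
      case 2
      then show ?thesis using eq a v[of k] by (auto simp: pcomp_perm_def Let_def split: if_splits)
    next
      case 3
      then show ?thesis using eq a v[of j] by (auto simp: pcomp_perm_def Let_def split: if_splits)
    next
      case 4
      then have "\<sigma> (?u j) = \<sigma> (?u k)"
        using eq a v[of j] v[of k] by (auto simp: pcomp_perm_def Let_def split: if_splits) arith
      then have "?u j = ?u k" by (simp only: inj)
      with 4 show ?thesis by (auto split: if_splits)
    qed
  qed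
  moreover have "pcomp_perm m n i \<sigma> id ` {..<m + n - 1} \<subseteq> {..<m + n - 1}"
  proof (rule image_subsetI)
    fix k assume "k \<in> {..<m + n - 1}"
    then show "pcomp_perm m n i \<sigma> id k \<in> {..<m + n - 1}"
      using v[of k] lt[OF i] by (auto simp: pcomp_perm_def Let_def split: if_splits)
  qed
  ultimately show "bij_betw (pcomp_perm m n i \<sigma> id) {..<m + n - 1} {..<m + n - 1}"
    by (simp add: bij_betw_def endo_inj_surj)
qed (simp add: pcomp_perm_def)

text \<open>The combinatorics of equivariance in one slot: the entry behind \<open>us\<close> moves
  to position \<open>i\<close>. Widening this entry to a block \<open>bs\<close>, and \<sigma>
  accordingly to \<open>pcomp_perm\<close>, leaves its surroundings as they are, so the same
  \<open>as'\<close> and \<open>cs'\<close> serve for the single entry and for every block.\<close>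

lemma permute_list_insert:
  fixes us cs :: "'a list"
  assumes \<sigma>: "\<sigma> permutes {..<Suc (length us + length cs)}"
  obtains i as' cs' where "i < Suc (length us + length cs)" "\<sigma> i = length us" "length as' = i"
    "set as' \<subseteq> set us \<union> set cs" "set cs' \<subseteq> set us \<union> set cs"
    "length as' + length cs' = length us + length cs"
    "\<And>y. permute_list \<sigma> (us @ y # cs) = as' @ y # cs'"
    "\<And>bs. permute_list (pcomp_perm (Suc (length us + length cs)) (length bs) i \<sigma> id) (us @ bs @ cs) = as' @ bs @ cs'"
proof -
  let ?p = "length us" and ?m = "Suc (length us + length cs)"
  obtain i where i: "\<sigma> i = ?p" using permutes_surj[OF \<sigma>] by (metis surjD)
  have im: "i < ?m" using permutes_in_image[OF \<sigma>, of i] i by simp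
  have lt: "\<sigma> j < ?m" if "j < ?m" for j using permutes_in_image[OF \<sigma>, of j] that by simp
  have ne: "\<sigma> j \<noteq> ?p" if "j \<noteq> i" for j using permutes_inj[OF \<sigma>] i that by (auto simp: inj_def)
  \<comment> \<open>The entry that \<sigma> brings to a position \<open>j\<close> other than
    \<open>i\<close>; the \<open>Suc\<close> skips the distinguished slot between \<open>us\<close>
    and \<open>cs\<close>.\<close>
  define w where "w j = (if \<sigma> j < ?p then us ! \<sigma> j else cs ! (\<sigma> j - Suc ?p))" for j
  define as' where "as' = map w [0..<i]"
  define cs' where "cs' = map w [Suc i..<?m]"
  have wc: "w j \<in> set us \<union> set cs" if "j < ?m" "j \<noteq> i" for j
    using lt[OF that(1)] ne[OF that(2)] by (auto simp: w_def)
  have "set as' \<subseteq> set us \<union> set cs" unfolding as'_def set_map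
    by (rule image_subsetI, rule wc) (use im in auto)
  moreover have "set cs' \<subseteq> set us \<union> set cs" unfolding cs'_def set_map
    by (rule image_subsetI, rule wc) (use im in auto)
  moreover have "permute_list \<sigma> (us @ y # cs) = as' @ y # cs'" for y
  proof (rule nth_equalityI)
    fix j assume "j < length (permute_list \<sigma> (us @ y # cs))"
    then have j: "j < ?m" by simp
    have "permute_list \<sigma> (us @ y # cs) ! j = (us @ y # cs) ! \<sigma> j"
      using \<sigma> j by (intro permute_list_nth) simp_all
    also have "\<dots> = (as' @ y # cs') ! j"
      using j im lt[OF j] ne[of j] i
      by (auto simp: as'_def cs'_def nth_append w_def nth_Cons' not_less simp del: upt_Suc)
    finally show "permute_list \<sigma> (us @ y # cs) ! j = (as' @ y # cs') ! j" .
  qed (use im in \<open>simp add: as'_def cs'_def del: upt_Suc\<close>)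
  moreover have "permute_list (pcomp_perm ?m (length bs) i \<sigma> id) (us @ bs @ cs) = as' @ bs @ cs'" for bs
  proof (rule nth_equalityI)
    fix j assume "j < length (permute_list (pcomp_perm ?m (length bs) i \<sigma> id) (us @ bs @ cs))"
    then have j: "j < length us + length bs + length cs" by simp
    have "permute_list (pcomp_perm ?m (length bs) i \<sigma> id) (us @ bs @ cs) ! j
        = (us @ bs @ cs) ! pcomp_perm ?m (length bs) i \<sigma> id j"
      using pcomp_perm_permutes[OF \<sigma> im, of "length bs"] j
      by (intro permute_list_nth) (simp_all add: add_ac)
    also have "\<dots> = (as' @ bs @ cs') ! j"
    proof (cases "i \<le> j \<and> j < i + length bs")
      case True
      then show ?thesis using j i by (auto simp: pcomp_perm_def as'_def nth_append simp del: upt_Suc)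
    next
      case False
      define u where "u = (if j < i then j else j + 1 - length bs)"
      have u: "u < ?m" "u \<noteq> i" using False j im by (auto simp: u_def)
      have "pcomp_perm ?m (length bs) i \<sigma> id j = (if \<sigma> u < ?p then \<sigma> u else \<sigma> u + length bs - 1)"
        using False j i by (auto simp: pcomp_perm_def u_def Let_def)
      then have "(us @ bs @ cs) ! pcomp_perm ?m (length bs) i \<sigma> id j = w u"
        using lt[OF u(1)] ne[OF u(2)] by (auto simp: w_def nth_append)
      also have "w u = (as' @ bs @ cs') ! j"
        using False j im by (auto simp: u_def as'_def cs'_def nth_append Suc_diff_le simp del: upt_Suc)
      finally show ?thesis .
    qed
    finally show "permute_list (pcomp_perm ?m (length bs) i \<sigma> id) (us @ bs @ cs) ! j = (as' @ bs @ cs') ! j" .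
  qed (use im in \<open>simp add: as'_def cs'_def del: upt_Suc\<close>)
  ultimately show thesis
    using that[of i as' cs'] im i by (simp add: as'_def cs'_def del: upt_Suc)
qed

context operad
begin

lemma is_lin_pcomp_left: "i < m \<Longrightarrow> \<nu> \<in> carrier (ops P n) \<Longrightarrow>
    is_lin R (ops P m) (ops P (m + n - 1)) (\<lambda>\<mu>. pcomp P m n i \<mu> \<nu>)"
  using is_lin_restrictD[OF pcomp_lin_left ops_module] by blast

lemma is_lin_pcomp_right: "i < m \<Longrightarrow> \<mu> \<in> carrier (ops P m) \<Longrightarrow>
    is_lin R (ops P n) (ops P (m + n - 1)) (\<lambda>\<nu>. pcomp P m n i \<mu> \<nu>)"
  using is_lin_restrictD[OF pcomp_lin_right ops_module] by blast

lemma pcomp_closed: "i < m \<Longrightarrow> \<mu> \<in> carrier (ops P m) \<Longrightarrow> \<nu> \<in> carrier (ops P n) \<Longrightarrow>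
    pcomp P m n i \<mu> \<nu> \<in> carrier (ops P (m + n - 1))"
  using is_lin_closed[OF is_lin_pcomp_left] by blast

section \<open>Composing an operation with elements of \<open>S(P,V)\<close>\<close>

text \<open>Linearity in a parameter survives lifting, since it can be checked on generators, where
  the lift is known. This controls the nested lifts in \<open>plug_rev\<close>: they are linear in
  the operation, in the trailing vectors and in the entries treated later.\<close>

lemma is_lin_schur_lift_param:
  assumes V: "module R V" and N: "module R N" and M: "module R M"
    and form: "\<And>x. x \<in> carrier M \<Longrightarrow> schur_form R P V N (\<Phi> x)"
    and lin: "\<And>\<nu> vs. \<nu> \<in> carrier (ops P (length vs)) \<Longrightarrow> set vs \<subseteq> carrier V \<Longrightarrow> is_lin R M N (\<lambda>x. \<Phi> x \<nu> vs)"
    and y: "y \<in> carrier (schur R P V)"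
  shows "is_lin R M N (\<lambda>x. schur_lift V N (\<Phi> x) y)"
proof (rule schur_induct[OF V y])
  fix s t assume st: "s \<in> carrier (schur R P V)" "t \<in> carrier (schur R P V)"
    and lin: "is_lin R M N (\<lambda>x. schur_lift V N (\<Phi> x) s)" "is_lin R M N (\<lambda>x. schur_lift V N (\<Phi> x) t)"
  show "is_lin R M N (\<lambda>x. schur_lift V N (\<Phi> x) (s \<oplus>\<^bsub>schur R P V\<^esub> t))"
    using is_lin_add_fun[OF lin N] M
    by (rule is_lin_cong) (rule is_lin_add[OF is_lin_schur_lift[OF V N form] st])
next
  fix \<nu> vs assume elt: "\<nu> \<in> carrier (ops P (length vs))" "set vs \<subseteq> carrier V"
  show "is_lin R M N (\<lambda>x. schur_lift V N (\<Phi> x) (schur_elt R P V \<nu> vs))"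
    using lin[OF elt] M by (rule is_lin_cong) (rule schur_lift_elt[OF V N form elt])
qed

text \<open>Entries are replaced by generators from right to left, and \<open>ys\<close> collects
  those already replaced. This bridges the gap to \<open>schur_mult\<close>, whose defining equation
  requires generators in all slots at once.\<close>

lemma multilin_schur_eqI:
  assumes V: "module R V"
    and L: "multilin R (schur R P V) N n L" "multilin R (schur R P V) N n L'"
    and eq: "\<And>ys. length ys = n \<Longrightarrow> (\<forall>(\<nu>, vs)\<in>set ys. \<nu> \<in> carrier (ops P (length vs)) \<and> set vs \<subseteq> carrier V) \<Longrightarrow>
      L (map (\<lambda>(\<nu>, vs). schur_elt R P V \<nu> vs) ys) = L' (map (\<lambda>(\<nu>, vs). schur_elt R P V \<nu> vs) ys)"
    and s: "length ss = n" "set ss \<subseteq> carrier (schur R P V)"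
  shows "L ss = L' ss"
proof -
  let ?e = "map (\<lambda>(\<nu>, vs). schur_elt R P V \<nu> vs)"
  have ec: "set (?e ys) \<subseteq> carrier (schur R P V)"
    if "\<forall>(\<nu>, vs)\<in>set ys. \<nu> \<in> carrier (ops P (length vs)) \<and> set vs \<subseteq> carrier V" for ys
    using that by (auto intro: schur_formD(4)[OF schur_form_schur_elt[OF V]])
  have "L (ss @ ?e ys) = L' (ss @ ?e ys)"
    if "length ss + length ys = n" "set ss \<subseteq> carrier (schur R P V)"
      "\<forall>(\<nu>, vs)\<in>set ys. \<nu> \<in> carrier (ops P (length vs)) \<and> set vs \<subseteq> carrier V" for ss ys
    using that
  proof (induct ss arbitrary: ys rule: rev_induct)
    case Nil
    then show ?case using eq by simp
  next
    case (snoc s ss)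
    have n: "Suc (length ss + length (?e ys)) = n" and ss: "set ss \<subseteq> carrier (schur R P V)"
      and s: "s \<in> carrier (schur R P V)" using snoc.prems by auto
    note lin = multilinD[OF L(1) n ss ec[OF snoc.prems(3)]] multilinD[OF L(2) n ss ec[OF snoc.prems(3)]]
    have "L (ss @ s # ?e ys) = L' (ss @ s # ?e ys)"
    proof (rule schur_eqI[OF V lin _ s])
      fix \<nu> vs assume "\<nu> \<in> carrier (ops P (length vs))" "set vs \<subseteq> carrier V"
      then show "L (ss @ schur_elt R P V \<nu> vs # ?e ys) = L' (ss @ schur_elt R P V \<nu> vs # ?e ys)"
        using snoc.hyps[of "(\<nu>, vs) # ys"] snoc.prems by simp
    qed
    then show ?case by simp
  qed
  from this[of ss "[]"] s show ?thesis by simp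
qed

text \<open>\<open>plug_rev V rys \<mu> bs\<close> plugs the list \<open>rev rys\<close> of elements of \<open>S(P,V)\<close> into the first inputs of \<open>\<mu>\<close>
  and the vectors \<open>bs\<close> into the remaining ones. The last element of \<open>rev rys\<close> is treated first, as in
  \<^const>\<open>pcomp_rev\<close>, so that positions on its left do not move.\<close>

primrec plug_rev ::
  "('r, 'v) module \<Rightarrow> ('r, 'p, 'v) schur list \<Rightarrow> 'p \<Rightarrow> 'v list \<Rightarrow> ('r, 'p, 'v) schur" where
  "plug_rev V [] \<mu> bs = schur_elt R P V \<mu> bs"
| "plug_rev V (y # rys) \<mu> bs = schur_lift V (schur R P V)
     (\<lambda>\<nu> vs. plug_rev V rys (pcomp P (Suc (length rys + length bs)) (length vs) (length rys) \<mu> \<nu>) (vs @ bs)) y"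

definition plug ::
  "('r, 'v) module \<Rightarrow> 'p \<Rightarrow> ('r, 'p, 'v) schur list \<Rightarrow> 'v list \<Rightarrow> ('r, 'p, 'v) schur" where
  "plug V \<mu> ys bs = plug_rev V (rev ys) \<mu> bs"

text \<open>The case without trailing vectors is the composition that represents the monad
  multiplication; the tail serves the recursion.\<close>

definition scomp :: "('r, 'v) module \<Rightarrow> 'p \<Rightarrow> ('r, 'p, 'v) schur list \<Rightarrow> ('r, 'p, 'v) schur" where
  "scomp V \<mu> ys = plug V \<mu> ys []"

section \<open>Linearity, associativity and equivariance of the composition\<close>

context
  fixes V :: "('r, 'v) module" assumes V: "module R V"
begin

private abbreviation (input) "S \<equiv> schur R P V"
private abbreviation (input) "E \<equiv> schur_elt R P V"
private abbreviation (input) "\<eta> \<equiv> schur_unit R P V"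

private lemmas S = schur_is_module[OF V]
private lemmas elt_form = schur_form_schur_elt[OF V]
private lemmas elt_closed = schur_formD(4)[OF elt_form]

text \<open>The invariant that carries the recursion. Only permutations of the trailing vectors are
  considered here; on the operation they act through \<open>shift_perm\<close>, which fixes the
  inputs reserved for \<open>rys\<close>.\<close>

definition "plug_form rys \<longleftrightarrow>
  (\<forall>bs. set bs \<subseteq> carrier V \<longrightarrow> is_lin R (ops P (length rys + length bs)) S (\<lambda>\<mu>. plug_rev V rys \<mu> bs)) \<and>
  (\<forall>n. \<forall>\<mu>\<in>carrier (ops P (length rys + n)). multilin R V S n (plug_rev V rys \<mu>)) \<and>
  (\<forall>\<sigma> bs. \<forall>\<mu>\<in>carrier (ops P (length rys + length bs)). set bs \<subseteq> carrier V \<longrightarrow> \<sigma> permutes {..<length bs} \<longrightarrow>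
     plug_rev V rys (act P (length rys + length bs) \<mu> (shift_perm (length rys) \<sigma>)) (permute_list \<sigma> bs) = plug_rev V rys \<mu> bs)"

text \<open>One step of the recursion is again an invariant multilinear family in \<nu> and
  \<open>vs\<close>, so it may be lifted: the new vectors join the trailing ones, and a permutation
  of \<open>vs\<close> becomes one of the front part of \<open>vs @ bs\<close>.\<close>

lemma schur_form_plug_rev:
  assumes rys: "plug_form rys"
    and \<mu>: "\<mu> \<in> carrier (ops P (Suc (length rys + length bs)))" and bs: "set bs \<subseteq> carrier V"
  shows "schur_form R P V S (\<lambda>\<nu> vs. plug_rev V rys
    (pcomp P (Suc (length rys + length bs)) (length vs) (length rys) \<mu> \<nu>) (vs @ bs))"
proof (rule schur_formI)
  let ?k = "length rys" let ?m = "Suc (?k + length bs)"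
  fix vs assume vs: "set vs \<subseteq> carrier V"
  have "is_lin R (ops P (length vs)) (ops P (?k + length (vs @ bs))) (\<lambda>\<nu>. pcomp P ?m (length vs) ?k \<mu> \<nu>)"
    using is_lin_pcomp_right[of ?k ?m \<mu> "length vs"] \<mu> by (simp add: add_ac)
  moreover have "is_lin R (ops P (?k + length (vs @ bs))) S (\<lambda>\<mu>. plug_rev V rys \<mu> (vs @ bs))"
    using rys vs bs unfolding plug_form_def by (metis set_append Un_subset_iff)
  ultimately show "is_lin R (ops P (length vs)) S (\<lambda>\<nu>. plug_rev V rys (pcomp P ?m (length vs) ?k \<mu> \<nu>) (vs @ bs))"
    by (rule is_lin_comp)
  have ar: "?k + length bs + length vs = ?k + length (vs @ bs)" by simp
  fix \<nu> \<tau> assume \<nu>: "\<nu> \<in> carrier (ops P (length vs))" and \<tau>: "\<tau> permutes {..<length vs}"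
  \<comment> \<open>The identity is inserted on \<mu> because the equivariance axiom speaks of
    permutations on both operations.\<close>
  have "pcomp P ?m (length vs) ?k (act P ?m \<mu> id) (act P (length vs) \<nu> \<tau>)
      = act P (?m + length vs - 1) (pcomp P ?m (length vs) (id ?k) \<mu> \<nu>) (pcomp_perm ?m (length vs) ?k id \<tau>)"
    using \<mu> \<nu> \<tau> by (intro pcomp_equivariant permutes_id) auto
  then have "pcomp P ?m (length vs) ?k \<mu> (act P (length vs) \<nu> \<tau>)
      = act P (?k + length (vs @ bs)) (pcomp P ?m (length vs) ?k \<mu> \<nu>) (shift_perm ?k \<tau>)"
    by (simp add: act_id[OF \<mu>] pcomp_perm_id_left[OF \<tau>] ar)
  moreover have "permute_list \<tau> vs @ bs = permute_list \<tau> (vs @ bs)"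
    by (rule permute_list_append_left[OF \<tau>, symmetric])
  moreover have "pcomp P ?m (length vs) ?k \<mu> \<nu> \<in> carrier (ops P (?k + length (vs @ bs)))"
    using pcomp_closed[of ?k ?m \<mu> \<nu> "length vs"] \<mu> \<nu> by (simp add: add_ac)
  moreover have "\<tau> permutes {..<length (vs @ bs)}" by (rule permutes_subset[OF \<tau>]) auto
  moreover have "set (vs @ bs) \<subseteq> carrier V" using vs bs by simp
  ultimately show "plug_rev V rys (pcomp P ?m (length (permute_list \<tau> vs)) ?k \<mu> (act P (length vs) \<nu> \<tau>)) (permute_list \<tau> vs @ bs)
      = plug_rev V rys (pcomp P ?m (length vs) ?k \<mu> \<nu>) (vs @ bs)"
    using rys unfolding plug_form_def length_permute_list by metis
next
  let ?k = "length rys" let ?m = "Suc (?k + length bs)"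
  fix n \<nu> assume \<nu>: "\<nu> \<in> carrier (ops P n)"
  have "pcomp P ?m n ?k \<mu> \<nu> \<in> carrier (ops P (?k + (n + length bs)))"
    using pcomp_closed[of ?k ?m \<mu> \<nu> n] \<mu> \<nu> by (simp add: add_ac)
  then have L: "multilin R V S (n + length bs) (plug_rev V rys (pcomp P ?m n ?k \<mu> \<nu>))"
    using rys unfolding plug_form_def by blast
  show "multilin R V S n (\<lambda>vs. plug_rev V rys (pcomp P ?m (length vs) ?k \<mu> \<nu>) (vs @ bs))"
  proof (rule multilinI)
    fix xs ys assume n: "Suc (length xs + length ys) = n" and c: "set xs \<subseteq> carrier V" "set ys \<subseteq> carrier V"
    show "is_lin R V S (\<lambda>v. plug_rev V rys (pcomp P ?m (length (xs @ v # ys)) ?k \<mu> \<nu>) ((xs @ v # ys) @ bs))"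
      using multilinD[OF L, of xs "ys @ bs"] n c bs by simp
  qed
qed

lemma plug_form: "set rys \<subseteq> carrier S \<Longrightarrow> plug_form rys"
proof (induct rys)
  case Nil
  have "shift_perm 0 \<sigma> = \<sigma>" for \<sigma> by (simp add: shift_perm_def)
  moreover have "plug_rev V [] = E" by (simp add: fun_eq_iff)
  ultimately show ?case
    using schur_formD[OF elt_form] by (simp add: plug_form_def)
next
  case (Cons y rys)
  then have y: "y \<in> carrier S" and rys: "plug_form rys" by auto
  let ?k = "length rys"
  note form = schur_form_plug_rev[OF rys]
  note lift = schur_lift_elt[OF V S form]
  show ?case unfolding plug_form_def
  proof (intro conjI allI ballI impI)
    fix bs assume bs: "set bs \<subseteq> carrier V"
    let ?m = "Suc (?k + length bs)"
    have "is_lin R (ops P ?m) S (\<lambda>\<mu>. plug_rev V (y # rys) \<mu> bs)"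
      unfolding plug_rev.simps
    proof (rule is_lin_schur_lift_param[OF V S ops_module form _ y])
      fix \<nu> vs assume \<nu>: "\<nu> \<in> carrier (ops P (length vs))" and vs: "set vs \<subseteq> carrier V"
      have "is_lin R (ops P ?m) (ops P (?k + length (vs @ bs))) (\<lambda>\<mu>. pcomp P ?m (length vs) ?k \<mu> \<nu>)"
        using is_lin_pcomp_left[of ?k ?m \<nu> "length vs"] \<nu> by (simp add: add_ac)
      moreover have "is_lin R (ops P (?k + length (vs @ bs))) S (\<lambda>\<mu>. plug_rev V rys \<mu> (vs @ bs))"
        using rys vs bs unfolding plug_form_def by (metis set_append Un_subset_iff)
      ultimately show "is_lin R (ops P ?m) S (\<lambda>\<mu>. plug_rev V rys (pcomp P ?m (length vs) ?k \<mu> \<nu>) (vs @ bs))"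
        by (rule is_lin_comp)
    qed (use bs in auto)
    then show "is_lin R (ops P (length (y # rys) + length bs)) S (\<lambda>\<mu>. plug_rev V (y # rys) \<mu> bs)" by simp
  next
    fix n \<mu> assume \<mu>: "\<mu> \<in> carrier (ops P (length (y # rys) + n))"
    show "multilin R V S n (plug_rev V (y # rys) \<mu>)"
    proof (rule multilinI)
      fix as bs assume n: "Suc (length as + length bs) = n" and c: "set as \<subseteq> carrier V" "set bs \<subseteq> carrier V"
      let ?m = "Suc (?k + n)"
      have \<mu>m: "\<mu> \<in> carrier (ops P ?m)" using \<mu> by simp
      have len: "length (as @ v # bs) = n" for v using n by simp
      show "is_lin R V S (\<lambda>v. plug_rev V (y # rys) \<mu> (as @ v # bs))"
        unfolding plug_rev.simps len
      proof (rule is_lin_schur_lift_param[OF V S V _ _ y])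
        show "schur_form R P V S (\<lambda>\<nu> vs. plug_rev V rys (pcomp P ?m (length vs) ?k \<mu> \<nu>) (vs @ as @ v # bs))"
          if "v \<in> carrier V" for v
          using form[of \<mu> "as @ v # bs"] \<mu>m c that unfolding len by simp
        fix \<nu> vs assume \<nu>: "\<nu> \<in> carrier (ops P (length vs))" and vs: "set vs \<subseteq> carrier V"
        have "pcomp P ?m (length vs) ?k \<mu> \<nu> \<in> carrier (ops P (?k + (length vs + n)))"
          using pcomp_closed[of ?k ?m \<mu> \<nu> "length vs"] \<mu>m \<nu> by (simp add: add_ac)
        then have "multilin R V S (length vs + n) (plug_rev V rys (pcomp P ?m (length vs) ?k \<mu> \<nu>))"
          using rys unfolding plug_form_def by blast
        from multilinD[OF this, of "vs @ as" bs]
        show "is_lin R V S (\<lambda>v. plug_rev V rys (pcomp P ?m (length vs) ?k \<mu> \<nu>) (vs @ as @ v # bs))"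
          using n c vs by simp
      qed
    qed
  next
    fix \<sigma> bs \<mu> assume \<mu>: "\<mu> \<in> carrier (ops P (length (y # rys) + length bs))"
      and bs: "set bs \<subseteq> carrier V" and \<sigma>: "\<sigma> permutes {..<length bs}"
    let ?m = "Suc (?k + length bs)" let ?\<mu> = "act P ?m \<mu> (shift_perm (Suc ?k) \<sigma>)"
    have \<mu>m: "\<mu> \<in> carrier (ops P ?m)" using \<mu> by simp
    have sh: "shift_perm (Suc ?k) \<sigma> permutes {..<?m}" using shift_perm_permutes[OF \<sigma>, of "Suc ?k"] by simp
    have \<mu>': "?\<mu> \<in> carrier (ops P ?m)" by (rule act_closed[OF V \<mu>m sh])
    have bs': "set (permute_list \<sigma> bs) \<subseteq> carrier V" using bs \<sigma> by simp
    have "plug_rev V (y # rys) ?\<mu> (permute_list \<sigma> bs) = plug_rev V (y # rys) \<mu> bs"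
      unfolding plug_rev.simps length_permute_list
    proof (rule schur_eqI[OF V is_lin_schur_lift[OF V S] is_lin_schur_lift[OF V S] _ y])
      show "schur_form R P V S (\<lambda>\<nu> vs. plug_rev V rys (pcomp P ?m (length vs) ?k \<mu> \<nu>) (vs @ bs))"
        by (rule form[OF \<mu>m bs])
      show form': "schur_form R P V S (\<lambda>\<nu> vs. plug_rev V rys (pcomp P ?m (length vs) ?k ?\<mu> \<nu>) (vs @ permute_list \<sigma> bs))"
        using form[of ?\<mu> "permute_list \<sigma> bs"] \<mu>' bs' by simp
      fix \<nu> vs assume \<nu>: "\<nu> \<in> carrier (ops P (length vs))" and vs: "set vs \<subseteq> carrier V"
      have ar: "?k + length bs + length vs = ?k + length (vs @ bs)" by simp
      \<comment> \<open>Now the permutation sits on the outer operation and fixes its input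
        \<open>?k\<close>; inserting \<nu> there pushes it behind the block \<open>vs\<close>. The
        identity on \<nu> brings the equivariance axiom into play.\<close>
      have "pcomp P ?m (length vs) ?k ?\<mu> (act P (length vs) \<nu> id)
          = act P (?m + length vs - 1) (pcomp P ?m (length vs) (shift_perm (Suc ?k) \<sigma> ?k) \<mu> \<nu>)
              (pcomp_perm ?m (length vs) ?k (shift_perm (Suc ?k) \<sigma>) id)"
        using \<mu>m \<nu> by (intro pcomp_equivariant permutes_id sh) auto
      moreover have "shift_perm (Suc ?k) \<sigma> ?k = ?k" by (simp add: shift_perm_def)
      ultimately have "pcomp P ?m (length vs) ?k ?\<mu> \<nu>
          = act P (?k + length (vs @ bs)) (pcomp P ?m (length vs) ?k \<mu> \<nu>) (shift_perm ?k (shift_perm (length vs) \<sigma>))"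
        by (simp add: act_id[OF \<nu>] pcomp_perm_shift_perm[OF \<sigma>] shift_perm_shift_perm ar)
      moreover have "vs @ permute_list \<sigma> bs = permute_list (shift_perm (length vs) \<sigma>) (vs @ bs)"
        by (rule permute_list_shift_perm[OF \<sigma>, symmetric])
      moreover have "pcomp P ?m (length vs) ?k \<mu> \<nu> \<in> carrier (ops P (?k + length (vs @ bs)))"
        using pcomp_closed[of ?k ?m \<mu> \<nu> "length vs"] \<mu>m \<nu> by (simp add: add_ac)
      moreover have "shift_perm (length vs) \<sigma> permutes {..<length (vs @ bs)}"
        using shift_perm_permutes[OF \<sigma>] by simp
      moreover have "set (vs @ bs) \<subseteq> carrier V" using vs bs by simp
      ultimately have "plug_rev V rys (pcomp P ?m (length vs) ?k ?\<mu> \<nu>) (vs @ permute_list \<sigma> bs)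
        = plug_rev V rys (pcomp P ?m (length vs) ?k \<mu> \<nu>) (vs @ bs)"
        using rys unfolding plug_form_def by metis
      then show "schur_lift V S (\<lambda>\<nu> vs. plug_rev V rys (pcomp P ?m (length vs) ?k ?\<mu> \<nu>) (vs @ permute_list \<sigma> bs)) (E \<nu> vs)
        = schur_lift V S (\<lambda>\<nu> vs. plug_rev V rys (pcomp P ?m (length vs) ?k \<mu> \<nu>) (vs @ bs)) (E \<nu> vs)"
        using schur_lift_elt[OF V S form' \<nu> vs] lift[OF \<mu>m bs \<nu> vs] by simp
    qed
    then show "plug_rev V (y # rys) (act P (length (y # rys) + length bs) \<mu> (shift_perm (length (y # rys)) \<sigma>)) (permute_list \<sigma> bs)
      = plug_rev V (y # rys) \<mu> bs" by simp
  qed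
qed

lemma plug_Nil: "plug V \<mu> [] bs = E \<mu> bs"
  by (simp add: plug_def)

lemma plug_snoc: "plug V \<mu> (ys @ [y]) bs = schur_lift V S
    (\<lambda>\<nu> vs. plug V (pcomp P (Suc (length ys + length bs)) (length vs) (length ys) \<mu> \<nu>) ys (vs @ bs)) y"
  by (simp add: plug_def)

lemma is_lin_plug_op:
  assumes "set ys \<subseteq> carrier S" "set bs \<subseteq> carrier V"
  shows "is_lin R (ops P (length ys + length bs)) S (\<lambda>\<mu>. plug V \<mu> ys bs)"
  using plug_form[of "rev ys"] assms unfolding plug_form_def plug_def by simp

lemma plug_closed:
  assumes "\<mu> \<in> carrier (ops P (length ys + length bs))" "set ys \<subseteq> carrier S" "set bs \<subseteq> carrier V"
  shows "plug V \<mu> ys bs \<in> carrier S"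
  using is_lin_closed[OF is_lin_plug_op] assms by blast

lemma schur_form_plug:
  assumes "\<mu> \<in> carrier (ops P (Suc (length ys + length bs)))" "set ys \<subseteq> carrier S" "set bs \<subseteq> carrier V"
  shows "schur_form R P V S (\<lambda>\<nu> vs. plug V (pcomp P (Suc (length ys + length bs)) (length vs) (length ys) \<mu> \<nu>) ys (vs @ bs))"
  using schur_form_plug_rev[OF plug_form[of "rev ys"], of \<mu> bs] assms by (simp add: plug_def)

lemma plug_snoc_elt:
  assumes "\<mu> \<in> carrier (ops P (Suc (length ys + length bs)))" "set ys \<subseteq> carrier S" "set bs \<subseteq> carrier V"
    and "\<nu> \<in> carrier (ops P (length vs))" "set vs \<subseteq> carrier V"
  shows "plug V \<mu> (ys @ [E \<nu> vs]) bs = plug V (pcomp P (Suc (length ys + length bs)) (length vs) (length ys) \<mu> \<nu>) ys (vs @ bs)"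
  unfolding plug_snoc by (rule schur_lift_elt[OF V S schur_form_plug[OF assms(1-3)] assms(4,5)])

text \<open>In the last slot the dependence on \<open>y\<close> is the lift itself. Further to the
  left, \<open>y\<close> is a parameter of the lifts for the entries on its right, which are peeled
  off one by one.\<close>

lemma is_lin_plug:
  assumes "\<mu> \<in> carrier (ops P (Suc (length xs + length ys + length bs)))"
    "set xs \<subseteq> carrier S" "set ys \<subseteq> carrier S" "set bs \<subseteq> carrier V"
  shows "is_lin R S S (\<lambda>y. plug V \<mu> (xs @ y # ys) bs)"
  using assms
proof (induct ys arbitrary: \<mu> bs rule: rev_induct)
  case Nil
  then show ?case
    unfolding plug_snoc by (intro is_lin_schur_lift[OF V S] schur_form_plug) simp_all
next
  case (snoc z ys)
  have z: "z \<in> carrier S" and ys: "set ys \<subseteq> carrier S" using snoc.prems by auto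
  let ?k = "Suc (length xs + length ys)"
  have \<mu>: "\<mu> \<in> carrier (ops P (Suc (?k + length bs)))" using snoc.prems(1) by simp
  have len: "length (xs @ y # ys) = ?k" for y by simp
  have "is_lin R S S (\<lambda>y. plug V \<mu> ((xs @ y # ys) @ [z]) bs)"
    unfolding plug_snoc len
  proof (rule is_lin_schur_lift_param[OF V S S _ _ z])
    show "schur_form R P V S (\<lambda>\<nu> vs. plug V (pcomp P (Suc (?k + length bs)) (length vs) ?k \<mu> \<nu>) (xs @ y # ys) (vs @ bs))"
      if "y \<in> carrier S" for y
      using schur_form_plug[of \<mu> "xs @ y # ys" bs] \<mu> that snoc.prems ys unfolding len by simp
    fix \<nu> vs assume \<nu>: "\<nu> \<in> carrier (ops P (length vs))" and vs: "set vs \<subseteq> carrier V"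
    have "pcomp P (Suc (?k + length bs)) (length vs) ?k \<mu> \<nu> \<in> carrier (ops P (Suc (length xs + length ys + length (vs @ bs))))"
      using pcomp_closed[of ?k "Suc (?k + length bs)" \<mu> \<nu> "length vs"] \<mu> \<nu> by (simp add: add_ac)
    then show "is_lin R S S (\<lambda>y. plug V (pcomp P (Suc (?k + length bs)) (length vs) ?k \<mu> \<nu>) (xs @ y # ys) (vs @ bs))"
      using snoc.prems vs ys by (intro snoc.hyps) simp_all
  qed
  then show ?case by simp
qed

text \<open>Linearity in a single entry allows a generator to be put there; once it stands in the
  last slot, \<open>plug_snoc_elt\<close> absorbs it into the operation.\<close>

lemma plug_eqI:
  assumes F: "is_lin R S N F" and \<mu>: "\<mu> \<in> carrier (ops P (Suc (length xs + length ys + length bs)))"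
    and c: "set xs \<subseteq> carrier S" "set ys \<subseteq> carrier S" "set bs \<subseteq> carrier V"
    and G: "is_lin R S N G"
    and eq: "\<And>\<nu> vs. \<nu> \<in> carrier (ops P (length vs)) \<Longrightarrow> set vs \<subseteq> carrier V \<Longrightarrow> F (plug V \<mu> (xs @ E \<nu> vs # ys) bs) = G (E \<nu> vs)"
    and y: "y \<in> carrier S"
  shows "F (plug V \<mu> (xs @ y # ys) bs) = G y"
  by (rule schur_eqI[OF V is_lin_comp[OF is_lin_plug[OF \<mu> c] F] G eq y])

lemma schur_unit_closed: "v \<in> carrier V \<Longrightarrow> \<eta> v \<in> carrier S"
  unfolding schur_unit_def using op_unit_closed by (intro elt_closed) simp_all

lemma is_lin_schur_unit: "is_lin R V S \<eta>"
  using multilinD[OF schur_formD(2)[OF elt_form, of "op_unit P" 1], of "[]" "[]"] op_unit_closed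
  unfolding schur_unit_def[abs_def] by simp

text \<open>By \<open>pcomp_unit_right\<close>, inserting a unit leaves \<mu> as it is, so an entry
  \<open>\<eta> v\<close> merely adds \<open>v\<close> to the trailing vectors.\<close>

lemma plug_units:
  assumes "\<mu> \<in> carrier (ops P (length us + length vs + length bs))"
    "set us \<subseteq> carrier S" "set vs \<subseteq> carrier V" "set bs \<subseteq> carrier V"
  shows "plug V \<mu> (us @ map \<eta> vs) bs = plug V \<mu> us (vs @ bs)"
  using assms
proof (induct vs arbitrary: bs rule: rev_induct)
  case (snoc v vs)
  let ?ys = "us @ map \<eta> vs"
  have ys: "set ?ys \<subseteq> carrier S" using snoc.prems schur_unit_closed by auto
  have \<mu>: "\<mu> \<in> carrier (ops P (Suc (length ?ys + length bs)))" using snoc.prems(1) by simp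
  have "plug V \<mu> (?ys @ [E (op_unit P) [v]]) bs
      = plug V (pcomp P (Suc (length ?ys + length bs)) (length [v]) (length ?ys) \<mu> (op_unit P)) ?ys ([v] @ bs)"
    using snoc.prems op_unit_closed by (intro plug_snoc_elt \<mu> ys) simp_all
  also have "pcomp P (Suc (length ?ys + length bs)) (length [v]) (length ?ys) \<mu> (op_unit P) = \<mu>"
    using pcomp_unit_right[OF _ \<mu>, of "length ?ys"] by simp
  also have "plug V \<mu> ?ys ([v] @ bs) = plug V \<mu> us (vs @ [v] @ bs)"
    using snoc.prems by (intro snoc.hyps) simp_all
  finally show ?case by (simp add: schur_unit_def)
qed simp

text \<open>The inner list shrinks from the right. A generator in its last slot is absorbed on both
  sides, and \<open>pcomp_sequential\<close> identifies inserting \<kappa> into \<nu> with inserting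
  it after \<nu> has been put into \<mu>. The tail \<open>es\<close> of the inner operation is where
  the vectors of absorbed generators go.\<close>

lemma plug_assoc_last:
  assumes "\<mu> \<in> carrier (ops P (Suc (length as + length ds)))"
    "\<nu> \<in> carrier (ops P (length bs + length es))"
    "set as \<subseteq> carrier S" "set bs \<subseteq> carrier S" "set ds \<subseteq> carrier V" "set es \<subseteq> carrier V"
  shows "plug V \<mu> (as @ [plug V \<nu> bs es]) ds
    = plug V (pcomp P (Suc (length as + length ds)) (length bs + length es) (length as) \<mu> \<nu>) (as @ bs) (es @ ds)"
  using assms
proof (induct bs arbitrary: \<nu> es rule: rev_induct)
  case Nil
  then show ?case using plug_snoc_elt[of \<mu> as ds \<nu> es] by (simp add: plug_Nil)
next
  case (snoc y bs)
  have y: "y \<in> carrier S" and bs: "set bs \<subseteq> carrier S" using snoc.prems by auto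
  have \<mu>: "\<mu> \<in> carrier (ops P (Suc (length as + length [] + length ds)))" using snoc.prems by simp
  have \<nu>: "\<nu> \<in> carrier (ops P (Suc (length bs + length [] + length es)))" using snoc.prems by simp
  let ?l = "Suc (length as + length ds)" and ?m = "Suc (length bs + length es)"
  have pc: "pcomp P ?l ?m (length as) \<mu> \<nu> \<in> carrier (ops P (Suc (length (as @ bs) + length [] + length (es @ ds))))"
    using pcomp_closed[of "length as" ?l \<mu> \<nu> ?m] \<mu> \<nu> by (simp add: add_ac)
  have "plug V \<mu> (as @ [plug V \<nu> (bs @ y # []) es]) ds = plug V (pcomp P ?l ?m (length as) \<mu> \<nu>) ((as @ bs) @ y # []) (es @ ds)"
  proof (rule plug_eqI[OF is_lin_plug[OF \<mu>] \<nu> bs _ _ is_lin_plug[OF pc] _ y])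
    fix \<kappa> vs assume \<kappa>: "\<kappa> \<in> carrier (ops P (length vs))" and vs: "set vs \<subseteq> carrier V"
    have "plug V \<nu> (bs @ [E \<kappa> vs]) es = plug V (pcomp P ?m (length vs) (length bs) \<nu> \<kappa>) bs (vs @ es)"
      using snoc.prems \<nu> \<kappa> vs bs by (intro plug_snoc_elt) simp_all
    moreover have pc2: "pcomp P ?m (length vs) (length bs) \<nu> \<kappa> \<in> carrier (ops P (length bs + length (vs @ es)))"
      using pcomp_closed[of "length bs" ?m \<nu> \<kappa> "length vs"] \<nu> \<kappa> by (simp add: add_ac)
    moreover have "plug V \<mu> (as @ [plug V (pcomp P ?m (length vs) (length bs) \<nu> \<kappa>) bs (vs @ es)]) ds
        = plug V (pcomp P ?l (length bs + length (vs @ es)) (length as) \<mu> (pcomp P ?m (length vs) (length bs) \<nu> \<kappa>)) (as @ bs) ((vs @ es) @ ds)"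
      using snoc.prems bs vs by (intro snoc.hyps pc2) simp_all
    moreover have "pcomp P (?l + ?m - 1) (length vs) (length as + length bs) (pcomp P ?l ?m (length as) \<mu> \<nu>) \<kappa>
        = pcomp P ?l (?m + length vs - 1) (length as) \<mu> (pcomp P ?m (length vs) (length bs) \<nu> \<kappa>)"
      using \<mu> \<nu> \<kappa> by (intro pcomp_sequential) simp_all
    moreover have "plug V (pcomp P ?l ?m (length as) \<mu> \<nu>) ((as @ bs) @ [E \<kappa> vs]) (es @ ds)
        = plug V (pcomp P (Suc (length (as @ bs) + length (es @ ds))) (length vs) (length (as @ bs)) (pcomp P ?l ?m (length as) \<mu> \<nu>) \<kappa>) (as @ bs) (vs @ es @ ds)"
      using snoc.prems pc \<kappa> vs bs by (intro plug_snoc_elt) simp_all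
    moreover have "?l + ?m - 1 = Suc (length (as @ bs) + length (es @ ds))"
      "?m + length vs - 1 = length bs + length (vs @ es)" "length as + length bs = length (as @ bs)" by simp_all
    ultimately show "plug V \<mu> (as @ plug V \<nu> (bs @ E \<kappa> vs # []) es # []) ds
        = plug V (pcomp P ?l ?m (length as) \<mu> \<nu>) ((as @ bs) @ E \<kappa> vs # []) (es @ ds)"
      by (simp only: append_assoc)
  qed (use snoc.prems in simp_all)
  then show ?case by simp
qed

text \<open>Entries to the right of the composite are absorbed as generators, and
  \<open>pcomp_parallel\<close> lets these insertions pass the insertion of \<nu>. Once none is
  left, the composite stands last and \<open>plug_assoc_last\<close> applies.\<close>

lemma plug_assoc:
  assumes "\<mu> \<in> carrier (ops P (Suc (length as + length cs + length ds)))" "\<nu> \<in> carrier (ops P (length bs))"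
    "set as \<subseteq> carrier S" "set bs \<subseteq> carrier S" "set cs \<subseteq> carrier S" "set ds \<subseteq> carrier V"
  shows "plug V \<mu> (as @ [plug V \<nu> bs []] @ cs) ds
    = plug V (pcomp P (Suc (length as + length cs + length ds)) (length bs) (length as) \<mu> \<nu>) (as @ bs @ cs) ds"
  using assms
proof (induct cs arbitrary: \<mu> ds rule: rev_induct)
  case Nil
  then show ?case using plug_assoc_last[of \<mu> as ds \<nu> bs "[]"] by simp
next
  case (snoc y cs)
  have y: "y \<in> carrier S" and cs: "set cs \<subseteq> carrier S" using snoc.prems by auto
  let ?a = "length as" and ?n = "length bs" and ?k = "Suc (length as + length cs)"
  let ?l = "Suc (?k + length ds)"
  let ?xs = "as @ [plug V \<nu> bs []] @ cs" and ?ys = "as @ bs @ cs"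
  have px: "plug V \<nu> bs [] \<in> carrier S" using snoc.prems by (intro plug_closed) simp_all
  have xs: "set ?xs \<subseteq> carrier S" using px snoc.prems by simp
  have ys: "set ?ys \<subseteq> carrier S" using snoc.prems by simp
  have \<mu>: "\<mu> \<in> carrier (ops P ?l)" using snoc.prems by simp
  have \<mu>': "\<mu> \<in> carrier (ops P (Suc (length ?xs + length [] + length ds)))" using \<mu> by simp
  have pc: "pcomp P ?l ?n ?a \<mu> \<nu> \<in> carrier (ops P (Suc (length ?ys + length [] + length ds)))"
    using pcomp_closed[of ?a ?l \<mu> \<nu> ?n] \<mu> snoc.prems(2) by (simp add: add_ac)
  have "plug V \<mu> (?xs @ y # []) ds = plug V (pcomp P ?l ?n ?a \<mu> \<nu>) (?ys @ y # []) ds"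
  proof (rule schur_eqI[OF V is_lin_plug[OF \<mu>' xs] is_lin_plug[OF pc ys] _ y])
    fix \<kappa> vs assume \<kappa>: "\<kappa> \<in> carrier (ops P (length vs))" and vs: "set vs \<subseteq> carrier V"
    let ?v = "length vs"
    have "plug V \<mu> (?xs @ [E \<kappa> vs]) ds = plug V (pcomp P (Suc (length ?xs + length ds)) ?v (length ?xs) \<mu> \<kappa>) ?xs (vs @ ds)"
      using \<mu>' xs snoc.prems \<kappa> vs by (intro plug_snoc_elt) simp_all
    also have "pcomp P (Suc (length ?xs + length ds)) ?v (length ?xs) \<mu> \<kappa> = pcomp P ?l ?v ?k \<mu> \<kappa>" by simp
    also have "plug V \<dots> ?xs (vs @ ds)
        = plug V (pcomp P (Suc (?a + length cs + length (vs @ ds))) ?n ?a (pcomp P ?l ?v ?k \<mu> \<kappa>) \<nu>) ?ys (vs @ ds)"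
    proof (rule snoc.hyps)
      show "pcomp P ?l ?v ?k \<mu> \<kappa> \<in> carrier (ops P (Suc (?a + length cs + length (vs @ ds))))"
        using pcomp_closed[of ?k ?l \<mu> \<kappa> ?v] \<mu> \<kappa> by (simp add: add_ac)
    qed (use snoc.prems cs vs in simp_all)
    also have "pcomp P (Suc (?a + length cs + length (vs @ ds))) ?n ?a (pcomp P ?l ?v ?k \<mu> \<kappa>) \<nu>
        = pcomp P (?l + ?v - 1) ?n ?a (pcomp P ?l ?v ?k \<mu> \<kappa>) \<nu>" by (simp add: add_ac)
    also have "\<dots> = pcomp P (?l + ?n - 1) ?v (?k + ?n - 1) (pcomp P ?l ?n ?a \<mu> \<nu>) \<kappa>"
      using \<mu> \<kappa> snoc.prems(2) by (intro pcomp_parallel[symmetric]) simp_all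
    also have "\<dots> = pcomp P (Suc (length ?ys + length ds)) ?v (length ?ys) (pcomp P ?l ?n ?a \<mu> \<nu>) \<kappa>"
      by (simp add: add_ac)
    also have "plug V \<dots> ?ys (vs @ ds) = plug V (pcomp P ?l ?n ?a \<mu> \<nu>) (?ys @ [E \<kappa> vs]) ds"
      using pc ys snoc.prems \<kappa> vs by (intro plug_snoc_elt[symmetric]) simp_all
    finally show "plug V \<mu> (?xs @ E \<kappa> vs # []) ds = plug V (pcomp P ?l ?n ?a \<mu> \<nu>) (?ys @ E \<kappa> vs # []) ds" .
  qed (use snoc.prems in simp_all)
  then show ?case by simp
qed

lemma is_lin_scomp_op:
  assumes "set ys \<subseteq> carrier S"
  shows "is_lin R (ops P (length ys)) S (\<lambda>\<mu>. scomp V \<mu> ys)"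
  using is_lin_plug_op[OF assms, of "[]"] by (simp add: scomp_def)

lemma scomp_closed: "\<mu> \<in> carrier (ops P (length ys)) \<Longrightarrow> set ys \<subseteq> carrier S \<Longrightarrow> scomp V \<mu> ys \<in> carrier S"
  using is_lin_closed[OF is_lin_scomp_op] by blast

lemma multilin_scomp:
  assumes "\<mu> \<in> carrier (ops P n)" shows "multilin R S S n (scomp V \<mu>)"
  unfolding scomp_def using assms by (intro multilinI is_lin_plug) auto

lemma scomp_units:
  assumes "\<mu> \<in> carrier (ops P (length vs))" "set vs \<subseteq> carrier V"
  shows "scomp V \<mu> (map \<eta> vs) = E \<mu> vs"
  using plug_units[of \<mu> "[]" vs "[]"] assms by (simp add: scomp_def plug_Nil)

lemma scomp_assoc:
  assumes "\<mu> \<in> carrier (ops P (Suc (length as + length cs)))" "\<nu> \<in> carrier (ops P (length bs))"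
    "set as \<subseteq> carrier S" "set bs \<subseteq> carrier S" "set cs \<subseteq> carrier S"
  shows "scomp V \<mu> (as @ [scomp V \<nu> bs] @ cs)
    = scomp V (pcomp P (Suc (length as + length cs)) (length bs) (length as) \<mu> \<nu>) (as @ bs @ cs)"
  using plug_assoc[of \<mu> as cs "[]" \<nu> bs] assms by (simp add: scomp_def)

lemma scomp_unit:
  assumes "y \<in> carrier S"
  shows "scomp V (op_unit P) [y] = y"
proof -
  have u: "op_unit P \<in> carrier (ops P (Suc (length [] + length [])))" using op_unit_closed by simp
  have "scomp V (op_unit P) ([] @ y # []) = y"
  proof (rule schur_eqI[OF V _ is_lin_id _ assms])
    show "is_lin R S S (\<lambda>y. scomp V (op_unit P) ([] @ y # []))"
      by (rule multilinD[OF multilin_scomp[OF u]]) simp_all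
    fix \<nu> vs assume "\<nu> \<in> carrier (ops P (length vs))" "set vs \<subseteq> carrier V"
    then show "scomp V (op_unit P) ([] @ E \<nu> vs # []) = E \<nu> vs"
      using plug_snoc_elt[of "op_unit P" "[]" "[]" \<nu> vs] u pcomp_unit_left[of \<nu> "length vs"]
      by (simp add: scomp_def plug_Nil)
  qed
  then show ?thesis by simp
qed

text \<open>Replacing \<open>(\<nu>; v\<^sub>0,\<dots>)\<close> by \<open>\<nu>(\<eta> v\<^sub>0,\<dots>)\<close> and moving \<open>\<nu>\<close> into \<open>\<mu>\<close> by associativity turns the entries
  one after the other into units, so that only the equivariance of a single partial composition is needed.\<close>

lemma scomp_equivariant_units:
  assumes "\<mu> \<in> carrier (ops P (length us + length vs))" "\<sigma> permutes {..<length us + length vs}"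
    "set us \<subseteq> carrier S" "set vs \<subseteq> carrier V"
  shows "scomp V (act P (length us + length vs) \<mu> \<sigma>) (permute_list \<sigma> (us @ map \<eta> vs)) = scomp V \<mu> (us @ map \<eta> vs)"
  using assms
proof (induct us arbitrary: \<mu> \<sigma> vs rule: rev_induct)
  case Nil
  then show ?case
    using act_closed[OF V, of \<mu> "length vs" \<sigma>] schur_formD(3)[OF elt_form, of \<mu> vs \<sigma>]
      scomp_units[of "act P (length vs) \<mu> \<sigma>" "permute_list \<sigma> vs"]
    by (simp add: scomp_units permute_list_map)
next
  case (snoc y us)
  let ?cs = "map \<eta> vs" let ?m = "Suc (length us + length ?cs)"
  have y: "y \<in> carrier S" and us: "set us \<subseteq> carrier S" using snoc.prems by auto
  have cs: "set ?cs \<subseteq> carrier S" using snoc.prems(4) schur_unit_closed by auto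
  have \<mu>: "\<mu> \<in> carrier (ops P ?m)" and \<sigma>: "\<sigma> permutes {..<?m}" using snoc.prems by simp_all
  \<comment> \<open>\<open>i\<close> is the position to which the permutation brings
    \<open>y\<close>; the data describe the same rearrangement after \<open>y\<close> is widened to
    a block of units.\<close>
  obtain i as' cs' where i: "i < ?m" "\<sigma> i = length us" "length as' = i"
    and sub: "set as' \<subseteq> set us \<union> set ?cs" "set cs' \<subseteq> set us \<union> set ?cs"
    and len: "length as' + length cs' = length us + length ?cs"
    and perm: "\<And>y. permute_list \<sigma> (us @ y # ?cs) = as' @ y # cs'"
    and pperm: "\<And>bs. permute_list (pcomp_perm ?m (length bs) i \<sigma> id) (us @ bs @ ?cs) = as' @ bs @ cs'"
    using permute_list_insert[OF \<sigma>] by metis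
  have c': "set as' \<subseteq> carrier S" "set cs' \<subseteq> carrier S" using sub us cs by blast+
  have \<mu>\<sigma>: "act P ?m \<mu> \<sigma> \<in> carrier (ops P ?m)" by (rule act_closed[OF V \<mu> \<sigma>])
  have "scomp V (act P ?m \<mu> \<sigma>) (as' @ y # cs') = scomp V \<mu> (us @ y # ?cs)"
  proof (rule schur_eqI[OF V multilinD[OF multilin_scomp[OF \<mu>\<sigma>] _ c'] multilinD[OF multilin_scomp[OF \<mu>] _ us cs] _ y])
    fix \<nu> ws assume \<nu>: "\<nu> \<in> carrier (ops P (length ws))" and ws: "set ws \<subseteq> carrier V"
    let ?bs = "map \<eta> ws" let ?n = "length ?bs"
    have bs: "set ?bs \<subseteq> carrier S" using ws schur_unit_closed by auto
    have e: "E \<nu> ws = scomp V \<nu> ?bs" using scomp_units[OF \<nu> ws] by simp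
    have \<nu>': "\<nu> \<in> carrier (ops P ?n)" using \<nu> by simp
    have pc: "pcomp P ?m ?n (length us) \<mu> \<nu> \<in> carrier (ops P (length us + length (ws @ vs)))"
      using pcomp_closed[of "length us" ?m \<mu> \<nu> ?n] \<mu> \<nu> by (simp add: add_ac)
    have pp: "pcomp_perm ?m ?n i \<sigma> id permutes {..<length us + length (ws @ vs)}"
      using pcomp_perm_permutes[OF \<sigma> i(1), of ?n] by (simp add: add_ac)
    have "scomp V (act P ?m \<mu> \<sigma>) (as' @ [scomp V \<nu> ?bs] @ cs')
        = scomp V (pcomp P (Suc (length as' + length cs')) ?n (length as') (act P ?m \<mu> \<sigma>) \<nu>) (as' @ ?bs @ cs')"
      using \<mu>\<sigma> \<nu>' c' bs len by (intro scomp_assoc) simp_all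
    also have "pcomp P (Suc (length as' + length cs')) ?n (length as') (act P ?m \<mu> \<sigma>) \<nu>
        = pcomp P ?m ?n i (act P ?m \<mu> \<sigma>) (act P ?n \<nu> id)"
      unfolding i(3) len[unfolded i(3)] act_id[OF \<nu>'] ..
    also have "\<dots> = act P (?m + ?n - 1) (pcomp P ?m ?n (\<sigma> i) \<mu> \<nu>) (pcomp_perm ?m ?n i \<sigma> id)"
      by (intro pcomp_equivariant i \<sigma> \<mu> \<nu>' permutes_id)
    also have "\<dots> = act P (length us + length (ws @ vs)) (pcomp P ?m ?n (length us) \<mu> \<nu>) (pcomp_perm ?m ?n i \<sigma> id)"
      by (simp add: i(2) add_ac)
    also have "as' @ ?bs @ cs' = permute_list (pcomp_perm ?m ?n i \<sigma> id) (us @ map \<eta> (ws @ vs))"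
      using pperm[of ?bs] by simp
    \<comment> \<open>The induction hypothesis applies because one entry fewer lies outside the
      block of units. The arity, the operation and the permutation have all changed, hence the
      generalisation over \<mu>, \<sigma> and \<open>vs\<close>.\<close>
    also have "scomp V (act P (length us + length (ws @ vs)) (pcomp P ?m ?n (length us) \<mu> \<nu>) (pcomp_perm ?m ?n i \<sigma> id))
        (permute_list (pcomp_perm ?m ?n i \<sigma> id) (us @ map \<eta> (ws @ vs)))
        = scomp V (pcomp P ?m ?n (length us) \<mu> \<nu>) (us @ map \<eta> (ws @ vs))"
      using ws snoc.prems(4) by (intro snoc.hyps pc pp us) simp
    also have "us @ map \<eta> (ws @ vs) = us @ ?bs @ ?cs" by simp
    also have "scomp V (pcomp P ?m ?n (length us) \<mu> \<nu>) (us @ ?bs @ ?cs) = scomp V \<mu> (us @ [scomp V \<nu> ?bs] @ ?cs)"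
      by (rule scomp_assoc[symmetric, OF \<mu> \<nu>' us bs cs])
    finally show "scomp V (act P ?m \<mu> \<sigma>) (as' @ E \<nu> ws # cs') = scomp V \<mu> (us @ E \<nu> ws # ?cs)"
      unfolding e by simp
  qed (use len in simp_all)
  then show ?case using perm[of y] by simp
qed

lemma schur_form_scomp: "schur_form R P S S (scomp V)"
proof (rule schur_formI)
  fix \<sigma> ys \<mu>
  assume "\<mu> \<in> carrier (ops P (length ys))" "set ys \<subseteq> carrier S" "\<sigma> permutes {..<length ys}"
  then show "scomp V (act P (length ys) \<mu> \<sigma>) (permute_list \<sigma> ys) = scomp V \<mu> ys"
    using scomp_equivariant_units[of \<mu> ys "[]" \<sigma>] by simp
qed (auto intro: is_lin_scomp_op multilin_scomp)

section \<open>Identification with the multiplication of the monad\<close>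

lemma plug_elts:
  assumes "\<forall>(\<nu>, vs)\<in>set ys. \<nu> \<in> carrier (ops P (length vs)) \<and> set vs \<subseteq> carrier V"
    and "\<mu> \<in> carrier (ops P (length ys + length bs))" "set bs \<subseteq> carrier V"
  shows "plug V \<mu> (map (\<lambda>(\<nu>, vs). E \<nu> vs) ys) bs
    = E (pcomp_rev P (length ys + length bs) \<mu> (rev (map (\<lambda>(\<nu>, vs). (length vs, \<nu>)) ys))) (concat (map snd ys) @ bs)"
  using assms
\<comment> \<open>Both recursions consume the last entry first, so \<open>plug_snoc_elt\<close> and
  the recursion equation of \<open>pcomp_rev\<close> agree without any renumbering of
  inputs.\<close>
proof (induct ys arbitrary: \<mu> bs rule: rev_induct)
  case Nil
  then show ?case by (simp add: plug_Nil)
next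
  case (snoc y ys)
  obtain \<nu> vs where y: "y = (\<nu>, vs)" by (cases y)
  let ?ys = "map (\<lambda>(\<nu>, vs). E \<nu> vs) ys"
  have \<nu>: "\<nu> \<in> carrier (ops P (length vs))" and vs: "set vs \<subseteq> carrier V" using snoc.prems(1) y by auto
  have ys: "set ?ys \<subseteq> carrier S" using snoc.prems(1) elt_closed by auto
  have \<mu>: "\<mu> \<in> carrier (ops P (Suc (length ?ys + length bs)))" using snoc.prems(2) by simp
  have pc: "pcomp P (Suc (length ys + length bs)) (length vs) (length ys) \<mu> \<nu> \<in> carrier (ops P (length ys + length (vs @ bs)))"
    using pcomp_closed[of "length ys" "Suc (length ys + length bs)" \<mu> \<nu> "length vs"] \<mu> \<nu> by (simp add: add_ac)
  have "plug V \<mu> (?ys @ [E \<nu> vs]) bs = plug V (pcomp P (Suc (length ys + length bs)) (length vs) (length ys) \<mu> \<nu>) ?ys (vs @ bs)"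
    using plug_snoc_elt[OF \<mu> ys snoc.prems(3) \<nu> vs] by simp
  also have "\<dots> = E (pcomp_rev P (length ys + length (vs @ bs)) (pcomp P (Suc (length ys + length bs)) (length vs) (length ys) \<mu> \<nu>)
      (rev (map (\<lambda>(\<nu>, vs). (length vs, \<nu>)) ys))) (concat (map snd ys) @ vs @ bs)"
    using snoc.prems vs by (intro snoc.hyps pc) simp_all
  finally show ?case by (simp add: y add_ac)
qed

lemma scomp_elts:
  assumes "\<forall>(\<nu>, vs)\<in>set ys. \<nu> \<in> carrier (ops P (length vs)) \<and> set vs \<subseteq> carrier V"
    and "\<mu> \<in> carrier (ops P (length ys))"
  shows "scomp V \<mu> (map (\<lambda>(\<nu>, vs). E \<nu> vs) ys)
    = E (full_comp P \<mu> (map (\<lambda>(\<nu>, vs). (length vs, \<nu>)) ys)) (concat (map snd ys))"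
  using plug_elts[of ys \<mu> "[]"] assms by (simp add: scomp_def full_comp_def)

text \<open>Existence is \<open>scomp_elts\<close>. For uniqueness, the description fixes
  \<open>G\<close> only where all entries are generators; multilinearity in the entries extends this
  to all generators of the outer S(P,S(P,V)), and linearity to the whole module.\<close>

lemma schur_mult_eq: "schur_mult R P V = restrict (schur_lift S S (scomp V)) (carrier (schur R P S))"
  unfolding schur_mult_def
proof (rule the_equality)
  let ?e = "map (\<lambda>(\<nu>, vs). E \<nu> vs)"
  let ?Q = "\<lambda>G. G \<in> lin_hom R (schur R P S) S \<and>
    (\<forall>ys. \<forall>\<mu>\<in>carrier (ops P (length ys)). (\<forall>(\<nu>, vs)\<in>set ys. \<nu> \<in> carrier (ops P (length vs)) \<and> set vs \<subseteq> carrier V) \<longrightarrow>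
      G (schur_elt R P S \<mu> (?e ys)) = E (full_comp P \<mu> (map (\<lambda>(\<nu>, vs). (length vs, \<nu>)) ys)) (concat (map snd ys)))"
  note SS = schur_is_module[OF S]
  note lin = is_lin_schur_lift[OF S S schur_form_scomp]
  have ec: "set (?e ys) \<subseteq> carrier S"
    if "\<forall>(\<nu>, vs)\<in>set ys. \<nu> \<in> carrier (ops P (length vs)) \<and> set vs \<subseteq> carrier V" for ys
    using that by (auto intro: elt_closed)
  have val: "schur_lift S S (scomp V) (schur_elt R P S \<mu> ys) = scomp V \<mu> ys"
    if "\<mu> \<in> carrier (ops P (length ys))" "set ys \<subseteq> carrier S" for \<mu> ys
    using schur_lift_elt[OF S S schur_form_scomp that] .
  show "?Q (restrict (schur_lift S S (scomp V)) (carrier (schur R P S)))"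
  proof (intro conjI allI ballI impI)
    fix ys \<mu> assume \<mu>: "\<mu> \<in> carrier (ops P (length ys))"
      and ys: "\<forall>(\<nu>, vs)\<in>set ys. \<nu> \<in> carrier (ops P (length vs)) \<and> set vs \<subseteq> carrier V"
    have "schur_elt R P S \<mu> (?e ys) \<in> carrier (schur R P S)"
      using \<mu> ec[OF ys] by (intro schur_formD(4)[OF schur_form_schur_elt[OF S]]) simp_all
    then show "restrict (schur_lift S S (scomp V)) (carrier (schur R P S)) (schur_elt R P S \<mu> (?e ys))
        = E (full_comp P \<mu> (map (\<lambda>(\<nu>, vs). (length vs, \<nu>)) ys)) (concat (map snd ys))"
      using val[of \<mu> "?e ys"] \<mu> ec[OF ys] scomp_elts[OF ys \<mu>] by simp
  qed (rule restrict_lin_hom[OF lin SS])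
  fix G assume G: "?Q G"
  then have G': "is_lin R (schur R P S) S G" "G \<in> extensional (carrier (schur R P S))" by (simp_all add: lin_hom_iff)
  show "G = restrict (schur_lift S S (scomp V)) (carrier (schur R P S))"
  proof (rule extensionalityI[OF G'(2)])
    fix s assume s: "s \<in> carrier (schur R P S)"
    have "G s = schur_lift S S (scomp V) s"
    proof (rule schur_eqI[OF S G'(1) lin _ s])
      fix \<mu> ys assume \<mu>: "\<mu> \<in> carrier (ops P (length ys))" and ys: "set ys \<subseteq> carrier S"
      have "G (schur_elt R P S \<mu> ys) = scomp V \<mu> ys"
      proof (rule multilin_schur_eqI[OF V multilin_comp[OF schur_formD(2)[OF schur_form_schur_elt[OF S] \<mu>] G'(1)] multilin_scomp[OF \<mu>] _ refl ys])
        fix zs assume z: "length zs = length ys" "\<forall>(\<nu>, vs)\<in>set zs. \<nu> \<in> carrier (ops P (length vs)) \<and> set vs \<subseteq> carrier V"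
        have \<mu>': "\<mu> \<in> carrier (ops P (length zs))" using \<mu> z by simp
        show "G (schur_elt R P S \<mu> (?e zs)) = scomp V \<mu> (?e zs)"
          unfolding scomp_elts[OF z(2) \<mu>'] using conjunct2[OF G] z(2) \<mu>' by blast
      qed
      then show "G (schur_elt R P S \<mu> ys) = schur_lift S S (scomp V) (schur_elt R P S \<mu> ys)"
        using val[OF \<mu> ys] by simp
    qed
    then show "G s = restrict (schur_lift S S (scomp V)) (carrier (schur R P S)) s" using s by simp
  qed simp
qed

lemma is_lin_schur_mult: "is_lin R (schur R P S) S (schur_mult R P V)"
  unfolding schur_mult_eq
  by (rule is_lin_cong[OF is_lin_schur_lift[OF S S schur_form_scomp] schur_is_module[OF S]]) simp

lemma schur_mult_elt:
  assumes "\<mu> \<in> carrier (ops P (length ys))" "set ys \<subseteq> carrier S"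
  shows "schur_mult R P V (schur_elt R P S \<mu> ys) = scomp V \<mu> ys"
  unfolding schur_mult_eq
  using schur_lift_elt[OF S S schur_form_scomp assms] schur_formD(4)[OF schur_form_schur_elt[OF S] assms] by simp

end

end

section \<open>Substitution and derivations\<close>

lemma (in abelian_monoid) finsum_swap:
  assumes "finite A" "\<And>i j. i \<in> A \<Longrightarrow> j \<in> B \<Longrightarrow> f i j \<in> carrier G"
  shows "(\<Oplus>i\<in>A. \<Oplus>j\<in>B. f i j) = (\<Oplus>j\<in>B. \<Oplus>i\<in>A. f i j)"
  using assms
proof (induct A rule: finite_induct)
  case empty
  then show ?case by simp
next
  case (insert a A)
  have "(\<Oplus>i\<in>insert a A. \<Oplus>j\<in>B. f i j) = (\<Oplus>j\<in>B. f a j) \<oplus> (\<Oplus>j\<in>B. \<Oplus>i\<in>A. f i j)"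
    using insert by (subst finsum_insert) (auto intro!: finsum_closed)
  also have "\<dots> = (\<Oplus>j\<in>B. f a j \<oplus> (\<Oplus>i\<in>A. f i j))"
    using insert by (intro finsum_addf[symmetric]) (auto intro!: finsum_closed)
  also have "\<dots> = (\<Oplus>j\<in>B. \<Oplus>i\<in>insert a A. f i j)"
    using insert by (intro finsum_cong') (auto intro!: finsum_closed finsum_insert[symmetric])
  finally show ?case .
qed

text \<open>The derivative of a multilinear map \<open>L\<close> at \<open>xs\<close> in direction \<open>zs\<close>.\<close>

definition dsum :: "('r, 'b) module \<Rightarrow> ('a list \<Rightarrow> 'b) \<Rightarrow> 'a list \<Rightarrow> 'a list \<Rightarrow> 'b" where
  "dsum N L xs zs = (\<Oplus>\<^bsub>N\<^esub>i\<in>{..<length xs}. L (xs[i := zs ! i]))"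

lemma set_list_update_nth_closed:
  assumes "set xs \<subseteq> A" "set zs \<subseteq> A" "length zs = length xs"
  shows "set (xs[i := zs ! i]) \<subseteq> A"
proof (cases "i < length xs")
  case True
  then have "zs ! i \<in> A" using assms by auto
  then show ?thesis using set_update_subset_insert[of xs i "zs ! i"] assms(1) by blast
qed (simp add: list_update_beyond assms)

text \<open>\<open>X\<close> is the set of admissible entries. Splitting the index range of
  \<open>dsum\<close> relies only on values lying in the carrier, which \<open>closed_at\<close>
  records.\<close>

locale multilinear_sum = module R N for R :: "'r ring" and N :: "('r, 'b) module" +
  fixes X :: "'a set"
begin

definition closed_at :: "('a list \<Rightarrow> 'b) \<Rightarrow> nat \<Rightarrow> bool" where
  "closed_at L n \<longleftrightarrow> (\<forall>xs. length xs = n \<longrightarrow> set xs \<subseteq> X \<longrightarrow> L xs \<in> carrier N)"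

lemma dsum_closed:
  assumes "closed_at L (length xs)" "set xs \<subseteq> X" "set zs \<subseteq> X" "length zs = length xs"
  shows "dsum N L xs zs \<in> carrier N"
  using assms set_list_update_nth_closed[OF assms(2,3,4)]
  by (auto simp: dsum_def closed_at_def intro!: finsum_closed)

lemma dsum_cong:
  assumes "closed_at L (length xs)" "set xs \<subseteq> X" "set zs \<subseteq> X" "length zs = length xs"
    and "\<And>ys. length ys = length xs \<Longrightarrow> set ys \<subseteq> X \<Longrightarrow> L' ys = L ys"
  shows "dsum N L' xs zs = dsum N L xs zs"
  using assms set_list_update_nth_closed[OF assms(2,3,4)]
  by (auto simp: dsum_def closed_at_def intro!: finsum_cong')

lemma dsum_append:
  assumes L: "closed_at L (length xs + length xs')"
    and c: "set xs \<subseteq> X" "set xs' \<subseteq> X" "set zs \<subseteq> X" "set zs' \<subseteq> X"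
    and l: "length zs = length xs" "length zs' = length xs'"
  shows "dsum N L (xs @ xs') (zs @ zs')
    = dsum N (\<lambda>ys. L (ys @ xs')) xs zs \<oplus>\<^bsub>N\<^esub> dsum N (\<lambda>ys. L (xs @ ys)) xs' zs'"
proof -
  let ?f = "\<lambda>i. L ((xs @ xs')[i := (zs @ zs') ! i])"
  let ?n = "length xs"
  have fc: "?f i \<in> carrier N" for i
    using L c l set_list_update_nth_closed[of "xs @ xs'" X "zs @ zs'" i] by (simp add: closed_at_def)
  have un: "{..<?n + length xs'} = {..<?n} \<union> (\<lambda>i. ?n + i) ` {..<length xs'}"
  proof (rule Set.set_eqI, rule iffI)
    fix j assume j: "j \<in> {..<?n + length xs'}"
    show "j \<in> {..<?n} \<union> (\<lambda>i. ?n + i) ` {..<length xs'}"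
    proof (cases "j < ?n")
      case False
      then have "j = ?n + (j - ?n)" "j - ?n < length xs'" using j by auto
      then show ?thesis by blast
    qed simp
  qed auto
  have "dsum N L (xs @ xs') (zs @ zs') = (\<Oplus>\<^bsub>N\<^esub>i\<in>{..<?n + length xs'}. ?f i)"
    by (simp add: dsum_def)
  also have "\<dots> = (\<Oplus>\<^bsub>N\<^esub>i\<in>{..<?n}. ?f i) \<oplus>\<^bsub>N\<^esub> (\<Oplus>\<^bsub>N\<^esub>i\<in>(\<lambda>i. ?n + i) ` {..<length xs'}. ?f i)"
    unfolding un using fc by (intro M.finsum_Un_disjoint) auto
  also have "(\<Oplus>\<^bsub>N\<^esub>i\<in>{..<?n}. ?f i) = dsum N (\<lambda>ys. L (ys @ xs')) xs zs"
    unfolding dsum_def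
  proof (intro M.finsum_cong' refl)
    show eq: "?f i = L (xs[i := zs ! i] @ xs')" if "i \<in> {..<?n}" for i
      using that l by (simp add: list_update_append nth_append)
    show "(\<lambda>i. L (xs[i := zs ! i] @ xs')) \<in> {..<?n} \<rightarrow> carrier N"
      using fc eq by (metis (no_types, lifting) Pi_I)
  qed
  also have "(\<Oplus>\<^bsub>N\<^esub>i\<in>(\<lambda>i. ?n + i) ` {..<length xs'}. ?f i) = (\<Oplus>\<^bsub>N\<^esub>i\<in>{..<length xs'}. ?f (?n + i))"
    using fc by (intro M.finsum_reindex) auto
  also have "(\<lambda>i. ?f (?n + i)) = (\<lambda>i. L (xs @ xs'[i := zs' ! i]))"
    using l by (simp add: list_update_append nth_append)
  finally show ?thesis by (simp add: dsum_def)
qed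

lemma dsum_single: "closed_at L 1 \<Longrightarrow> z \<in> X \<Longrightarrow> dsum N L [x] [z] = L [z]"
proof -
  assume "closed_at L 1" "z \<in> X"
  then have "L [z] \<in> carrier N" by (simp add: closed_at_def)
  moreover have "{..<Suc 0} = {0}" by auto
  ultimately show ?thesis by (simp add: dsum_def)
qed

text \<open>The sum is sorted by whether the differentiated entry lies before, at or behind
  \<open>x\<close>; the middle term is the one in which \<open>x\<close> itself gives way to its
  derivative \<open>z\<close>.\<close>

lemma dsum_middle:
  assumes L: "closed_at L (Suc (length as + length bs))"
    and c: "set as \<subseteq> X" "set as' \<subseteq> X" "set bs \<subseteq> X" "set bs' \<subseteq> X" "x \<in> X" "z \<in> X"
    and l: "length as' = length as" "length bs' = length bs"
  shows "dsum N L (as @ x # bs) (as' @ z # bs')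
    = dsum N (\<lambda>ys. L (ys @ x # bs)) as as' \<oplus>\<^bsub>N\<^esub> (L (as @ z # bs) \<oplus>\<^bsub>N\<^esub> dsum N (\<lambda>ys. L (as @ x # ys)) bs bs')"
proof -
  have ca: "closed_at (\<lambda>ys. L (as @ ys)) (length ([x] @ bs))"
    and cb: "closed_at (\<lambda>ys. L (as @ ys @ bs)) 1"
    using L c by (auto simp: closed_at_def)
  have "dsum N L (as @ [x] @ bs) (as' @ [z] @ bs')
    = dsum N (\<lambda>ys. L (ys @ [x] @ bs)) as as' \<oplus>\<^bsub>N\<^esub> dsum N (\<lambda>ys. L (as @ ys)) ([x] @ bs) ([z] @ bs')"
    using L c l by (intro dsum_append) auto
  also have "dsum N (\<lambda>ys. L (as @ ys)) ([x] @ bs) ([z] @ bs')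
    = dsum N (\<lambda>ys. L (as @ ys @ bs)) [x] [z] \<oplus>\<^bsub>N\<^esub> dsum N (\<lambda>ys. L (as @ [x] @ ys)) bs bs'"
    using ca c l by (subst dsum_append) auto
  also have "dsum N (\<lambda>ys. L (as @ ys @ bs)) [x] [z] = L (as @ [z] @ bs)"
    using dsum_single[OF cb c(6)] by simp
  finally show ?thesis by simp
qed

end

text \<open>Each summand contains \<open>v\<close> in exactly one slot: as \<open>g v\<close> in the
  summand that differentiates this slot, as \<open>f v\<close> in all others. So every summand is
  linear in \<open>v\<close>.\<close>

lemma is_lin_multilin_dsum:
  assumes V: "module R V" and N: "module R N" and L: "multilin R W N (Suc (length as + length bs)) L"
    and f: "is_lin R V W f" and g: "is_lin R V W g"
    and c: "set as \<subseteq> carrier W" "set as' \<subseteq> carrier W" "set bs \<subseteq> carrier W" "set bs' \<subseteq> carrier W"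
    and l: "length as' = length as" "length bs' = length bs"
  shows "is_lin R V N (\<lambda>v. dsum N L (as @ f v # bs) (as' @ g v # bs'))"
proof -
  have "is_lin R V N (\<lambda>v. L ((as @ f v # bs)[i := (as' @ g v # bs') ! i]))" if i: "i < Suc (length as + length bs)" for i
  proof -
    consider "i < length as" | "i = length as" | "length as < i" by linarith
    then show ?thesis
    proof cases
      case 1
      have "is_lin R W N (\<lambda>w. L (as[i := as' ! i] @ w # bs))"
        using c l 1 by (intro multilinD[OF L] set_list_update_nth_closed) simp_all
      from is_lin_comp[OF f this] show ?thesis using 1 l by (simp add: list_update_append nth_append)
    next
      case 2
      have "is_lin R W N (\<lambda>w. L (as @ w # bs))" using c by (intro multilinD[OF L]) simp_all
      from is_lin_comp[OF g this] show ?thesis using 2 l by (simp add: nth_append)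
    next
      case 3
      then obtain j where j: "i = Suc (length as + j)" using less_imp_Suc_add by blast
      have "is_lin R W N (\<lambda>w. L (as @ w # bs[j := bs' ! j]))"
        using c l by (intro multilinD[OF L] set_list_update_nth_closed) simp_all
      from is_lin_comp[OF f this] show ?thesis using j l by (simp add: list_update_append nth_append)
    qed
  qed
  from is_lin_finsum_fun[OF this V N, of "{..<Suc (length as + length bs)}"] show ?thesis
    by (simp add: dsum_def)
qed

section \<open>Functoriality, Kleisli extension and derivations\<close>

context operad
begin

lemma schur_map_eq:
  "schur_map R P V W f = schur_lift V (schur R P W) (\<lambda>\<mu> vs. schur_elt R P W \<mu> (map f vs))"
  unfolding schur_map_def schur_lift_def ..

lemma schur_map:
  assumes V: "module R V" and W: "module R W" and f: "is_lin R V W f"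
  shows is_lin_schur_map: "is_lin R (schur R P V) (schur R P W) (schur_map R P V W f)"
    and schur_map_elt: "\<And>\<mu> vs. \<mu> \<in> carrier (ops P (length vs)) \<Longrightarrow> set vs \<subseteq> carrier V \<Longrightarrow>
      schur_map R P V W f (schur_elt R P V \<mu> vs) = schur_elt R P W \<mu> (map f vs)"
  unfolding schur_map_eq
  using schur_lift[OF V schur_is_module[OF W] schur_form_map[OF schur_form_schur_elt[OF W] f]] by simp_all

text \<open>The Kleisli extension of \<kappa>. In terms of it the monad laws take the form of
  \<open>bind_unit\<close>, \<open>bind_unit_right\<close> and \<open>bind_bind\<close>.\<close>

definition bind ::
  "('r, 'v) module \<Rightarrow> ('r, 'w) module \<Rightarrow> ('v \<Rightarrow> ('r, 'p, 'w) schur) \<Rightarrow> ('r, 'p, 'v) schur \<Rightarrow> ('r, 'p, 'w) schur" where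
  "bind V W \<kappa> s = schur_mult R P W (schur_map R P V (schur R P W) \<kappa> s)"

lemma bind:
  assumes V: "module R V" and W: "module R W" and \<kappa>: "is_lin R V (schur R P W) \<kappa>"
  shows is_lin_bind: "is_lin R (schur R P V) (schur R P W) (bind V W \<kappa>)"
    and bind_elt: "\<And>\<mu> vs. \<mu> \<in> carrier (ops P (length vs)) \<Longrightarrow> set vs \<subseteq> carrier V \<Longrightarrow>
      bind V W \<kappa> (schur_elt R P V \<mu> vs) = scomp W \<mu> (map \<kappa> vs)"
proof -
  note SW = schur_is_module[OF W]
  show "is_lin R (schur R P V) (schur R P W) (bind V W \<kappa>)"
    unfolding bind_def[abs_def] by (rule is_lin_comp[OF is_lin_schur_map[OF V SW \<kappa>] is_lin_schur_mult[OF W]])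
  fix \<mu> vs assume "\<mu> \<in> carrier (ops P (length vs))" "set vs \<subseteq> carrier V"
  moreover from this have "set (map \<kappa> vs) \<subseteq> carrier (schur R P W)" using is_lin_closed[OF \<kappa>] by auto
  ultimately show "bind V W \<kappa> (schur_elt R P V \<mu> vs) = scomp W \<mu> (map \<kappa> vs)"
    unfolding bind_def by (simp add: schur_map_elt[OF V SW \<kappa>] schur_mult_elt[OF W])
qed

text \<open>The maps produced by \<open>kleisli_of\<close> are compared only on the carrier, and
  generators with entries in the carrier see no more than that.\<close>

lemma bind_cong:
  assumes V: "module R V" and W: "module R W" and \<kappa>: "is_lin R V (schur R P W) \<kappa>"
    and eq: "\<And>v. v \<in> carrier V \<Longrightarrow> \<kappa>' v = \<kappa> v" and s: "s \<in> carrier (schur R P V)"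
  shows "bind V W \<kappa>' s = bind V W \<kappa> s"
proof -
  have \<kappa>': "is_lin R V (schur R P W) \<kappa>'" by (rule is_lin_cong[OF \<kappa> V eq])
  show ?thesis
  proof (rule schur_eqI[OF V is_lin_bind[OF V W \<kappa>'] is_lin_bind[OF V W \<kappa>] _ s])
    fix \<mu> vs assume a: "\<mu> \<in> carrier (ops P (length vs))" "set vs \<subseteq> carrier V"
    have "map \<kappa>' vs = map \<kappa> vs" using a(2) eq by auto
    then show "bind V W \<kappa>' (schur_elt R P V \<mu> vs) = bind V W \<kappa> (schur_elt R P V \<mu> vs)"
      unfolding bind_elt[OF V W \<kappa> a] bind_elt[OF V W \<kappa>' a] by (rule arg_cong)
  qed
qed

lemma bind_unit:
  assumes V: "module R V" and W: "module R W" and \<kappa>: "is_lin R V (schur R P W) \<kappa>" and v: "v \<in> carrier V"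
  shows "bind V W \<kappa> (schur_unit R P V v) = \<kappa> v"
proof -
  have "bind V W \<kappa> (schur_elt R P V (op_unit P) [v]) = scomp W (op_unit P) (map \<kappa> [v])"
    using op_unit_closed v by (intro bind_elt[OF V W \<kappa>]) simp_all
  then show ?thesis using scomp_unit[OF W is_lin_closed[OF \<kappa> v]] by (simp add: schur_unit_def)
qed

lemma bind_unit_right:
  assumes V: "module R V" and s: "s \<in> carrier (schur R P V)"
  shows "bind V V (schur_unit R P V) s = s"
  by (rule schur_eqI[OF V is_lin_bind[OF V V is_lin_schur_unit[OF V]] is_lin_id _ s])
    (simp add: bind_elt[OF V V is_lin_schur_unit[OF V]] scomp_units[OF V])

text \<open>A Kleisli extension is compatible with operadic composition. A trailing vector
  \<open>v\<close> contributes \<open>\<kappa> v\<close>; a generator absorbed into the operation on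
  the left is split off again on the right by \<open>scomp_assoc\<close>.\<close>

lemma bind_plug:
  assumes V: "module R V" and W: "module R W" and \<kappa>: "is_lin R V (schur R P W) \<kappa>"
    and "\<mu> \<in> carrier (ops P (length ys + length bs))" "set ys \<subseteq> carrier (schur R P V)" "set bs \<subseteq> carrier V"
  shows "bind V W \<kappa> (plug V \<mu> ys bs) = scomp W \<mu> (map (bind V W \<kappa>) ys @ map \<kappa> bs)"
  using assms(4-)
proof (induct ys arbitrary: \<mu> bs rule: rev_induct)
  case Nil
  then show ?case by (simp add: plug_Nil[OF V] bind_elt[OF V W \<kappa>])
next
  case (snoc y ys)
  let ?h = "bind V W \<kappa>" and ?SV = "schur R P V" and ?SW = "schur R P W"
  note h = is_lin_bind[OF V W \<kappa>]
  have y: "y \<in> carrier ?SV" and ys: "set ys \<subseteq> carrier ?SV" using snoc.prems by auto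
  have \<mu>: "\<mu> \<in> carrier (ops P (Suc (length ys + length [] + length bs)))" using snoc.prems by simp
  have \<mu>': "\<mu> \<in> carrier (ops P (Suc (length (map ?h ys) + length (map \<kappa> bs))))" using \<mu> by simp
  have c: "set (map ?h ys) \<subseteq> carrier ?SW" "set (map \<kappa> bs) \<subseteq> carrier ?SW"
    using ys snoc.prems(3) is_lin_closed[OF h] is_lin_closed[OF \<kappa>] by auto
  have "?h (plug V \<mu> (ys @ y # []) bs) = scomp W \<mu> (map ?h ys @ ?h y # map \<kappa> bs)"
  proof (rule plug_eqI[OF V h \<mu> ys _ _ is_lin_comp[OF h multilinD[OF multilin_scomp[OF W \<mu>'] refl c]] _ y])
    fix \<nu> vs assume \<nu>: "\<nu> \<in> carrier (ops P (length vs))" and vs: "set vs \<subseteq> carrier V"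
    let ?l = "Suc (length ys + length bs)"
    have pc: "pcomp P ?l (length vs) (length ys) \<mu> \<nu> \<in> carrier (ops P (length ys + length (vs @ bs)))"
      using pcomp_closed[of "length ys" ?l \<mu> \<nu> "length vs"] \<mu> \<nu> by (simp add: add_ac)
    have cv: "set (map \<kappa> vs) \<subseteq> carrier ?SW" using vs is_lin_closed[OF \<kappa>] by auto
    have \<nu>': "\<nu> \<in> carrier (ops P (length (map \<kappa> vs)))" using \<nu> by simp
    have "?h (plug V \<mu> (ys @ [schur_elt R P V \<nu> vs]) bs)
        = ?h (plug V (pcomp P ?l (length vs) (length ys) \<mu> \<nu>) ys (vs @ bs))"
      using plug_snoc_elt[OF V _ ys snoc.prems(3) \<nu> vs, of \<mu>] \<mu> by simp
    also have "\<dots> = scomp W (pcomp P ?l (length vs) (length ys) \<mu> \<nu>) (map ?h ys @ map \<kappa> (vs @ bs))"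
      using snoc.prems vs ys by (intro snoc.hyps pc) simp_all
    also have "\<dots> = scomp W \<mu> (map ?h ys @ [scomp W \<nu> (map \<kappa> vs)] @ map \<kappa> bs)"
      using scomp_assoc[OF W \<mu>' \<nu>' c(1) cv c(2)] by simp
    finally show "?h (plug V \<mu> (ys @ schur_elt R P V \<nu> vs # []) bs) = scomp W \<mu> (map ?h ys @ ?h (schur_elt R P V \<nu> vs) # map \<kappa> bs)"
      by (simp add: bind_elt[OF V W \<kappa> \<nu> vs])
  qed (use snoc.prems in simp_all)
  then show ?case by simp
qed

lemma bind_scomp:
  assumes V: "module R V" and W: "module R W" and \<kappa>: "is_lin R V (schur R P W) \<kappa>"
    and "\<mu> \<in> carrier (ops P (length ys))" "set ys \<subseteq> carrier (schur R P V)"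
  shows "bind V W \<kappa> (scomp V \<mu> ys) = scomp W \<mu> (map (bind V W \<kappa>) ys)"
  using bind_plug[OF V W \<kappa>, of \<mu> ys "[]"] assms(4,5) by (simp add: scomp_def)

text \<open>On a generator the inner extension yields a composition, through which
  \<open>bind_scomp\<close> moves the outer extension.\<close>

lemma bind_bind:
  assumes V: "module R V" and W: "module R W" and U: "module R U"
    and \<kappa>: "is_lin R V (schur R P W) \<kappa>" and \<kappa>': "is_lin R W (schur R P U) \<kappa>'"
    and s: "s \<in> carrier (schur R P V)"
  shows "bind W U \<kappa>' (bind V W \<kappa> s) = bind V U (\<lambda>v. bind W U \<kappa>' (\<kappa> v)) s"
proof -
  note c = is_lin_comp[OF \<kappa> is_lin_bind[OF W U \<kappa>']]
  show ?thesis
  proof (rule schur_eqI[OF V is_lin_comp[OF is_lin_bind[OF V W \<kappa>] is_lin_bind[OF W U \<kappa>']] is_lin_bind[OF V U c] _ s])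
    fix \<mu> vs assume \<mu>: "\<mu> \<in> carrier (ops P (length vs))" and vs: "set vs \<subseteq> carrier V"
    have "set (map \<kappa> vs) \<subseteq> carrier (schur R P W)" using vs is_lin_closed[OF \<kappa>] by auto
    then show "bind W U \<kappa>' (bind V W \<kappa> (schur_elt R P V \<mu> vs)) = bind V U (\<lambda>v. bind W U \<kappa>' (\<kappa> v)) (schur_elt R P V \<mu> vs)"
      using bind_scomp[OF W U \<kappa>', of \<mu> "map \<kappa> vs"] \<mu> vs
      by (simp add: bind_elt[OF V W \<kappa>] bind_elt[OF V U c] comp_def)
  qed
qed

text \<open>The derivation along a pair of linear maps \<open>f, g : V \<rightarrow> W\<close>; both \<open>\<partial>\<^sub>V\<close> and its transport
  to \<open>R\<^bsup>n+n\<^esup>\<close> are of this form.\<close>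

definition deriv ::
  "('r, 'v) module \<Rightarrow> ('r, 'w) module \<Rightarrow> ('v \<Rightarrow> 'w) \<Rightarrow> ('v \<Rightarrow> 'w) \<Rightarrow> ('r, 'p, 'v) schur \<Rightarrow> ('r, 'p, 'w) schur" where
  "deriv V W f g = schur_lift V (schur R P W) (\<lambda>\<mu> vs. dsum (schur R P W) (schur_elt R P W \<mu>) (map f vs) (map g vs))"

text \<open>Invariance is a reindexing: the summand of the permuted list that differentiates
  position \<open>i\<close> equals the summand of the original list at \<open>\<sigma> i\<close>,
  and \<sigma> permutes the index range. Linearity in a vector is
  \<open>is_lin_multilin_dsum\<close>.\<close>

lemma schur_form_deriv:
  assumes V: "module R V" and W: "module R W" and f: "is_lin R V W f" and g: "is_lin R V W g"
  shows "schur_form R P V (schur R P W) (\<lambda>\<mu> vs. dsum (schur R P W) (schur_elt R P W \<mu>) (map f vs) (map g vs))"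
proof (rule schur_formI)
  interpret SW: module R "schur R P W" by (rule schur_is_module[OF W])
  note form = schur_form_schur_elt[OF W] and SW = schur_is_module[OF W]
  note fg = is_lin_closed[OF f] is_lin_closed[OF g]
  fix vs assume vs: "set vs \<subseteq> carrier V"
  have c: "set ((map f vs)[i := map g vs ! i]) \<subseteq> carrier W" for i
    using vs fg by (intro set_list_update_nth_closed) auto
  have "is_lin R (ops P (length vs)) (schur R P W) (\<lambda>\<mu>. schur_elt R P W \<mu> ((map f vs)[i := map g vs ! i]))" for i
    using schur_formD(1)[OF form c[of i]] by simp
  then show "is_lin R (ops P (length vs)) (schur R P W) (\<lambda>\<mu>. dsum (schur R P W) (schur_elt R P W \<mu>) (map f vs) (map g vs))"
    unfolding dsum_def by (rule is_lin_finsum_fun[OF _ ops_module SW])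
  fix \<mu> \<sigma> assume \<mu>: "\<mu> \<in> carrier (ops P (length vs))" and \<sigma>: "\<sigma> permutes {..<length vs}"
  let ?n = "length vs"
  let ?t = "\<lambda>i. schur_elt R P W \<mu> ((map f vs)[i := map g vs ! i])"
  have tc: "?t i \<in> carrier (schur R P W)" for i using schur_formD(4)[OF form _ c[of i], of \<mu>] \<mu> by simp
  have upd: "(map f (permute_list \<sigma> vs))[i := map g (permute_list \<sigma> vs) ! i] = permute_list \<sigma> ((map f vs)[\<sigma> i := map g vs ! \<sigma> i])"
    if i: "i < ?n" for i
  proof (rule nth_equalityI)
    fix j assume "j < length ((map f (permute_list \<sigma> vs))[i := map g (permute_list \<sigma> vs) ! i])"
    then have j: "j < ?n" by simp
    have \<sigma>j: "\<sigma> j < ?n" "\<sigma> i < ?n" using permutes_in_image[OF \<sigma>] i j by auto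
    have inj: "\<sigma> i = \<sigma> j \<longleftrightarrow> i = j" using permutes_inj[OF \<sigma>] by (auto simp: inj_def)
    show "(map f (permute_list \<sigma> vs))[i := map g (permute_list \<sigma> vs) ! i] ! j = permute_list \<sigma> ((map f vs)[\<sigma> i := map g vs ! \<sigma> i]) ! j"
      using i j \<sigma>j inj \<sigma> by (simp add: permute_list_nth nth_list_update)
  qed simp
  have "dsum (schur R P W) (schur_elt R P W (act P ?n \<mu> \<sigma>)) (map f (permute_list \<sigma> vs)) (map g (permute_list \<sigma> vs))
      = (\<Oplus>\<^bsub>schur R P W\<^esub>i\<in>{..<?n}. ?t (\<sigma> i))"
    unfolding dsum_def
  proof (intro SW.finsum_cong')
    fix i assume "i \<in> {..<?n}"
    then show "schur_elt R P W (act P ?n \<mu> \<sigma>) ((map f (permute_list \<sigma> vs))[i := map g (permute_list \<sigma> vs) ! i]) = ?t (\<sigma> i)"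
      using upd[of i] schur_formD(3)[OF form _ c, of \<mu> "\<sigma> i" \<sigma>] \<mu> \<sigma> by simp
  qed (use tc in auto)
  also have "\<dots> = (\<Oplus>\<^bsub>schur R P W\<^esub>i\<in>\<sigma> ` {..<?n}. ?t i)"
    using tc permutes_inj_on[OF \<sigma>] by (intro SW.finsum_reindex[symmetric]) auto
  also have "\<dots> = dsum (schur R P W) (schur_elt R P W \<mu>) (map f vs) (map g vs)"
    by (simp add: permutes_image[OF \<sigma>] dsum_def)
  finally show "dsum (schur R P W) (schur_elt R P W (act P ?n \<mu> \<sigma>)) (map f (permute_list \<sigma> vs)) (map g (permute_list \<sigma> vs))
      = dsum (schur R P W) (schur_elt R P W \<mu>) (map f vs) (map g vs)" .
next
  note form = schur_form_schur_elt[OF W] and SW = schur_is_module[OF W]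
  note fg = is_lin_closed[OF f] is_lin_closed[OF g]
  fix n \<mu> assume \<mu>: "\<mu> \<in> carrier (ops P n)"
  show "multilin R V (schur R P W) n (\<lambda>vs. dsum (schur R P W) (schur_elt R P W \<mu>) (map f vs) (map g vs))"
  proof (rule multilinI)
    fix as bs assume n: "Suc (length as + length bs) = n" and c: "set as \<subseteq> carrier V" "set bs \<subseteq> carrier V"
    have "is_lin R V (schur R P W) (\<lambda>v. dsum (schur R P W) (schur_elt R P W \<mu>) (map f as @ f v # map f bs) (map g as @ g v # map g bs))"
      using schur_formD(2)[OF form \<mu>] n c fg
      by (intro is_lin_multilin_dsum[OF V SW _ f g]) auto
    then show "is_lin R V (schur R P W) (\<lambda>v. dsum (schur R P W) (schur_elt R P W \<mu>) (map f (as @ v # bs)) (map g (as @ v # bs)))"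
      by simp
  qed
qed

context
  fixes V :: "('r, 'v) module" and W :: "('r, 'w) module" and f g
  assumes V: "module R V" and W: "module R W" and f: "is_lin R V W f" and g: "is_lin R V W g"
begin

private abbreviation (input) "SV \<equiv> schur R P V"
private abbreviation (input) "SW \<equiv> schur R P W"
private abbreviation (input) "D \<equiv> deriv V W f g"
private abbreviation (input) "F \<equiv> bind V W (\<lambda>v. schur_unit R P W (f v))"
private abbreviation (input) "\<eta>f \<equiv> \<lambda>v. schur_unit R P W (f v)"
private abbreviation (input) "\<eta>g \<equiv> \<lambda>v. schur_unit R P W (g v)"

lemma is_lin_deriv: "is_lin R SV SW D"
  unfolding deriv_def by (rule is_lin_schur_lift[OF V schur_is_module[OF W] schur_form_deriv[OF V W f g]])

lemma deriv_elt:
  assumes "\<mu> \<in> carrier (ops P (length vs))" "set vs \<subseteq> carrier V"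
  shows "D (schur_elt R P V \<mu> vs) = dsum SW (schur_elt R P W \<mu>) (map f vs) (map g vs)"
  unfolding deriv_def by (rule schur_lift_elt[OF V schur_is_module[OF W] schur_form_deriv[OF V W f g] assms])

lemma is_lin_unit_f: "is_lin R V SW \<eta>f"
  by (rule is_lin_comp[OF f is_lin_schur_unit[OF W]])

text \<open>Rewriting vectors as units puts the derivative of a generator into terms of
  \<open>scomp\<close>, where \<open>scomp_assoc\<close> becomes available for the Leibniz
  rule.\<close>

lemma deriv_elt_scomp:
  assumes \<mu>: "\<mu> \<in> carrier (ops P (length vs))" and vs: "set vs \<subseteq> carrier V"
  shows "D (schur_elt R P V \<mu> vs) = dsum SW (scomp W \<mu>) (map \<eta>f vs) (map \<eta>g vs)"
proof -
  interpret SW: module R SW by (rule schur_is_module[OF W])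
  have c: "set ((map f vs)[i := map g vs ! i]) \<subseteq> carrier W" for i
    using vs is_lin_closed[OF f] is_lin_closed[OF g] by (intro set_list_update_nth_closed) auto
  have "scomp W \<mu> ((map \<eta>f vs)[i := map \<eta>g vs ! i]) = schur_elt R P W \<mu> ((map f vs)[i := map g vs ! i])"
    if i: "i < length vs" for i
  proof -
    have "(map \<eta>f vs)[i := map \<eta>g vs ! i] = map (schur_unit R P W) ((map f vs)[i := map g vs ! i])"
      using i by (simp add: map_update comp_def)
    then show ?thesis using scomp_units[OF W _ c[of i], of \<mu>] \<mu> by simp
  qed
  moreover have "schur_elt R P W \<mu> ((map f vs)[i := map g vs ! i]) \<in> carrier SW" for i
    using schur_formD(4)[OF schur_form_schur_elt[OF W] _ c[of i], of \<mu>] \<mu> by simp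
  ultimately show ?thesis
    unfolding deriv_elt[OF assms] dsum_def by (intro SW.finsum_cong') (auto simp del: nth_map)
qed

text \<open>The Leibniz rule, with a trailing vector \<open>v\<close> treated as a unit:
  \<open>\<eta>f v\<close> where it is not differentiated, \<open>\<eta>g v\<close> where it is.
  After a generator has been absorbed, the sum over the inputs splits into those before, inside and
  behind the block of \<nu>.\<close>

lemma deriv_plug:
  assumes "\<mu> \<in> carrier (ops P (length ys + length bs))" "set ys \<subseteq> carrier SV" "set bs \<subseteq> carrier V"
  shows "D (plug V \<mu> ys bs) = dsum SW (scomp W \<mu>) (map F ys @ map \<eta>f bs) (map D ys @ map \<eta>g bs)"
  using assms
proof (induct ys arbitrary: \<mu> bs rule: rev_induct)
  case Nil
  then show ?case by (simp add: plug_Nil[OF V] deriv_elt_scomp)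
next
  case (snoc y ys)
  interpret SW: multilinear_sum R SW "carrier SW"
    by (intro multilinear_sum.intro schur_is_module[OF W])
  have cl: "SW.closed_at (scomp W \<kappa>) n" if "\<kappa> \<in> carrier (ops P n)" for \<kappa> n
    using that scomp_closed[OF W] by (auto simp: SW.closed_at_def)
  note h = is_lin_bind[OF V W is_lin_unit_f]
  have y: "y \<in> carrier SV" and ys: "set ys \<subseteq> carrier SV" using snoc.prems by auto
  have \<mu>: "\<mu> \<in> carrier (ops P (Suc (length ys + length [] + length bs)))" using snoc.prems by simp
  let ?A = "map F ys" and ?A' = "map D ys" and ?C = "map \<eta>f bs" and ?C' = "map \<eta>g bs"
  have uc: "set (map \<eta>f vs) \<subseteq> carrier SW" "set (map \<eta>g vs) \<subseteq> carrier SW" if "set vs \<subseteq> carrier V" for vs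
    using that is_lin_closed[OF f] is_lin_closed[OF g] schur_unit_closed[OF W] by auto
  have A: "set ?A \<subseteq> carrier SW" "set ?A' \<subseteq> carrier SW"
    using ys is_lin_closed[OF h] is_lin_closed[OF is_lin_deriv] by auto
  have C: "set ?C \<subseteq> carrier SW" "set ?C' \<subseteq> carrier SW" using snoc.prems(3) uc by auto
  have \<mu>m: "\<mu> \<in> carrier (ops P (Suc (length ?A + length ?C)))" using \<mu> by simp
  have lin: "is_lin R SV SW (\<lambda>y. dsum SW (scomp W \<mu>) (?A @ F y # ?C) (?A' @ D y # ?C'))"
    using A C by (intro is_lin_multilin_dsum[OF schur_is_module[OF V] schur_is_module[OF W] multilin_scomp[OF W \<mu>m] h is_lin_deriv]) simp_all
  have "D (plug V \<mu> (ys @ y # []) bs) = dsum SW (scomp W \<mu>) (?A @ F y # ?C) (?A' @ D y # ?C')"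
  proof (rule plug_eqI[OF V is_lin_deriv \<mu> ys _ _ lin _ y])
    fix \<nu> vs assume \<nu>: "\<nu> \<in> carrier (ops P (length vs))" and vs: "set vs \<subseteq> carrier V"
    let ?l = "Suc (length ys + length bs)" let ?\<kappa> = "pcomp P ?l (length vs) (length ys) \<mu> \<nu>"
    let ?B = "map \<eta>f vs" and ?B' = "map \<eta>g vs"
    have pc: "?\<kappa> \<in> carrier (ops P (length ys + length (vs @ bs)))"
      using pcomp_closed[of "length ys" ?l \<mu> \<nu> "length vs"] \<mu> \<nu> by (simp add: add_ac)
    have B: "set ?B \<subseteq> carrier SW" "set ?B' \<subseteq> carrier SW" using vs uc by auto
    have Fe: "F (schur_elt R P V \<nu> vs) = scomp W \<nu> ?B" by (rule bind_elt[OF V W is_lin_unit_f \<nu> vs])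
    have De: "D (schur_elt R P V \<nu> vs) = dsum SW (scomp W \<nu>) ?B ?B'" by (rule deriv_elt_scomp[OF \<nu> vs])
    have \<nu>B: "scomp W \<nu> ys \<in> carrier SW" if "length ys = length vs" "set ys \<subseteq> carrier SW" for ys
      using scomp_closed[OF W, of \<nu> ys] \<nu> that by simp
    have Dc: "dsum SW (scomp W \<nu>) ?B ?B' \<in> carrier SW"
      using B \<nu> by (intro SW.dsum_closed cl) simp_all
    have assoc: "scomp W \<mu> (as @ scomp W \<nu> xs # cs) = scomp W ?\<kappa> (as @ xs @ cs)"
      if "length as = length ys" "length cs = length bs" "length xs = length vs"
        "set as \<subseteq> carrier SW" "set cs \<subseteq> carrier SW" "set xs \<subseteq> carrier SW" for as cs xs
      using scomp_assoc[OF W, of \<mu> as cs \<nu> xs] \<mu> \<nu> that by simp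
    have clk: "SW.closed_at (\<lambda>ws. scomp W ?\<kappa> (as @ ws @ cs)) n"
      if "length as + n + length cs = length ys + length (vs @ bs)" "set as \<subseteq> carrier SW" "set cs \<subseteq> carrier SW" for as cs n
      using cl[OF pc] that unfolding SW.closed_at_def by auto
    have "D (plug V \<mu> (ys @ [schur_elt R P V \<nu> vs]) bs) = D (plug V ?\<kappa> ys (vs @ bs))"
      using plug_snoc_elt[OF V _ ys snoc.prems(3) \<nu> vs, of \<mu>] \<mu> by simp
    also have "\<dots> = dsum SW (scomp W ?\<kappa>) (?A @ map \<eta>f (vs @ bs)) (?A' @ map \<eta>g (vs @ bs))"
      using snoc.prems vs ys by (intro snoc.hyps pc) simp_all
    also have "\<dots> = dsum SW (scomp W ?\<kappa>) (?A @ ?B @ ?C) (?A' @ ?B' @ ?C')" by simp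
    also have "\<dots> = dsum SW (\<lambda>ws. scomp W ?\<kappa> (ws @ ?B @ ?C)) ?A ?A' \<oplus>\<^bsub>SW\<^esub>
        dsum SW (\<lambda>ws. scomp W ?\<kappa> (?A @ ws)) (?B @ ?C) (?B' @ ?C')"
      using pc A B C by (intro SW.dsum_append cl) simp_all
    also have "dsum SW (\<lambda>ws. scomp W ?\<kappa> (?A @ ws)) (?B @ ?C) (?B' @ ?C')
        = dsum SW (\<lambda>ws. scomp W ?\<kappa> (?A @ ws @ ?C)) ?B ?B' \<oplus>\<^bsub>SW\<^esub> dsum SW (\<lambda>ws. scomp W ?\<kappa> (?A @ ?B @ ws)) ?C ?C'"
      using clk[of ?A _ "[]"] A B C by (intro SW.dsum_append) simp_all
    also have "dsum SW (\<lambda>ws. scomp W ?\<kappa> (ws @ ?B @ ?C)) ?A ?A'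
        = dsum SW (\<lambda>ws. scomp W \<mu> (ws @ F (schur_elt R P V \<nu> vs) # ?C)) ?A ?A'"
      unfolding Fe using clk[of "[]" _ "?B @ ?C"] A B C
      by (intro SW.dsum_cong[symmetric] assoc) (simp_all)
    also have "dsum SW (\<lambda>ws. scomp W ?\<kappa> (?A @ ?B @ ws)) ?C ?C'
        = dsum SW (\<lambda>ws. scomp W \<mu> (?A @ F (schur_elt R P V \<nu> vs) # ws)) ?C ?C'"
      unfolding Fe using clk[of "?A @ ?B" _ "[]"] A B C
      by (intro SW.dsum_cong[symmetric] assoc) (simp_all)
    also have "dsum SW (\<lambda>ws. scomp W ?\<kappa> (?A @ ws @ ?C)) ?B ?B'
        = dsum SW (\<lambda>ws. scomp W \<mu> (?A @ scomp W \<nu> ws # ?C)) ?B ?B'"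
      using clk[of ?A _ ?C] A B C
      by (intro SW.dsum_cong[symmetric] assoc) (simp_all)
    \<comment> \<open>The sum over the inputs of \<nu> is pulled into the slot occupied by \<nu>, by
      linearity in that slot; there it is the derivative of the generator.\<close>
    also have "\<dots> = scomp W \<mu> (?A @ D (schur_elt R P V \<nu> vs) # ?C)"
      unfolding De dsum_def
    proof (rule is_lin_finsum[OF multilinD[OF multilin_scomp[OF W \<mu>m] refl A(1) C(1)] schur_is_module[OF W] schur_is_module[OF W], symmetric])
      show "(\<lambda>i. scomp W \<nu> (?B[i := ?B' ! i])) \<in> {..<length ?B} \<rightarrow> carrier SW"
        using set_list_update_nth_closed[OF B] by (auto intro!: \<nu>B)
    qed
    also have "dsum SW (\<lambda>ws. scomp W \<mu> (ws @ F (schur_elt R P V \<nu> vs) # ?C)) ?A ?A' \<oplus>\<^bsub>SW\<^esub>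
          (scomp W \<mu> (?A @ D (schur_elt R P V \<nu> vs) # ?C) \<oplus>\<^bsub>SW\<^esub>
           dsum SW (\<lambda>ws. scomp W \<mu> (?A @ F (schur_elt R P V \<nu> vs) # ws)) ?C ?C')
        = dsum SW (scomp W \<mu>) (?A @ F (schur_elt R P V \<nu> vs) # ?C) (?A' @ D (schur_elt R P V \<nu> vs) # ?C')"
      using \<mu>m A C Dc \<nu>B[OF _ B(1)] by (intro SW.dsum_middle[symmetric] cl) (simp_all add: Fe De)
    finally show "D (plug V \<mu> (ys @ schur_elt R P V \<nu> vs # []) bs)
        = dsum SW (scomp W \<mu>) (?A @ F (schur_elt R P V \<nu> vs) # ?C) (?A' @ D (schur_elt R P V \<nu> vs) # ?C')" .
  qed (use snoc.prems in simp_all)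
  then show ?case by simp
qed

lemma deriv_scomp:
  assumes "\<mu> \<in> carrier (ops P (length ys))" "set ys \<subseteq> carrier SV"
  shows "D (scomp V \<mu> ys) = dsum SW (scomp W \<mu>) (map F ys) (map D ys)"
  using deriv_plug[of \<mu> ys "[]"] assms by (simp add: scomp_def)

text \<open>After substitution, f and g survive only in the composites with \<kappa>. The
  differential axioms are therefore settled by computing these composites.\<close>

lemma bind_deriv_elt:
  assumes U: "module R U" and \<kappa>: "is_lin R W (schur R P U) \<kappa>"
    and \<mu>: "\<mu> \<in> carrier (ops P (length vs))" and vs: "set vs \<subseteq> carrier V"
  shows "bind W U \<kappa> (D (schur_elt R P V \<mu> vs)) = dsum (schur R P U) (scomp U \<mu>) (map (\<lambda>v. \<kappa> (f v)) vs) (map (\<lambda>v. \<kappa> (g v)) vs)"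
proof -
  interpret SU: module R "schur R P U" by (rule schur_is_module[OF U])
  have c: "set ((map f vs)[i := map g vs ! i]) \<subseteq> carrier W" for i
    using vs is_lin_closed[OF f] is_lin_closed[OF g] by (intro set_list_update_nth_closed) auto
  have c': "set (map \<kappa> ((map f vs)[i := map g vs ! i])) \<subseteq> carrier (schur R P U)" for i
    using c[of i] is_lin_closed[OF \<kappa>] by auto
  have ec: "schur_elt R P W \<mu> ((map f vs)[i := map g vs ! i]) \<in> carrier SW" for i
    using schur_formD(4)[OF schur_form_schur_elt[OF W] _ c[of i], of \<mu>] \<mu> by simp
  have "bind W U \<kappa> (D (schur_elt R P V \<mu> vs))
      = (\<Oplus>\<^bsub>schur R P U\<^esub>i\<in>{..<length (map f vs)}. bind W U \<kappa> (schur_elt R P W \<mu> ((map f vs)[i := map g vs ! i])))"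
    unfolding deriv_elt[OF \<mu> vs] dsum_def using ec
    by (intro is_lin_finsum[OF is_lin_bind[OF W U \<kappa>] schur_is_module[OF W] schur_is_module[OF U]]) auto
  also have "\<dots> = (\<Oplus>\<^bsub>schur R P U\<^esub>i\<in>{..<length (map f vs)}. scomp U \<mu> ((map (\<lambda>v. \<kappa> (f v)) vs)[i := map (\<lambda>v. \<kappa> (g v)) vs ! i]))"
  proof (intro SU.finsum_cong' refl)
    fix i assume i: "i \<in> {..<length (map f vs)}"
    have eq: "map \<kappa> ((map f vs)[i := map g vs ! i]) = (map (\<lambda>v. \<kappa> (f v)) vs)[i := map (\<lambda>v. \<kappa> (g v)) vs ! i]"
      using i by (simp add: map_update comp_def)
    show "bind W U \<kappa> (schur_elt R P W \<mu> ((map f vs)[i := map g vs ! i])) = scomp U \<mu> ((map (\<lambda>v. \<kappa> (f v)) vs)[i := map (\<lambda>v. \<kappa> (g v)) vs ! i])"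
      using bind_elt[OF W U \<kappa> _ c[of i], of \<mu>] \<mu> eq by simp
  next
    show "(\<lambda>i. scomp U \<mu> ((map (\<lambda>v. \<kappa> (f v)) vs)[i := map (\<lambda>v. \<kappa> (g v)) vs ! i])) \<in> {..<length (map f vs)} \<rightarrow> carrier (schur R P U)"
    proof
      fix i assume i: "i \<in> {..<length (map f vs)}"
      have eq: "map \<kappa> ((map f vs)[i := map g vs ! i]) = (map (\<lambda>v. \<kappa> (f v)) vs)[i := map (\<lambda>v. \<kappa> (g v)) vs ! i]"
        using i by (simp add: map_update comp_def)
      show "scomp U \<mu> ((map (\<lambda>v. \<kappa> (f v)) vs)[i := map (\<lambda>v. \<kappa> (g v)) vs ! i]) \<in> carrier (schur R P U)"
        using scomp_closed[OF U _ c'[of i], of \<mu>] \<mu> eq by simp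
    qed
  qed
  finally show ?thesis by (simp add: dsum_def)
qed

end

end

lemma multilin_update:
  assumes L: "multilin R W N n L" and xs: "length xs = n" "set xs \<subseteq> carrier W" and i: "i < n"
  shows "is_lin R W N (\<lambda>w. L (xs[i := w]))"
proof -
  have "is_lin R W N (\<lambda>w. L (take i xs @ w # drop (Suc i) xs))"
    using xs i by (intro multilinD[OF L]) (auto dest: in_set_takeD in_set_dropD)
  then show ?thesis using xs i by (simp add: upd_conv_take_nth_drop)
qed

lemma dsum_add:
  assumes N: "module R N" and L: "multilin R W N (length vs) L"
    and a: "\<And>v. v \<in> set vs \<Longrightarrow> a v \<in> carrier W" and b: "\<And>v. v \<in> set vs \<Longrightarrow> b v \<in> carrier W"
    and c: "\<And>v. v \<in> set vs \<Longrightarrow> c v \<in> carrier W"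
  shows "dsum N L (map a vs) (map (\<lambda>v. b v \<oplus>\<^bsub>W\<^esub> c v) vs) = dsum N L (map a vs) (map b vs) \<oplus>\<^bsub>N\<^esub> dsum N L (map a vs) (map c vs)"
proof -
  interpret N: module R N by (rule N)
  have lin: "is_lin R W N (\<lambda>w. L ((map a vs)[i := w]))" if "i < length vs" for i
    using a that by (intro multilin_update[OF L]) auto
  have "dsum N L (map a vs) (map (\<lambda>v. b v \<oplus>\<^bsub>W\<^esub> c v) vs)
      = (\<Oplus>\<^bsub>N\<^esub>i\<in>{..<length vs}. L ((map a vs)[i := b (vs ! i)]) \<oplus>\<^bsub>N\<^esub> L ((map a vs)[i := c (vs ! i)]))"
    unfolding dsum_def using b c is_lin_closed[OF lin]
    by (intro N.finsum_cong') (auto simp: is_lin_add[OF lin])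
  also have "\<dots> = (\<Oplus>\<^bsub>N\<^esub>i\<in>{..<length vs}. L ((map a vs)[i := b (vs ! i)])) \<oplus>\<^bsub>N\<^esub> (\<Oplus>\<^bsub>N\<^esub>i\<in>{..<length vs}. L ((map a vs)[i := c (vs ! i)]))"
    using b c is_lin_closed[OF lin] by (intro N.finsum_addf) auto
  also have "(\<Oplus>\<^bsub>N\<^esub>i\<in>{..<length vs}. L ((map a vs)[i := b (vs ! i)])) = dsum N L (map a vs) (map b vs)"
    unfolding dsum_def using b is_lin_closed[OF lin] by (intro N.finsum_cong') auto
  also have "(\<Oplus>\<^bsub>N\<^esub>i\<in>{..<length vs}. L ((map a vs)[i := c (vs ! i)])) = dsum N L (map a vs) (map c vs)"
    unfolding dsum_def using c is_lin_closed[OF lin] by (intro N.finsum_cong') auto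
  finally show ?thesis .
qed

lemma dsum_zero:
  assumes N: "module R N" and W: "module R W" and L: "multilin R W N (length vs) L"
    and a: "\<And>v. v \<in> set vs \<Longrightarrow> a v \<in> carrier W"
  shows "dsum N L (map a vs) (map (\<lambda>v. \<zero>\<^bsub>W\<^esub>) vs) = \<zero>\<^bsub>N\<^esub>"
proof -
  interpret N: module R N by (rule N)
  have "L ((map a vs)[i := map (\<lambda>v. \<zero>\<^bsub>W\<^esub>) vs ! i]) = \<zero>\<^bsub>N\<^esub>" if "i < length vs" for i
  proof -
    have "is_lin R W N (\<lambda>w. L ((map a vs)[i := w]))"
      using a that by (intro multilin_update[OF L]) auto
    from is_lin_zero[OF this W N] show ?thesis using that by simp
  qed
  then have "dsum N L (map a vs) (map (\<lambda>v. \<zero>\<^bsub>W\<^esub>) vs) = (\<Oplus>\<^bsub>N\<^esub>i\<in>{..<length vs}. \<zero>\<^bsub>N\<^esub>)"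
    unfolding dsum_def by (intro N.finsum_cong') auto
  then show ?thesis by simp
qed

section \<open>Chain rule, linearity in the direction, and second derivatives\<close>

context operad
begin

text \<open>The chain rule in abstract form: \<kappa>' corresponds to the pairing in [CD.5], being
  \<kappa> transported along f' on the image of f, and the derivative of \<kappa> on the image of g.
  On a generator both sides become the same \<open>dsum\<close>, by \<open>deriv_scomp\<close> and
  \<open>bind_deriv_elt\<close>.\<close>

lemma deriv_bind:
  assumes V: "module R V" and V': "module R V'" and W: "module R W" and W': "module R W'"
    and f: "is_lin R V V' f" and g: "is_lin R V V' g" and f': "is_lin R W W' f'" and g': "is_lin R W W' g'"
    and \<kappa>: "is_lin R V (schur R P W) \<kappa>" and \<kappa>': "is_lin R V' (schur R P W') \<kappa>'"
    and \<kappa>f: "\<And>v. v \<in> carrier V \<Longrightarrow> \<kappa>' (f v) = bind W W' (\<lambda>w. schur_unit R P W' (f' w)) (\<kappa> v)"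
    and \<kappa>g: "\<And>v. v \<in> carrier V \<Longrightarrow> \<kappa>' (g v) = deriv W W' f' g' (\<kappa> v)"
    and s: "s \<in> carrier (schur R P V)"
  shows "deriv W W' f' g' (bind V W \<kappa> s) = bind V' W' \<kappa>' (deriv V V' f g s)"
proof (rule schur_eqI[OF V is_lin_comp[OF is_lin_bind[OF V W \<kappa>] is_lin_deriv[OF W W' f' g']]
      is_lin_comp[OF is_lin_deriv[OF V V' f g] is_lin_bind[OF V' W' \<kappa>']] _ s])
  fix \<mu> vs assume \<mu>: "\<mu> \<in> carrier (ops P (length vs))" and vs: "set vs \<subseteq> carrier V"
  have c: "set (map \<kappa> vs) \<subseteq> carrier (schur R P W)" using vs is_lin_closed[OF \<kappa>] by auto
  have "deriv W W' f' g' (bind V W \<kappa> (schur_elt R P V \<mu> vs))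
      = dsum (schur R P W') (scomp W' \<mu>) (map (bind W W' (\<lambda>w. schur_unit R P W' (f' w))) (map \<kappa> vs)) (map (deriv W W' f' g') (map \<kappa> vs))"
    unfolding bind_elt[OF V W \<kappa> \<mu> vs] using \<mu> by (intro deriv_scomp[OF W W' f' g' _ c]) simp
  also have "map (bind W W' (\<lambda>w. schur_unit R P W' (f' w))) (map \<kappa> vs) = map (\<lambda>v. \<kappa>' (f v)) vs"
    using vs \<kappa>f by auto
  also have "map (deriv W W' f' g') (map \<kappa> vs) = map (\<lambda>v. \<kappa>' (g v)) vs"
    using vs \<kappa>g by auto
  also have "dsum (schur R P W') (scomp W' \<mu>) (map (\<lambda>v. \<kappa>' (f v)) vs) (map (\<lambda>v. \<kappa>' (g v)) vs)
      = bind V' W' \<kappa>' (deriv V V' f g (schur_elt R P V \<mu> vs))"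
    by (rule bind_deriv_elt[OF V V' f g W' \<kappa>' \<mu> vs, symmetric])
  finally show "deriv W W' f' g' (bind V W \<kappa> (schur_elt R P V \<mu> vs)) = bind V' W' \<kappa>' (deriv V V' f g (schur_elt R P V \<mu> vs))" .
qed

context
  fixes V :: "('r, 'v) module" and W :: "('r, 'w) module" and U :: "('r, 'u) module" and f g
  assumes V: "module R V" and W: "module R W" and U: "module R U"
    and f: "is_lin R V W f" and g: "is_lin R V W g"
begin

private abbreviation (input) "SU \<equiv> schur R P U"
private abbreviation (input) "D1 \<equiv> deriv V W f g"

text \<open>Every summand of the derivative has exactly one entry coming from g, and the three
  Kleisli maps agree on all entries coming from f; so additivity in that single slot is
  enough.\<close>

lemma bind_deriv_add:
  assumes \<kappa>: "is_lin R W SU \<kappa>" and \<kappa>1: "is_lin R W SU \<kappa>1" and \<kappa>2: "is_lin R W SU \<kappa>2"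
    and f1: "\<And>v. v \<in> carrier V \<Longrightarrow> \<kappa>1 (f v) = \<kappa> (f v)" and f2: "\<And>v. v \<in> carrier V \<Longrightarrow> \<kappa>2 (f v) = \<kappa> (f v)"
    and g12: "\<And>v. v \<in> carrier V \<Longrightarrow> \<kappa> (g v) = \<kappa>1 (g v) \<oplus>\<^bsub>SU\<^esub> \<kappa>2 (g v)"
    and s: "s \<in> carrier (schur R P V)"
  shows "bind W U \<kappa> (D1 s) = bind W U \<kappa>1 (D1 s) \<oplus>\<^bsub>SU\<^esub> bind W U \<kappa>2 (D1 s)"
proof -
  note SU = schur_is_module[OF U]
  note d = is_lin_deriv[OF V W f g]
  note l = is_lin_comp[OF d is_lin_bind[OF W U \<kappa>]] is_lin_comp[OF d is_lin_bind[OF W U \<kappa>1]] is_lin_comp[OF d is_lin_bind[OF W U \<kappa>2]]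
  show ?thesis
  proof (rule schur_eqI[OF V l(1) is_lin_add_fun[OF l(2,3) SU] _ s])
    fix \<mu> vs assume \<mu>: "\<mu> \<in> carrier (ops P (length vs))" and vs: "set vs \<subseteq> carrier V"
    have c: "\<kappa> (f v) \<in> carrier SU" "\<kappa>1 (g v) \<in> carrier SU" "\<kappa>2 (g v) \<in> carrier SU" if "v \<in> set vs" for v
      using that vs is_lin_closed[OF f] is_lin_closed[OF g] is_lin_closed[OF \<kappa>] is_lin_closed[OF \<kappa>1] is_lin_closed[OF \<kappa>2]
      by auto
    have m: "map (\<lambda>v. \<kappa>1 (f v)) vs = map (\<lambda>v. \<kappa> (f v)) vs" "map (\<lambda>v. \<kappa>2 (f v)) vs = map (\<lambda>v. \<kappa> (f v)) vs"
      "map (\<lambda>v. \<kappa> (g v)) vs = map (\<lambda>v. \<kappa>1 (g v) \<oplus>\<^bsub>SU\<^esub> \<kappa>2 (g v)) vs"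
      using vs f1 f2 g12 by auto
    show "bind W U \<kappa> (D1 (schur_elt R P V \<mu> vs)) = bind W U \<kappa>1 (D1 (schur_elt R P V \<mu> vs)) \<oplus>\<^bsub>SU\<^esub> bind W U \<kappa>2 (D1 (schur_elt R P V \<mu> vs))"
      unfolding bind_deriv_elt[OF V W f g U \<kappa> \<mu> vs] bind_deriv_elt[OF V W f g U \<kappa>1 \<mu> vs] bind_deriv_elt[OF V W f g U \<kappa>2 \<mu> vs] m
      using c by (intro dsum_add[OF SU multilin_scomp[OF U \<mu>]])
  qed
qed

lemma bind_deriv_zero:
  assumes \<kappa>: "is_lin R W SU \<kappa>" and \<kappa>g: "\<And>v. v \<in> carrier V \<Longrightarrow> \<kappa> (g v) = \<zero>\<^bsub>SU\<^esub>"
    and s: "s \<in> carrier (schur R P V)"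
  shows "bind W U \<kappa> (D1 s) = \<zero>\<^bsub>SU\<^esub>"
proof -
  note SU = schur_is_module[OF U]
  show ?thesis
  proof (rule schur_eqI[OF V is_lin_comp[OF is_lin_deriv[OF V W f g] is_lin_bind[OF W U \<kappa>]] is_lin_zero_fun[OF SU] _ s])
    fix \<mu> vs assume \<mu>: "\<mu> \<in> carrier (ops P (length vs))" and vs: "set vs \<subseteq> carrier V"
    have c: "\<kappa> (f v) \<in> carrier SU" if "v \<in> set vs" for v
      using that vs is_lin_closed[OF f] is_lin_closed[OF \<kappa>] by auto
    have "map (\<lambda>v. \<kappa> (g v)) vs = map (\<lambda>v. \<zero>\<^bsub>SU\<^esub>) vs" using vs \<kappa>g by auto
    with dsum_zero[OF SU SU multilin_scomp[OF U \<mu>] c]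
    show "bind W U \<kappa> (D1 (schur_elt R P V \<mu> vs)) = \<zero>\<^bsub>SU\<^esub>"
      unfolding bind_deriv_elt[OF V W f g U \<kappa> \<mu> vs] by (simp only:)
  qed
qed

text \<open>The summand of a second derivative in which input \<open>i\<close> is differentiated first, and input \<open>j\<close> second.\<close>

definition deriv2_term where
  "deriv2_term \<mu> vs a b c d i j = scomp U \<mu> (((map a vs)[i := b (vs ! i)])[j := ((map c vs)[i := d (vs ! i)]) ! j])"

lemma deriv2_term_closed:
  assumes \<mu>: "\<mu> \<in> carrier (ops P (length vs))" and ij: "i < length vs" "j < length vs"
    and c: "\<And>v. v \<in> set vs \<Longrightarrow> a v \<in> carrier SU \<and> b v \<in> carrier SU \<and> c v \<in> carrier SU \<and> d v \<in> carrier SU"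
  shows "deriv2_term \<mu> vs a b c d i j \<in> carrier SU"
proof -
  have 1: "set ((map a vs)[i := b (vs ! i)]) \<subseteq> carrier SU" and 2: "set ((map c vs)[i := d (vs ! i)]) \<subseteq> carrier SU"
    using c c[OF nth_mem[OF ij(1)]] by (intro set_list_update_closed; auto)+
  show ?thesis unfolding deriv2_term_def
    using \<mu> set_list_update_nth_closed[OF 1 2] by (intro scomp_closed[OF U]) simp_all
qed

context
  fixes W' :: "('r, 'z) module" and f' g'
  assumes W': "module R W'" and f': "is_lin R W W' f'" and g': "is_lin R W W' g'"
begin

private abbreviation (input) "D2 \<equiv> deriv W W' f' g'"

text \<open>For \<open>i = j\<close> the second update overwrites the first, and the common input
  carries \<open>\<kappa> (g' (g v))\<close>. Otherwise inputs \<open>i\<close> and \<open>j\<close>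
  carry \<open>\<kappa> (f' (g v))\<close> and \<open>\<kappa> (g' (f v))\<close>.\<close>

lemma bind_deriv_deriv_elt:
  assumes \<kappa>: "is_lin R W' SU \<kappa>" and \<mu>: "\<mu> \<in> carrier (ops P (length vs))" and vs: "set vs \<subseteq> carrier V"
  shows "bind W' U \<kappa> (D2 (D1 (schur_elt R P V \<mu> vs)))
    = (\<Oplus>\<^bsub>SU\<^esub>i\<in>{..<length vs}. \<Oplus>\<^bsub>SU\<^esub>j\<in>{..<length vs}.
        deriv2_term \<mu> vs (\<lambda>v. \<kappa> (f' (f v))) (\<lambda>v. \<kappa> (f' (g v))) (\<lambda>v. \<kappa> (g' (f v))) (\<lambda>v. \<kappa> (g' (g v))) i j)"
proof -
  interpret SU: module R SU by (rule schur_is_module[OF U])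
  note l = is_lin_comp[OF is_lin_deriv[OF W W' f' g'] is_lin_bind[OF W' U \<kappa>]]
  let ?t = "deriv2_term \<mu> vs (\<lambda>v. \<kappa> (f' (f v))) (\<lambda>v. \<kappa> (f' (g v))) (\<lambda>v. \<kappa> (g' (f v))) (\<lambda>v. \<kappa> (g' (g v)))"
  let ?x = "\<lambda>i. (map f vs)[i := map g vs ! i]"
  have c: "set (?x i) \<subseteq> carrier W" for i
    using vs is_lin_closed[OF f] is_lin_closed[OF g] by (intro set_list_update_nth_closed) auto
  have ec: "schur_elt R P W \<mu> (?x i) \<in> carrier (schur R P W)" for i
    using schur_formD(4)[OF schur_form_schur_elt[OF W] _ c[of i], of \<mu>] \<mu> by simp
  have tc: "?t i j \<in> carrier SU" if "i < length vs" "j < length vs" for i j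
    using that vs is_lin_closed[OF f] is_lin_closed[OF g] is_lin_closed[OF f'] is_lin_closed[OF g'] is_lin_closed[OF \<kappa>]
    by (intro deriv2_term_closed \<mu>) auto
  have inner: "bind W' U \<kappa> (D2 (schur_elt R P W \<mu> (?x i))) = (\<Oplus>\<^bsub>SU\<^esub>j\<in>{..<length vs}. ?t i j)" if i: "i < length vs" for i
  proof -
    have "bind W' U \<kappa> (D2 (schur_elt R P W \<mu> (?x i)))
        = dsum SU (scomp U \<mu>) (map (\<lambda>v. \<kappa> (f' v)) (?x i)) (map (\<lambda>v. \<kappa> (g' v)) (?x i))"
      using \<mu> by (intro bind_deriv_elt[OF W W' f' g' U \<kappa> _ c]) simp
    also have "map (\<lambda>v. \<kappa> (f' v)) (?x i) = (map (\<lambda>v. \<kappa> (f' (f v))) vs)[i := \<kappa> (f' (g (vs ! i)))]"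
      using i by (simp add: map_update comp_def)
    also have "map (\<lambda>v. \<kappa> (g' v)) (?x i) = (map (\<lambda>v. \<kappa> (g' (f v))) vs)[i := \<kappa> (g' (g (vs ! i)))]"
      using i by (simp add: map_update comp_def)
    finally show ?thesis by (simp add: dsum_def deriv2_term_def)
  qed
  have "bind W' U \<kappa> (D2 (D1 (schur_elt R P V \<mu> vs))) = (\<Oplus>\<^bsub>SU\<^esub>i\<in>{..<length (map f vs)}. bind W' U \<kappa> (D2 (schur_elt R P W \<mu> (?x i))))"
    unfolding deriv_elt[OF V W f g \<mu> vs] dsum_def using ec
    by (intro is_lin_finsum[OF l schur_is_module[OF W] schur_is_module[OF U]]) auto
  also have "\<dots> = (\<Oplus>\<^bsub>SU\<^esub>i\<in>{..<length vs}. \<Oplus>\<^bsub>SU\<^esub>j\<in>{..<length vs}. ?t i j)"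
    using inner tc by (intro SU.finsum_cong') (auto intro!: SU.finsum_closed)
  finally show ?thesis .
qed

text \<open>Off the diagonal, input \<open>j\<close> carries \<open>\<kappa> (g' (f v))\<close>,
  which is zero and kills the summand by multilinearity. The diagonal summands are those of a first
  derivative along \<kappa>'.\<close>

lemma bind_deriv_deriv_diagonal:
  assumes \<kappa>: "is_lin R W' SU \<kappa>" and z1: "\<And>v. v \<in> carrier V \<Longrightarrow> \<kappa> (f' (g v)) = \<zero>\<^bsub>SU\<^esub>" and z2: "\<And>v. v \<in> carrier V \<Longrightarrow> \<kappa> (g' (f v)) = \<zero>\<^bsub>SU\<^esub>"
    and \<kappa>': "is_lin R W SU \<kappa>'"
    and \<kappa>f: "\<And>v. v \<in> carrier V \<Longrightarrow> \<kappa>' (f v) = \<kappa> (f' (f v))" and \<kappa>g: "\<And>v. v \<in> carrier V \<Longrightarrow> \<kappa>' (g v) = \<kappa> (g' (g v))"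
    and s: "s \<in> carrier (schur R P V)"
  shows "bind W' U \<kappa> (D2 (D1 s)) = bind W U \<kappa>' (D1 s)"
proof -
  interpret SU: module R SU by (rule schur_is_module[OF U])
  note d = is_lin_deriv[OF V W f g]
  show ?thesis
  proof (rule schur_eqI[OF V is_lin_comp[OF d is_lin_comp[OF is_lin_deriv[OF W W' f' g'] is_lin_bind[OF W' U \<kappa>]]]
        is_lin_comp[OF d is_lin_bind[OF W U \<kappa>']] _ s])
    fix \<mu> vs assume \<mu>: "\<mu> \<in> carrier (ops P (length vs))" and vs: "set vs \<subseteq> carrier V"
    let ?t = "deriv2_term \<mu> vs (\<lambda>v. \<kappa> (f' (f v))) (\<lambda>v. \<kappa> (f' (g v))) (\<lambda>v. \<kappa> (g' (f v))) (\<lambda>v. \<kappa> (g' (g v)))"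
    have vn: "vs ! i \<in> carrier V" if "i < length vs" for i using vs that by auto
    have kc: "\<kappa> (f' (f v)) \<in> carrier SU" "\<kappa> (f' (g v)) \<in> carrier SU" "\<kappa> (g' (f v)) \<in> carrier SU" "\<kappa> (g' (g v)) \<in> carrier SU"
      if "v \<in> carrier V" for v
      using that is_lin_closed[OF f] is_lin_closed[OF g] is_lin_closed[OF f'] is_lin_closed[OF g'] is_lin_closed[OF \<kappa>] by auto
    have tc: "?t i j \<in> carrier SU" if "i < length vs" "j < length vs" for i j
      using that vs kc by (intro deriv2_term_closed \<mu>) auto
    have off: "?t i j = \<zero>\<^bsub>SU\<^esub>" if ij: "i < length vs" "j < length vs" "i \<noteq> j" for i j
    proof -
      have "set ((map (\<lambda>v. \<kappa> (f' (f v))) vs)[i := \<kappa> (f' (g (vs ! i)))]) \<subseteq> carrier SU"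
        using kc vs vn[OF ij(1)] by (intro set_list_update_closed) auto
      then have "is_lin R SU SU (\<lambda>w. scomp U \<mu> (((map (\<lambda>v. \<kappa> (f' (f v))) vs)[i := \<kappa> (f' (g (vs ! i)))])[j := w]))"
        using ij by (intro multilin_update[OF multilin_scomp[OF U \<mu>]]) simp_all
      from is_lin_zero[OF this schur_is_module[OF U] schur_is_module[OF U]]
      show ?thesis using ij z2[OF vn[OF ij(2)]] by (simp add: deriv2_term_def)
    qed
    have diag: "?t i i = scomp U \<mu> ((map (\<lambda>v. \<kappa>' (f v)) vs)[i := map (\<lambda>v. \<kappa>' (g v)) vs ! i])" if i: "i < length vs" for i
    proof -
      have m: "map (\<lambda>v. \<kappa>' (f v)) vs = map (\<lambda>v. \<kappa> (f' (f v))) vs" using vs \<kappa>f by auto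
      show ?thesis using i \<kappa>g[OF vn[OF i]] by (simp add: deriv2_term_def m)
    qed
    have "(\<Oplus>\<^bsub>SU\<^esub>j\<in>{..<length vs}. ?t i j) = ?t i i" if i: "i < length vs" for i
    proof -
      have "(\<Oplus>\<^bsub>SU\<^esub>j\<in>{..<length vs}. ?t i j) = (\<Oplus>\<^bsub>SU\<^esub>j\<in>{..<length vs}. if i = j then ?t i j else \<zero>\<^bsub>SU\<^esub>)"
        using off i tc by (intro SU.finsum_cong') auto
      also have "\<dots> = ?t i i" using i tc by (intro SU.M.finsum_singleton) auto
      finally show ?thesis .
    qed
    then have "bind W' U \<kappa> (D2 (D1 (schur_elt R P V \<mu> vs))) = (\<Oplus>\<^bsub>SU\<^esub>i\<in>{..<length vs}. ?t i i)"
      unfolding bind_deriv_deriv_elt[OF \<kappa> \<mu> vs] using tc by (intro SU.finsum_cong') auto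
    also have "\<dots> = bind W U \<kappa>' (D1 (schur_elt R P V \<mu> vs))"
      unfolding bind_deriv_elt[OF V W f g U \<kappa>' \<mu> vs] dsum_def length_map
    proof (intro SU.finsum_cong' refl)
      show "(\<lambda>i. scomp U \<mu> ((map (\<lambda>v. \<kappa>' (f v)) vs)[i := map (\<lambda>v. \<kappa>' (g v)) vs ! i])) \<in> {..<length vs} \<rightarrow> carrier SU"
      proof
        fix i assume "i \<in> {..<length vs}"
        then show "scomp U \<mu> ((map (\<lambda>v. \<kappa>' (f v)) vs)[i := map (\<lambda>v. \<kappa>' (g v)) vs ! i]) \<in> carrier SU"
          using tc[of i i] diag[of i] by (simp only: lessThan_iff)
      qed
    qed (use diag in simp)
    finally show "bind W' U \<kappa> (D2 (D1 (schur_elt R P V \<mu> vs))) = bind W U \<kappa>' (D1 (schur_elt R P V \<mu> vs))" .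
  qed
qed

text \<open>Exchanging the two mixed composites transposes the indices of a summand, since updates
  at distinct positions commute; exchanging the two summations undoes the transposition.\<close>

lemma bind_deriv_deriv_swap:
  assumes \<kappa>: "is_lin R W' SU \<kappa>" and \<kappa>': "is_lin R W' SU \<kappa>'"
    and eq: "\<And>v. v \<in> carrier V \<Longrightarrow> \<kappa>' (f' (f v)) = \<kappa> (f' (f v))" "\<And>v. v \<in> carrier V \<Longrightarrow> \<kappa>' (f' (g v)) = \<kappa> (g' (f v))"
      "\<And>v. v \<in> carrier V \<Longrightarrow> \<kappa>' (g' (f v)) = \<kappa> (f' (g v))" "\<And>v. v \<in> carrier V \<Longrightarrow> \<kappa>' (g' (g v)) = \<kappa> (g' (g v))"
    and s: "s \<in> carrier (schur R P V)"
  shows "bind W' U \<kappa> (D2 (D1 s)) = bind W' U \<kappa>' (D2 (D1 s))"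
proof -
  interpret SU: module R SU by (rule schur_is_module[OF U])
  note d = is_lin_comp[OF is_lin_deriv[OF V W f g] is_lin_deriv[OF W W' f' g']]
  show ?thesis
  proof (rule schur_eqI[OF V is_lin_comp[OF d is_lin_bind[OF W' U \<kappa>]] is_lin_comp[OF d is_lin_bind[OF W' U \<kappa>']] _ s])
    fix \<mu> vs assume \<mu>: "\<mu> \<in> carrier (ops P (length vs))" and vs: "set vs \<subseteq> carrier V"
    let ?t = "deriv2_term \<mu> vs (\<lambda>v. \<kappa> (f' (f v))) (\<lambda>v. \<kappa> (f' (g v))) (\<lambda>v. \<kappa> (g' (f v))) (\<lambda>v. \<kappa> (g' (g v)))"
    let ?u = "deriv2_term \<mu> vs (\<lambda>v. \<kappa>' (f' (f v))) (\<lambda>v. \<kappa>' (f' (g v))) (\<lambda>v. \<kappa>' (g' (f v))) (\<lambda>v. \<kappa>' (g' (g v)))"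
    have vn: "vs ! i \<in> carrier V" if "i < length vs" for i using vs that by auto
    have tc: "?t i j \<in> carrier SU" if "i < length vs" "j < length vs" for i j
      using that vs is_lin_closed[OF f] is_lin_closed[OF g] is_lin_closed[OF f'] is_lin_closed[OF g'] is_lin_closed[OF \<kappa>]
      by (intro deriv2_term_closed \<mu>) auto
    have tu: "?u j i = ?t i j" if ij: "i < length vs" "j < length vs" for i j
    proof (cases "i = j")
      case True
      have m: "map (\<lambda>v. \<kappa>' (f' (f v))) vs = map (\<lambda>v. \<kappa> (f' (f v))) vs" using vs eq(1) by auto
      show ?thesis using ij True eq(4)[OF vn[OF ij(1)]] by (simp add: deriv2_term_def m)
    next
      case False
      have m: "map (\<lambda>v. \<kappa>' (f' (f v))) vs = map (\<lambda>v. \<kappa> (f' (f v))) vs" using vs eq(1) by auto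
      show ?thesis
        using ij False eq(2)[OF vn[OF ij(2)]] eq(3)[OF vn[OF ij(1)]]
        by (simp add: deriv2_term_def m list_update_swap)
    qed
    have "bind W' U \<kappa> (D2 (D1 (schur_elt R P V \<mu> vs))) = (\<Oplus>\<^bsub>SU\<^esub>i\<in>{..<length vs}. \<Oplus>\<^bsub>SU\<^esub>j\<in>{..<length vs}. ?t i j)"
      by (rule bind_deriv_deriv_elt[OF \<kappa> \<mu> vs])
    also have "\<dots> = (\<Oplus>\<^bsub>SU\<^esub>j\<in>{..<length vs}. \<Oplus>\<^bsub>SU\<^esub>i\<in>{..<length vs}. ?t i j)"
      using tc by (intro SU.M.finsum_swap) auto
    also have "\<dots> = (\<Oplus>\<^bsub>SU\<^esub>j\<in>{..<length vs}. \<Oplus>\<^bsub>SU\<^esub>i\<in>{..<length vs}. ?u j i)"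
      using tc tu by (intro SU.M.finsum_cong') (auto intro!: SU.M.finsum_closed SU.M.finsum_cong')
    also have "\<dots> = bind W' U \<kappa>' (D2 (D1 (schur_elt R P V \<mu> vs)))"
      by (rule bind_deriv_deriv_elt[OF \<kappa>' \<mu> vs, symmetric])
    finally show "bind W' U \<kappa> (D2 (D1 (schur_elt R P V \<mu> vs))) = bind W' U \<kappa>' (D2 (D1 (schur_elt R P V \<mu> vs)))" .
  qed
qed

end

end

end

section \<open>The category \<open>P\<close>-POLY\<close>

text \<open>The length hypothesis makes the slices cover the whole of \<open>xs\<close>. With
  projections acting as slices, this equivalence contains existence and uniqueness of tuples
  together.\<close>

lemma concat_eq_iff_slices:
  assumes "length xs = sum_list (map length yss)"
  shows "(\<forall>j<length yss. take (length (yss ! j)) (drop (sum_list (take j (map length yss))) xs) = yss ! j)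
    \<longleftrightarrow> xs = concat yss"
  using assms
proof (induct yss arbitrary: xs)
  case (Cons ys yss)
  have "(\<forall>j<length (ys # yss). take (length ((ys # yss) ! j)) (drop (sum_list (take j (map length (ys # yss)))) xs) = (ys # yss) ! j)
    \<longleftrightarrow> take (length ys) xs = ys \<and>
      (\<forall>j<length yss. take (length (yss ! j)) (drop (sum_list (take j (map length yss))) (drop (length ys) xs)) = yss ! j)"
    unfolding length_Cons All_less_Suc2 by (simp add: add_ac)
  also have "\<dots> \<longleftrightarrow> take (length ys) xs = ys \<and> drop (length ys) xs = concat yss"
    using Cons.hyps[of "drop (length ys) xs"] Cons.prems by simp
  also have "\<dots> \<longleftrightarrow> xs = concat (ys # yss)"
    by (metis append_eq_conv_conj append_take_drop_id concat.simps(2))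
  finally show ?case .
qed simp

lemma sum_list_take_nth_le:
  fixes ns :: "nat list"
  assumes "j < length ns"
  shows "sum_list (take j ns) + ns ! j \<le> sum_list ns"
proof -
  have "sum_list ns = sum_list (take j ns @ ns ! j # drop (Suc j) ns)"
    using id_take_nth_drop[OF assms] by simp
  then show ?thesis by simp
qed

lemma prod_module_is_module:
  assumes V: "module R V" and W: "module R W"
  shows "module R (prod_module V W)"
proof (rule moduleI)
  interpret V: module R V by (rule V)
  interpret W: module R W by (rule W)
  show "cring R" by (rule V.R.cring_axioms)
  show "abelian_group (prod_module V W)"
  proof (rule abelian_groupI)
    fix x assume x: "x \<in> carrier (prod_module V W)"
    then have "(\<ominus>\<^bsub>V\<^esub> fst x, \<ominus>\<^bsub>W\<^esub> snd x) \<oplus>\<^bsub>prod_module V W\<^esub> x = \<zero>\<^bsub>prod_module V W\<^esub>"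
      by (auto simp: prod_module_def V.M.l_neg W.M.l_neg)
    moreover have "(\<ominus>\<^bsub>V\<^esub> fst x, \<ominus>\<^bsub>W\<^esub> snd x) \<in> carrier (prod_module V W)"
      using x by (auto simp: prod_module_def)
    ultimately show "\<exists>y\<in>carrier (prod_module V W). y \<oplus>\<^bsub>prod_module V W\<^esub> x = \<zero>\<^bsub>prod_module V W\<^esub>" by blast
  qed (auto simp: prod_module_def V.M.a_ac W.M.a_ac)
qed (auto simp: prod_module_def module.smult_l_distr[OF V] module.smult_r_distr[OF V] module.smult_assoc1[OF V]
  module.smult_one[OF V] module.smult_closed[OF V] module.smult_l_distr[OF W] module.smult_r_distr[OF W]
  module.smult_assoc1[OF W] module.smult_one[OF W] module.smult_closed[OF W])

lemma is_lin_prod_left: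
  assumes V: "module R V" and W: "module R W"
  shows "is_lin R V (prod_module V W) (\<lambda>v. (v, \<zero>\<^bsub>W\<^esub>))"
proof -
  interpret W: module R W by (rule W)
  show ?thesis by (rule is_linI) (simp_all add: prod_module_def)
qed

lemma is_lin_prod_right:
  assumes V: "module R V" and W: "module R W"
  shows "is_lin R W (prod_module V W) (\<lambda>w. (\<zero>\<^bsub>V\<^esub>, w))"
proof -
  interpret V: module R V by (rule V)
  show ?thesis by (rule is_linI) (simp_all add: prod_module_def)
qed

section \<open>Coordinates: the modules R^n, the two inclusions and substitution of
  polynomials\<close>

context operad
begin

lemma Rpow_is_module: "module R (Rpow R n)"
  unfolding Rpow_def by (rule free_module_is_module)

lemma Rpow_carrier: "x \<in> carrier (Rpow R n) \<longleftrightarrow> (\<forall>i. x i \<in> carrier R) \<and> (\<forall>i\<ge>n. x i = \<zero>)"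
proof -
  have "finite {i. x i \<noteq> \<zero>}" if "\<forall>i\<ge>n. x i = \<zero>"
    by (rule finite_subset[of _ "{..<n}"]) (use that not_le in auto)
  then show ?thesis by (auto simp: Rpow_def free_module_def not_less)
qed

lemma Rpow_ops: "x \<oplus>\<^bsub>Rpow R n\<^esub> y = (\<lambda>i. x i \<oplus> y i)" "r \<odot>\<^bsub>Rpow R n\<^esub> x = (\<lambda>i. r \<otimes> x i)"
  "\<zero>\<^bsub>Rpow R n\<^esub> = (\<lambda>i. \<zero>)"
  by (simp_all add: Rpow_def free_module_def)

lemma Rpow_basis_closed: "i < n \<Longrightarrow> free_basis R i \<in> carrier (Rpow R n)"
  unfolding Rpow_def by (rule free_basis_closed) simp

lemma Rpow_eqI:
  assumes "is_lin R (Rpow R n) N f" "is_lin R (Rpow R n) N g" "module R N"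
    and "\<And>i. i < n \<Longrightarrow> f (free_basis R i) = g (free_basis R i)" and "x \<in> carrier (Rpow R n)"
  shows "f x = g x"
  using is_lin_free_eqI[of "{..<n}" N f g x] assms by (simp add: Rpow_def)

lemma is_lin_Rpow_append: "is_lin R (prod_module (Rpow R n) (Rpow R n)) (Rpow R (n + n)) (Rpow_append n)"
proof (rule is_linI)
  fix x assume "x \<in> carrier (prod_module (Rpow R n) (Rpow R n))"
  then show "Rpow_append n x \<in> carrier (Rpow R (n + n))"
    by (auto simp: prod_module_def Rpow_carrier Rpow_append_def)
qed (auto simp: prod_module_def Rpow_ops Rpow_append_def fun_eq_iff)

text \<open>The inclusions of the two halves of R^(n+n). Followed by the unit of the monad they are
  Kleisli maps, which in the opposite category are the two projections from \<open>n + n\<close> to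
  \<open>n\<close>.\<close>

definition inl :: "nat \<Rightarrow> (nat \<Rightarrow> 'r) \<Rightarrow> nat \<Rightarrow> 'r" where
  "inl n v = Rpow_append n (v, \<zero>\<^bsub>Rpow R n\<^esub>)"

definition inr :: "nat \<Rightarrow> (nat \<Rightarrow> 'r) \<Rightarrow> nat \<Rightarrow> 'r" where
  "inr n v = Rpow_append n (\<zero>\<^bsub>Rpow R n\<^esub>, v)"

lemma is_lin_inl: "is_lin R (Rpow R n) (Rpow R (n + n)) (inl n)"
  unfolding inl_def[abs_def]
  by (rule is_lin_comp[OF is_lin_prod_left[OF Rpow_is_module Rpow_is_module] is_lin_Rpow_append])

lemma is_lin_inr: "is_lin R (Rpow R n) (Rpow R (n + n)) (inr n)"
  unfolding inr_def[abs_def]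
  by (rule is_lin_comp[OF is_lin_prod_right[OF Rpow_is_module Rpow_is_module] is_lin_Rpow_append])

lemma inl_basis: "i < n \<Longrightarrow> inl n (free_basis R i) = free_basis R i"
  by (auto simp: inl_def Rpow_append_def free_basis_def Rpow_ops fun_eq_iff)

lemma inr_basis: "inr n (free_basis R i) = free_basis R (n + i)"
  by (auto simp: inr_def Rpow_append_def free_basis_def Rpow_ops fun_eq_iff)

lemmas Rpow_schur_is_module = schur_is_module[OF Rpow_is_module]

text \<open>The list in the definition of the derivative is the list of all (v,0) with entry
  \<open>i\<close> replaced by (0,v), so both descriptions single out a map by the same
  predicate.\<close>

lemma schur_deriv_eq:
  assumes V: "module R V"
  shows "schur_deriv R P V = deriv V (prod_module V V) (\<lambda>v. (v, \<zero>\<^bsub>V\<^esub>)) (\<lambda>v. (\<zero>\<^bsub>V\<^esub>, v))"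
proof -
  let ?VV = "prod_module V V"
  let ?S = "schur R P ?VV"
  let ?f = "\<lambda>v. (v, \<zero>\<^bsub>V\<^esub>)" and ?g = "\<lambda>v. (\<zero>\<^bsub>V\<^esub>, v)"
  note VV = prod_module_is_module[OF V V]
  interpret S: module R ?S by (rule schur_is_module[OF VV])
  have "(\<Oplus>\<^bsub>?S\<^esub>i\<in>{..<length vs}. schur_elt R P ?VV \<mu> (map (\<lambda>j. if j = i then ?g (vs ! j) else ?f (vs ! j)) [0..<length vs]))
      = dsum ?S (schur_elt R P ?VV \<mu>) (map ?f vs) (map ?g vs)"
    if \<mu>: "\<mu> \<in> carrier (ops P (length vs))" and vs: "set vs \<subseteq> carrier V" for \<mu> vs
    unfolding dsum_def length_map
  proof (intro S.finsum_cong' refl)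
    fix i assume i: "i \<in> {..<length vs}"
    have "map (\<lambda>j. if j = i then ?g (vs ! j) else ?f (vs ! j)) [0..<length vs] = (map ?f vs)[i := map ?g vs ! i]"
      using i by (intro nth_equalityI) (auto simp: nth_list_update)
    then show "schur_elt R P ?VV \<mu> (map (\<lambda>j. if j = i then ?g (vs ! j) else ?f (vs ! j)) [0..<length vs])
        = schur_elt R P ?VV \<mu> ((map ?f vs)[i := map ?g vs ! i])" by simp
  next
    have "set ((map ?f vs)[i := map ?g vs ! i]) \<subseteq> carrier ?VV" for i
      using vs is_lin_closed[OF is_lin_prod_left[OF V V]] is_lin_closed[OF is_lin_prod_right[OF V V]]
      by (intro set_list_update_nth_closed) auto
    then show "(\<lambda>i. schur_elt R P ?VV \<mu> ((map ?f vs)[i := map ?g vs ! i])) \<in> {..<length vs} \<rightarrow> carrier ?S"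
      using \<mu> by (intro Pi_I schur_formD(4)[OF schur_form_schur_elt[OF VV]]) (simp_all del: nth_map)
  qed
  then show ?thesis
    unfolding schur_deriv_def deriv_def schur_lift_def Let_def
    by (intro arg_cong[where f = The] ext) (auto cong: conj_cong)
qed

text \<open>Moving to R^(n+n) turns the pairs (v,0) and (0,v) into \<open>inl n v\<close> and
  \<open>inr n v\<close>, and on generators it commutes with the sum over the inputs.\<close>

lemma poly_partial_eq:
  assumes s: "s \<in> carrier (schur R P (Rpow R n))"
  shows "poly_partial R P n s = deriv (Rpow R n) (Rpow R (n + n)) (inl n) (inr n) s"
proof -
  let ?V = "Rpow R n" let ?VV = "prod_module ?V ?V" let ?W = "Rpow R (n + n)"
  note V = Rpow_is_module[of n] and W = Rpow_is_module[of "n + n"]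
  note VV = prod_module_is_module[OF V V]
  note l = is_lin_prod_left[OF V V] is_lin_prod_right[OF V V]
  note m = is_lin_schur_map[OF VV W is_lin_Rpow_append]
  interpret SW: module R "schur R P ?W" by (rule Rpow_schur_is_module)
  have "schur_map R P ?VV ?W (Rpow_append n) (deriv ?V ?VV (\<lambda>v. (v, \<zero>\<^bsub>?V\<^esub>)) (\<lambda>v. (\<zero>\<^bsub>?V\<^esub>, v)) s) = deriv ?V ?W (inl n) (inr n) s"
  proof (rule schur_eqI[OF V is_lin_comp[OF is_lin_deriv[OF V VV l] m] is_lin_deriv[OF V W is_lin_inl is_lin_inr] _ s])
    fix \<mu> vs assume \<mu>: "\<mu> \<in> carrier (ops P (length vs))" and vs: "set vs \<subseteq> carrier ?V"
    let ?x = "\<lambda>i. (map (\<lambda>v. (v, \<zero>\<^bsub>?V\<^esub>)) vs)[i := map (\<lambda>v. (\<zero>\<^bsub>?V\<^esub>, v)) vs ! i]"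
    have c: "set (?x i) \<subseteq> carrier ?VV" for i
      using vs is_lin_closed[OF l(1)] is_lin_closed[OF l(2)] by (intro set_list_update_nth_closed) auto
    have ec: "schur_elt R P ?VV \<mu> (?x i) \<in> carrier (schur R P ?VV)" for i
      using schur_formD(4)[OF schur_form_schur_elt[OF VV] _ c[of i], of \<mu>] \<mu> by simp
    have me: "schur_map R P ?VV ?W (Rpow_append n) (schur_elt R P ?VV \<mu> (?x i))
        = schur_elt R P ?W \<mu> ((map (inl n) vs)[i := map (inr n) vs ! i])" if i: "i < length vs" for i
    proof -
      have "map (Rpow_append n) (?x i) = (map (inl n) vs)[i := map (inr n) vs ! i]"
        using i by (simp add: map_update comp_def inl_def[abs_def] inr_def)
      then show ?thesis using schur_map_elt[OF VV W is_lin_Rpow_append _ c[of i], of \<mu>] \<mu> by simp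
    qed
    have "schur_map R P ?VV ?W (Rpow_append n) (deriv ?V ?VV (\<lambda>v. (v, \<zero>\<^bsub>?V\<^esub>)) (\<lambda>v. (\<zero>\<^bsub>?V\<^esub>, v)) (schur_elt R P ?V \<mu> vs))
        = (\<Oplus>\<^bsub>schur R P ?W\<^esub>i\<in>{..<length (map (\<lambda>v. (v, \<zero>\<^bsub>?V\<^esub>)) vs)}. schur_map R P ?VV ?W (Rpow_append n) (schur_elt R P ?VV \<mu> (?x i)))"
      unfolding deriv_elt[OF V VV l \<mu> vs] dsum_def using ec
      by (intro is_lin_finsum[OF m schur_is_module[OF VV] Rpow_schur_is_module]) auto
    also have "\<dots> = deriv ?V ?W (inl n) (inr n) (schur_elt R P ?V \<mu> vs)"
      unfolding deriv_elt[OF V W is_lin_inl is_lin_inr \<mu> vs] dsum_def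
    proof (intro SW.finsum_cong')
      show "(\<lambda>i. schur_elt R P ?W \<mu> ((map (inl n) vs)[i := map (inr n) vs ! i])) \<in> {..<length (map (inl n) vs)} \<rightarrow> carrier (schur R P ?W)"
      proof
        fix i assume "i \<in> {..<length (map (inl n) vs)}"
        then have "i < length vs" by simp
        from is_lin_closed[OF m ec[of i]] show "schur_elt R P ?W \<mu> ((map (inl n) vs)[i := map (inr n) vs ! i]) \<in> carrier (schur R P ?W)"
          unfolding me[OF \<open>i < length vs\<close>] .
      qed
    qed (use me in simp_all)
    finally show "schur_map R P ?VV ?W (Rpow_append n) (deriv ?V ?VV (\<lambda>v. (v, \<zero>\<^bsub>?V\<^esub>)) (\<lambda>v. (\<zero>\<^bsub>?V\<^esub>, v)) (schur_elt R P ?V \<mu> vs))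
        = deriv ?V ?W (inl n) (inr n) (schur_elt R P ?V \<mu> vs)" .
  qed
  then show ?thesis by (simp add: poly_partial_def schur_deriv_eq[OF V])
qed

lemma is_lin_poly_partial: "is_lin R (schur R P (Rpow R n)) (schur R P (Rpow R (n + n))) (poly_partial R P n)"
  by (rule is_lin_cong[OF is_lin_deriv[OF Rpow_is_module Rpow_is_module is_lin_inl is_lin_inr] Rpow_schur_is_module poly_partial_eq])

lemma poly_var_closed: "i < n \<Longrightarrow> poly_var R P n i \<in> carrier (schur R P (Rpow R n))"
  unfolding poly_var_def by (intro schur_unit_closed[OF Rpow_is_module] Rpow_basis_closed)

text \<open>A variable has a single input, so the sum has one term; in it \<open>inr\<close> sends
  basis vector \<open>i\<close> to basis vector \<open>n + i\<close>.\<close>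

lemma poly_partial_var:
  assumes i: "i < n"
  shows "poly_partial R P n (poly_var R P n i) = poly_var R P (n + n) (n + i)"
proof -
  let ?W = "Rpow R (n + n)"
  interpret SW: module R "schur R P ?W" by (rule Rpow_schur_is_module)
  have b: "set [free_basis R i] \<subseteq> carrier (Rpow R n)" using Rpow_basis_closed[OF i] by simp
  have "poly_partial R P n (poly_var R P n i) = deriv (Rpow R n) ?W (inl n) (inr n) (schur_elt R P (Rpow R n) (op_unit P) [free_basis R i])"
    using poly_partial_eq[OF poly_var_closed[OF i]] by (simp add: poly_var_def schur_unit_def)
  also have "\<dots> = dsum (schur R P ?W) (schur_elt R P ?W (op_unit P)) [inl n (free_basis R i)] [inr n (free_basis R i)]"
    using deriv_elt[OF Rpow_is_module Rpow_is_module is_lin_inl is_lin_inr _ b, of "op_unit P"] op_unit_closed by simp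
  also have "\<dots> = poly_var R P (n + n) (n + i)"
    using poly_var_closed[of "n + i" "n + n"] i
    by (simp add: dsum_def lessThan_Suc inr_basis poly_var_def schur_unit_def)
  finally show ?thesis .
qed

lemma is_lin_kleisli_of:
  assumes Ps: "length Ps = m" "set Ps \<subseteq> carrier (schur R P (Rpow R n))"
  shows "is_lin R (Rpow R m) (schur R P (Rpow R n)) (kleisli_of R P (n, m, Ps))"
proof -
  let ?S = "schur R P (Rpow R n)"
  interpret S: module R ?S by (rule Rpow_schur_is_module)
  have "is_lin R (Rpow R m) ?S (\<lambda>x. x i \<odot>\<^bsub>?S\<^esub> p)" if "p \<in> carrier ?S" for i p
    using that by (intro is_linI) (auto simp: Rpow_carrier Rpow_ops S.smult_l_distr S.smult_assoc1)
  moreover have "Ps ! i \<in> carrier ?S" if "i < m" for i using Ps that by auto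
  ultimately have "is_lin R (Rpow R m) ?S (\<lambda>x. \<Oplus>\<^bsub>?S\<^esub>i\<in>{..<m}. x i \<odot>\<^bsub>?S\<^esub> Ps ! i)"
    by (intro is_lin_finsum_fun Rpow_is_module Rpow_schur_is_module) simp_all
  then show ?thesis by (rule is_lin_cong[OF _ Rpow_is_module]) (simp add: kleisli_of_def)
qed

lemma kleisli_of_basis:
  assumes Ps: "length Ps = m" "set Ps \<subseteq> carrier (schur R P (Rpow R n))" and i: "i < m"
  shows "kleisli_of R P (n, m, Ps) (free_basis R i) = Ps ! i"
proof -
  let ?S = "schur R P (Rpow R n)"
  interpret S: module R ?S by (rule Rpow_schur_is_module)
  have c: "Ps ! j \<in> carrier ?S" if "j < m" for j using Ps that by auto
  have "kleisli_of R P (n, m, Ps) (free_basis R i) = (\<Oplus>\<^bsub>?S\<^esub>j\<in>{..<m}. free_basis R i j \<odot>\<^bsub>?S\<^esub> Ps ! j)"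
    using Rpow_basis_closed[OF i] by (simp add: kleisli_of_def)
  also have "\<dots> = (\<Oplus>\<^bsub>?S\<^esub>j\<in>{..<m}. if i = j then Ps ! j else \<zero>\<^bsub>?S\<^esub>)"
    using c by (intro S.M.finsum_cong') (auto simp: free_basis_def)
  also have "\<dots> = Ps ! i" using c i by (intro S.M.finsum_singleton) auto
  finally show ?thesis .
qed

text \<open>R^m is free on its basis vectors. Identities between Kleisli maps are thereby reduced to
  identities between the entries of lists of polynomials.\<close>

lemma kleisli_of_unique:
  assumes Ps: "length Ps = m" "set Ps \<subseteq> carrier (schur R P (Rpow R n))"
    and g: "is_lin R (Rpow R m) (schur R P (Rpow R n)) g" "\<And>i. i < m \<Longrightarrow> g (free_basis R i) = Ps ! i"
    and v: "v \<in> carrier (Rpow R m)"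
  shows "kleisli_of R P (n, m, Ps) v = g v"
  by (rule Rpow_eqI[OF is_lin_kleisli_of[OF Ps] g(1) Rpow_schur_is_module _ v])
    (simp add: kleisli_of_basis[OF Ps] g(2))

text \<open>Concatenation of lists is pairing of maps; restriction along the first inclusion
  recovers the first component, and \<open>kleisli_of_inr\<close> does the same for the
  second.\<close>

lemma kleisli_of_inl:
  assumes "length Ps = m" "set Ps \<subseteq> carrier (schur R P (Rpow R n))"
    and "length Qs = m" "set Qs \<subseteq> carrier (schur R P (Rpow R n))" and "v \<in> carrier (Rpow R m)"
  shows "kleisli_of R P (n, m + m, Ps @ Qs) (inl m v) = kleisli_of R P (n, m, Ps) v"
  using assms
  by (intro kleisli_of_unique[symmetric] is_lin_comp[OF is_lin_inl] is_lin_kleisli_of)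
    (simp_all add: inl_basis kleisli_of_basis nth_append)

lemma kleisli_of_inr:
  assumes "length Ps = m" "set Ps \<subseteq> carrier (schur R P (Rpow R n))"
    and "length Qs = m" "set Qs \<subseteq> carrier (schur R P (Rpow R n))" and "v \<in> carrier (Rpow R m)"
  shows "kleisli_of R P (n, m + m, Ps @ Qs) (inr m v) = kleisli_of R P (n, m, Qs) v"
  using assms
  by (intro kleisli_of_unique[symmetric] is_lin_comp[OF is_lin_inr] is_lin_kleisli_of)
    (simp_all add: inr_basis kleisli_of_basis nth_append)

text \<open>Substitution of the polynomials \<open>Ps\<close> for the \<open>m\<close> variables;
  composition in the category applies it to each component.\<close>

definition psubst :: "nat \<Rightarrow> nat \<Rightarrow> ('r, 'p, nat \<Rightarrow> 'r) schur list \<Rightarrow> ('r, 'p, nat \<Rightarrow> 'r) schur \<Rightarrow> ('r, 'p, nat \<Rightarrow> 'r) schur" where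
  "psubst n m Ps = bind (Rpow R m) (Rpow R n) (kleisli_of R P (n, m, Ps))"

lemma is_lin_psubst:
  "length Ps = m \<Longrightarrow> set Ps \<subseteq> carrier (schur R P (Rpow R n)) \<Longrightarrow>
    is_lin R (schur R P (Rpow R m)) (schur R P (Rpow R n)) (psubst n m Ps)"
  unfolding psubst_def by (intro is_lin_bind Rpow_is_module is_lin_kleisli_of)

lemma psubst_var:
  "length Ps = m \<Longrightarrow> set Ps \<subseteq> carrier (schur R P (Rpow R n)) \<Longrightarrow> i < m \<Longrightarrow> psubst n m Ps (poly_var R P m i) = Ps ! i"
  unfolding psubst_def poly_var_def
  by (simp add: bind_unit[OF Rpow_is_module Rpow_is_module is_lin_kleisli_of Rpow_basis_closed] kleisli_of_basis)

lemma psubst_vars: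
  assumes s: "s \<in> carrier (schur R P (Rpow R n))"
  shows "psubst n n (map (poly_var R P n) [0..<n]) s = s"
proof -
  let ?Ps = "map (poly_var R P n) [0..<n]"
  have Ps: "length ?Ps = n" "set ?Ps \<subseteq> carrier (schur R P (Rpow R n))" using poly_var_closed by auto
  have "kleisli_of R P (n, n, ?Ps) v = schur_unit R P (Rpow R n) v" if "v \<in> carrier (Rpow R n)" for v
    using that by (intro kleisli_of_unique Ps is_lin_schur_unit[OF Rpow_is_module]) (simp_all add: poly_var_def)
  then have "psubst n n ?Ps s = bind (Rpow R n) (Rpow R n) (schur_unit R P (Rpow R n)) s"
    unfolding psubst_def using s by (intro bind_cong Rpow_is_module is_lin_schur_unit)
  then show ?thesis by (simp add: bind_unit_right[OF Rpow_is_module s])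
qed

lemma psubst_psubst:
  assumes Ps: "length Ps = m" "set Ps \<subseteq> carrier (schur R P (Rpow R n))"
    and Qs: "length Qs = l" "set Qs \<subseteq> carrier (schur R P (Rpow R m))"
    and s: "s \<in> carrier (schur R P (Rpow R l))"
  shows "psubst n m Ps (psubst m l Qs s) = psubst n l (map (psubst n m Ps) Qs) s"
proof -
  have c: "set (map (psubst n m Ps) Qs) \<subseteq> carrier (schur R P (Rpow R n))"
    using Qs is_lin_closed[OF is_lin_psubst[OF Ps]] by auto
  note lin = is_lin_comp[OF is_lin_kleisli_of[OF Qs] is_lin_psubst[OF Ps]]
  have "kleisli_of R P (n, l, map (psubst n m Ps) Qs) v = psubst n m Ps (kleisli_of R P (m, l, Qs) v)"
    if "v \<in> carrier (Rpow R l)" for v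
    using that Qs by (intro kleisli_of_unique c lin) (simp_all add: kleisli_of_basis)
  then have "psubst n l (map (psubst n m Ps) Qs) s
      = bind (Rpow R l) (Rpow R n) (\<lambda>v. psubst n m Ps (kleisli_of R P (m, l, Qs) v)) s"
    unfolding psubst_def[of n l] by (intro bind_cong Rpow_is_module lin s)
  also have "\<dots> = psubst n m Ps (psubst m l Qs s)"
    unfolding psubst_def
    by (rule bind_bind[OF Rpow_is_module Rpow_is_module Rpow_is_module is_lin_kleisli_of[OF Qs] is_lin_kleisli_of[OF Ps] s, symmetric])
  finally show ?thesis ..
qed

abbreviation SR :: "nat \<Rightarrow> ('r, ('r, 'p, nat \<Rightarrow> 'r) schur) module" where
  "SR n \<equiv> schur R P (Rpow R n)"

lemma poly_hom_iff: "(n', m', Ps) \<in> poly_hom R P n m \<longleftrightarrow> n' = n \<and> m' = m \<and> length Ps = m \<and> set Ps \<subseteq> carrier (SR n)"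
  by (auto simp: poly_hom_def)

lemma poly_homE:
  assumes "f \<in> poly_hom R P n m"
  obtains Ps where "f = (n, m, Ps)" "length Ps = m" "set Ps \<subseteq> carrier (SR n)"
  using assms by (auto simp: poly_hom_def)

lemma POLY_simps:
  "Ob (POLY R P) = UNIV" "Hom (POLY R P) = poly_hom R P" "Prod (POLY R P) = sum_list"
  "Id (POLY R P) n = (n, n, map (poly_var R P n) [0..<n])"
  "Proj (POLY R P) ns j = (sum_list ns, ns ! j, map (\<lambda>i. poly_var R P (sum_list ns) (sum_list (take j ns) + i)) [0..<ns ! j])"
  "Add (POLY R P) (n, m, Ps) (n', m', Qs) = (n, m, map2 (add (SR n)) Ps Qs)"
  "Zero (POLY R P) n m = (n, m, replicate m \<zero>\<^bsub>SR n\<^esub>)"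
  "Comp (POLY R P) (m'', l, Qs) (n, m, Ps) = (n, l, map (psubst n m Ps) Qs)"
  by (simp_all add: POLY_def poly_comp_def psubst_def bind_def[abs_def])

lemma psubst_closed: "length Ps = m \<Longrightarrow> set Ps \<subseteq> carrier (SR n) \<Longrightarrow> s \<in> carrier (SR m) \<Longrightarrow> psubst n m Ps s \<in> carrier (SR n)"
  using is_lin_closed[OF is_lin_psubst] by blast

lemma psubst_map_closed: "length Ps = m \<Longrightarrow> set Ps \<subseteq> carrier (SR n) \<Longrightarrow> set Qs \<subseteq> carrier (SR m) \<Longrightarrow> set (map (psubst n m Ps) Qs) \<subseteq> carrier (SR n)"
  using psubst_closed by auto

lemma poly_partial_map_closed: "set Qs \<subseteq> carrier (SR n) \<Longrightarrow> set (map (poly_partial R P n) Qs) \<subseteq> carrier (SR (n + n))"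
  using is_lin_closed[OF is_lin_poly_partial] by auto

lemma map2_add_closed:
  assumes "set Ps \<subseteq> carrier (SR n)" "set Qs \<subseteq> carrier (SR n)"
  shows "set (map2 (add (SR n)) Ps Qs) \<subseteq> carrier (SR n)"
proof -
  interpret S: module R "SR n" by (rule Rpow_schur_is_module)
  show ?thesis using assms by (auto dest: set_zip_leftD set_zip_rightD)
qed

lemma zeros_closed: "set (replicate m \<zero>\<^bsub>SR n\<^esub>) \<subseteq> carrier (SR n)"
proof -
  interpret S: module R "SR n" by (rule Rpow_schur_is_module)
  show ?thesis by (auto simp: set_replicate_conv_if)
qed

section \<open>Category structure, finite products and addition of maps\<close>

lemma category_POLY: "category (POLY R P)"
proof (rule category.intro)
  fix f :: "('r, 'p) poly_map" and A B A' B'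
  assume "f \<in> Hom (POLY R P) A B" "f \<in> Hom (POLY R P) A' B'"
  then show "A = A' \<and> B = B'" by (auto simp: POLY_simps elim!: poly_homE)
next
  fix A show "Id (POLY R P) A \<in> Hom (POLY R P) A A"
    using poly_var_closed by (auto simp: POLY_simps poly_hom_iff)
next
  fix f g :: "('r, 'p) poly_map" and A B E
  assume "f \<in> Hom (POLY R P) A B" "g \<in> Hom (POLY R P) B E"
  then show "Comp (POLY R P) g f \<in> Hom (POLY R P) A E"
    using psubst_map_closed by (auto simp: POLY_simps poly_hom_iff elim!: poly_homE)
next
  fix f :: "('r, 'p) poly_map" and A B
  assume "f \<in> Hom (POLY R P) A B"
  then obtain Fs where f: "f = (A, B, Fs)" "length Fs = B" "set Fs \<subseteq> carrier (SR A)"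
    by (auto simp: POLY_simps elim: poly_homE)
  show "Comp (POLY R P) f (Id (POLY R P) A) = f"
    using f by (auto simp: POLY_simps psubst_vars intro!: map_idI)
  show "Comp (POLY R P) (Id (POLY R P) B) f = f"
    using f by (auto simp: POLY_simps psubst_var intro!: nth_equalityI)
next
  fix f g h :: "('r, 'p) poly_map" and A B E F
  assume "f \<in> Hom (POLY R P) A B" "g \<in> Hom (POLY R P) B E" "h \<in> Hom (POLY R P) E F"
  then show "Comp (POLY R P) (Comp (POLY R P) h g) f = Comp (POLY R P) h (Comp (POLY R P) g f)"
    by (auto simp: POLY_simps elim!: poly_homE intro!: psubst_psubst)
qed

lemma Proj_Hom_POLY:
  assumes "j < length As"
  shows "Proj (POLY R P) As j \<in> Hom (POLY R P) (sum_list As) (As ! j)"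
  using sum_list_take_nth_le[OF assms] poly_var_closed by (auto simp: POLY_simps poly_hom_iff)

text \<open>A projection is a list of consecutive variables, and substituting into a variable
  selects the corresponding entry.\<close>

lemma Proj_Comp_POLY:
  assumes j: "j < length As" and Hs: "length Hs = sum_list As" "set Hs \<subseteq> carrier (SR X)"
  shows "Comp (POLY R P) (Proj (POLY R P) As j) (X, sum_list As, Hs) = (X, As ! j, take (As ! j) (drop (sum_list (take j As)) Hs))"
  using sum_list_take_nth_le[OF j] Hs
  by (auto simp: POLY_simps psubst_var intro!: nth_equalityI)

text \<open>Since projections cut out consecutive slices, the tuple equations say that the
  components of \<open>h\<close> are the concatenation of those of \<open>fs\<close>. Being an
  equivalence with an explicit value, this is the universal property of the product.\<close>

lemma is_tuple_POLY:
  assumes fs: "list_all2 (\<lambda>f A. f \<in> Hom (POLY R P) X A) fs As"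
  shows "is_tuple (POLY R P) X As fs h \<longleftrightarrow> h = (X, sum_list As, concat (map (snd \<circ> snd) fs))"
proof -
  let ?Fs = "map (snd \<circ> snd) fs"
  have len: "length fs = length As" using fs by (rule list_all2_lengthD)
  have f: "fs ! j = (X, As ! j, ?Fs ! j)" "length (?Fs ! j) = As ! j" "set (?Fs ! j) \<subseteq> carrier (SR X)"
    if "j < length As" for j
    using list_all2_nthD2[OF fs that] that len by (auto simp: POLY_simps elim!: poly_homE)
  have mF: "map length ?Fs = As" using f(2) len by (intro nth_equalityI) simp_all
  have lF: "length ?Fs = length As" using len by simp
  have c: "set (concat ?Fs) \<subseteq> carrier (SR X)"
    using f(3) len by (fastforce simp: in_set_conv_nth)
  have lc: "length (concat ?Fs) = sum_list As" by (simp only: length_concat mF)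
  have main: "is_tuple (POLY R P) X As fs (X, sum_list As, Hs) \<longleftrightarrow> Hs = concat ?Fs"
    if Hs: "length Hs = sum_list As" "set Hs \<subseteq> carrier (SR X)" for Hs
  proof -
    have "is_tuple (POLY R P) X As fs (X, sum_list As, Hs) \<longleftrightarrow>
        (\<forall>j<length As. take (As ! j) (drop (sum_list (take j As)) Hs) = ?Fs ! j)"
      using Hs f(1) by (simp add: is_tuple_def POLY_simps(2,3) poly_hom_iff Proj_Comp_POLY[OF _ Hs])
    also have "\<dots> \<longleftrightarrow> (\<forall>j<length ?Fs. take (length (?Fs ! j)) (drop (sum_list (take j (map length ?Fs))) Hs) = ?Fs ! j)"
      unfolding mF lF by (rule iff_allI, rule imp_cong[OF refl]) (simp only: f(2))
    also have "\<dots> \<longleftrightarrow> Hs = concat ?Fs"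
      by (rule concat_eq_iff_slices) (simp only: Hs(1) mF)
    finally show ?thesis .
  qed
  show ?thesis
  proof
    assume h: "is_tuple (POLY R P) X As fs h"
    then obtain Hs where "h = (X, sum_list As, Hs)" "length Hs = sum_list As" "set Hs \<subseteq> carrier (SR X)"
      by (auto simp: is_tuple_def POLY_simps(2,3) elim: poly_homE)
    then show "h = (X, sum_list As, concat ?Fs)" using h main by simp
  next
    assume "h = (X, sum_list As, concat ?Fs)"
    then show "is_tuple (POLY R P) X As fs h" using main[OF lc c] by simp
  qed
qed

lemma tuple_POLY:
  assumes "list_all2 (\<lambda>f A. f \<in> Hom (POLY R P) X A) fs As"
  shows "tuple (POLY R P) X As fs = (X, sum_list As, concat (map (snd \<circ> snd) fs))"
  unfolding tuple_def is_tuple_POLY[OF assms] by simp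

lemma pair_POLY:
  assumes "length Fs = A" "set Fs \<subseteq> carrier (SR X)" "length Gs = B" "set Gs \<subseteq> carrier (SR X)"
  shows "tuple (POLY R P) X [A, B] [(X, A, Fs), (X, B, Gs)] = (X, A + B, Fs @ Gs)"
  using assms by (subst tuple_POLY) (simp_all add: POLY_simps poly_hom_iff)

lemma finite_products_POLY: "category_with_finite_products (POLY R P)"
proof (intro category_with_finite_products.intro category_POLY category_with_finite_products_axioms.intro)
  fix X As and fs :: "('r, 'p) poly_map list"
  assume "list_all2 (\<lambda>f A. f \<in> Hom (POLY R P) X A) fs As"
  then show "\<exists>!h. is_tuple (POLY R P) X As fs h" by (simp add: is_tuple_POLY)
next
  fix As j assume "j < length (As :: nat list)"
  then show "Proj (POLY R P) As j \<in> Hom (POLY R P) (Prod (POLY R P) As) (As ! j)"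
    using Proj_Hom_POLY by (simp add: POLY_simps(3))
qed (simp add: POLY_simps)

lemma left_additive_POLY: "cartesian_left_additive_category (POLY R P)"
proof (intro cartesian_left_additive_category.intro finite_products_POLY cartesian_left_additive_category_axioms.intro)
  fix A B
  interpret S: module R "SR A" by (rule Rpow_schur_is_module)
  have c: "Fs ! i \<in> carrier (SR A)" if "set Fs \<subseteq> carrier (SR A)" "i < length Fs" for Fs i using that by auto
  let ?M = "\<lparr>carrier = Hom (POLY R P) A B, monoid.mult = Add (POLY R P), one = Zero (POLY R P) A B\<rparr>"
  show "comm_monoid ?M"
  proof (rule comm_monoidI)
    fix x y z assume "x \<in> carrier ?M" "y \<in> carrier ?M" "z \<in> carrier ?M"
    then show "x \<otimes>\<^bsub>?M\<^esub> y \<otimes>\<^bsub>?M\<^esub> z = x \<otimes>\<^bsub>?M\<^esub> (y \<otimes>\<^bsub>?M\<^esub> z)"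
      by (auto simp: POLY_simps elim!: poly_homE intro!: nth_equalityI S.M.a_assoc c)
  next
    fix x y assume "x \<in> carrier ?M" "y \<in> carrier ?M"
    then show "x \<otimes>\<^bsub>?M\<^esub> y = y \<otimes>\<^bsub>?M\<^esub> x"
      by (auto simp: POLY_simps elim!: poly_homE intro!: nth_equalityI S.M.a_comm c)
  qed (use zeros_closed map2_add_closed in \<open>auto simp: POLY_simps poly_hom_iff elim!: poly_homE
      intro!: nth_equalityI S.M.l_zero c\<close>)
next
  fix A B E and f g h :: "('r, 'p) poly_map"
  assume "f \<in> Hom (POLY R P) B E" "g \<in> Hom (POLY R P) B E" "h \<in> Hom (POLY R P) A B"
  then obtain Fs Gs Hs where f: "f = (B, E, Fs)" "length Fs = E" "set Fs \<subseteq> carrier (SR B)"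
    and g: "g = (B, E, Gs)" "length Gs = E" "set Gs \<subseteq> carrier (SR B)"
    and h: "h = (A, B, Hs)" "length Hs = B" "set Hs \<subseteq> carrier (SR A)"
    by (auto simp: POLY_simps elim!: poly_homE)
  have c: "Fs ! i \<in> carrier (SR B)" "Gs ! i \<in> carrier (SR B)" if "i < E" for i using f g that by auto
  show "Comp (POLY R P) (Add (POLY R P) f g) h = Add (POLY R P) (Comp (POLY R P) f h) (Comp (POLY R P) g h)"
    using f(1,2) g(1,2) h(1) is_lin_add[OF is_lin_psubst[OF h(2,3)]] c
    by (auto simp: POLY_simps intro!: nth_equalityI)
next
  fix A B E and h :: "('r, 'p) poly_map"
  assume "h \<in> Hom (POLY R P) A B"
  then obtain Hs where h: "h = (A, B, Hs)" "length Hs = B" "set Hs \<subseteq> carrier (SR A)"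
    by (auto simp: POLY_simps elim!: poly_homE)
  show "Comp (POLY R P) (Zero (POLY R P) B E) h = Zero (POLY R P) A E"
    using h(1) is_lin_zero[OF is_lin_psubst[OF h(2,3)] Rpow_schur_is_module Rpow_schur_is_module]
    by (simp add: POLY_simps)
next
  fix X As j and f g :: "('r, 'p) poly_map"
  assume j: "j < length As" and "f \<in> Hom (POLY R P) X (Prod (POLY R P) As)" "g \<in> Hom (POLY R P) X (Prod (POLY R P) As)"
  then obtain Fs Gs where f: "f = (X, sum_list As, Fs)" "length Fs = sum_list As" "set Fs \<subseteq> carrier (SR X)"
    and g: "g = (X, sum_list As, Gs)" "length Gs = sum_list As" "set Gs \<subseteq> carrier (SR X)"
    by (auto simp: POLY_simps elim!: poly_homE)
  have l: "length (map2 (add (SR X)) Fs Gs) = sum_list As" using f g by simp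
  show "Comp (POLY R P) (Proj (POLY R P) As j) (Add (POLY R P) f g)
      = Add (POLY R P) (Comp (POLY R P) (Proj (POLY R P) As j) f) (Comp (POLY R P) (Proj (POLY R P) As j) g)"
    unfolding f(1) g(1) POLY_simps(6) Proj_Comp_POLY[OF j f(2,3)] Proj_Comp_POLY[OF j g(2,3)]
      Proj_Comp_POLY[OF j l map2_add_closed[OF f(3) g(3)]]
    by (simp add: take_zip drop_zip take_map drop_map)
next
  fix X As j assume j: "j < length (As :: nat list)"
  have l: "length (replicate (sum_list As) \<zero>\<^bsub>SR X\<^esub>) = sum_list As" by simp
  show "Comp (POLY R P) (Proj (POLY R P) As j) (Zero (POLY R P) X (Prod (POLY R P) As)) = Zero (POLY R P) X (As ! j)"
    unfolding POLY_simps(3,7) Proj_Comp_POLY[OF j l zeros_closed]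
    using sum_list_take_nth_le[OF j] by simp
qed

section \<open>The differential axioms for single polynomials\<close>

lemma kleisli_of_add:
  assumes Ps: "length Ps = m" "set Ps \<subseteq> carrier (SR n)" and Qs: "length Qs = m" "set Qs \<subseteq> carrier (SR n)"
    and v: "v \<in> carrier (Rpow R m)"
  shows "kleisli_of R P (n, m, map2 (add (SR n)) Ps Qs) v = kleisli_of R P (n, m, Ps) v \<oplus>\<^bsub>SR n\<^esub> kleisli_of R P (n, m, Qs) v"
  using Ps Qs v
  by (intro kleisli_of_unique map2_add_closed is_lin_add_fun is_lin_kleisli_of Rpow_schur_is_module)
    (simp_all add: kleisli_of_basis)

lemma kleisli_of_zero:
  assumes v: "v \<in> carrier (Rpow R m)"
  shows "kleisli_of R P (n, m, replicate m \<zero>\<^bsub>SR n\<^esub>) v = \<zero>\<^bsub>SR n\<^esub>"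
  using v by (intro kleisli_of_unique zeros_closed is_lin_zero_fun Rpow_schur_is_module) simp_all

lemma psubst_partial:
  assumes "s \<in> carrier (SR m)"
  shows "psubst n (m + m) Qs (poly_partial R P m s)
    = bind (Rpow R (m + m)) (Rpow R n) (kleisli_of R P (n, m + m, Qs)) (deriv (Rpow R m) (Rpow R (m + m)) (inl m) (inr m) s)"
  using assms by (simp add: psubst_def poly_partial_eq)

lemma psubst_partial_partial:
  assumes s: "s \<in> carrier (SR m)"
  shows "psubst n (m + m + (m + m)) Qs (poly_partial R P (m + m) (poly_partial R P m s))
    = bind (Rpow R (m + m + (m + m))) (Rpow R n) (kleisli_of R P (n, m + m + (m + m), Qs))
       (deriv (Rpow R (m + m)) (Rpow R (m + m + (m + m))) (inl (m + m)) (inr (m + m))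
         (deriv (Rpow R m) (Rpow R (m + m)) (inl m) (inr m) s))"
  using is_lin_closed[OF is_lin_poly_partial s] s by (simp add: psubst_def poly_partial_eq)

text \<open>One component of [CD.5]. It remains to check the two hypotheses of
  \<open>deriv_bind\<close> for the concatenated list, one for each inclusion, and both follow by
  comparison on basis vectors.\<close>

lemma poly_partial_psubst:
  assumes Fs: "length Fs = B" "set Fs \<subseteq> carrier (SR A)" and s: "s \<in> carrier (SR B)"
  shows "poly_partial R P A (psubst A B Fs s)
    = psubst (A + A) (B + B) (map (psubst (A + A) A (map (poly_var R P (A + A)) [0..<A])) Fs @ map (poly_partial R P A) Fs)
       (poly_partial R P B s)"
proof -
  \<comment> \<open>The first \<open>A\<close> of the \<open>A + A\<close> variables, that is, the
    first projection; its Kleisli map is the unit after \<open>inl\<close>. Consequently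
    \<open>?Gs\<close> is the composite with that projection, and \<open>?Hs\<close> is the
    derivative.\<close>
  let ?V = "map (poly_var R P (A + A)) [0..<A]"
  let ?Gs = "map (psubst (A + A) A ?V) Fs" and ?Hs = "map (poly_partial R P A) Fs"
  have V: "length ?V = A" "set ?V \<subseteq> carrier (SR (A + A))" using poly_var_closed by auto
  have G: "length ?Gs = B" "set ?Gs \<subseteq> carrier (SR (A + A))" using psubst_map_closed[OF V Fs(2)] Fs by simp_all
  have H: "length ?Hs = B" "set ?Hs \<subseteq> carrier (SR (A + A))" using poly_partial_map_closed[OF Fs(2)] Fs by simp_all
  have GH: "length (?Gs @ ?Hs) = B + B" "set (?Gs @ ?Hs) \<subseteq> carrier (SR (A + A))" using G H by simp_all
  have W: "kleisli_of R P (A + A, A, ?V) v = schur_unit R P (Rpow R (A + A)) (inl A v)" if "v \<in> carrier (Rpow R A)" for v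
    using that by (intro kleisli_of_unique V is_lin_comp[OF is_lin_inl is_lin_schur_unit[OF Rpow_is_module]])
      (simp_all add: poly_var_def inl_basis)
  have "poly_partial R P A (psubst A B Fs s)
      = deriv (Rpow R A) (Rpow R (A + A)) (inl A) (inr A) (bind (Rpow R B) (Rpow R A) (kleisli_of R P (A, B, Fs)) s)"
    using poly_partial_eq[OF psubst_closed[OF Fs s]] by (simp add: psubst_def)
  also have "\<dots> = bind (Rpow R (B + B)) (Rpow R (A + A)) (kleisli_of R P (A + A, B + B, ?Gs @ ?Hs))
      (deriv (Rpow R B) (Rpow R (B + B)) (inl B) (inr B) s)"
  proof (rule deriv_bind[OF Rpow_is_module Rpow_is_module Rpow_is_module Rpow_is_module is_lin_inl is_lin_inr is_lin_inl is_lin_inr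
        is_lin_kleisli_of[OF Fs] is_lin_kleisli_of[OF GH] _ _ s])
    fix v assume v: "v \<in> carrier (Rpow R B)"
    have kv: "kleisli_of R P (A, B, Fs) v \<in> carrier (SR A)" by (rule is_lin_closed[OF is_lin_kleisli_of[OF Fs] v])
    have "kleisli_of R P (A + A, B + B, ?Gs @ ?Hs) (inl B v) = kleisli_of R P (A + A, B, ?Gs) v"
      by (rule kleisli_of_inl[OF G H v])
    also have "\<dots> = psubst (A + A) A ?V (kleisli_of R P (A, B, Fs) v)"
      using Fs by (intro kleisli_of_unique G is_lin_comp[OF is_lin_kleisli_of[OF Fs] is_lin_psubst[OF V]] v)
        (simp_all add: kleisli_of_basis)
    also have "\<dots> = bind (Rpow R A) (Rpow R (A + A)) (\<lambda>w. schur_unit R P (Rpow R (A + A)) (inl A w)) (kleisli_of R P (A, B, Fs) v)"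
      unfolding psubst_def
      by (intro bind_cong Rpow_is_module is_lin_comp[OF is_lin_inl is_lin_schur_unit[OF Rpow_is_module]] W kv)
    finally show "kleisli_of R P (A + A, B + B, ?Gs @ ?Hs) (inl B v)
      = bind (Rpow R A) (Rpow R (A + A)) (\<lambda>w. schur_unit R P (Rpow R (A + A)) (inl A w)) (kleisli_of R P (A, B, Fs) v)" .
    have "kleisli_of R P (A + A, B + B, ?Gs @ ?Hs) (inr B v) = kleisli_of R P (A + A, B, ?Hs) v"
      by (rule kleisli_of_inr[OF G H v])
    also have "\<dots> = poly_partial R P A (kleisli_of R P (A, B, Fs) v)"
      using Fs by (intro kleisli_of_unique H is_lin_comp[OF is_lin_kleisli_of[OF Fs] is_lin_poly_partial] v)
        (simp_all add: kleisli_of_basis)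
    finally show "kleisli_of R P (A + A, B + B, ?Gs @ ?Hs) (inr B v)
      = deriv (Rpow R A) (Rpow R (A + A)) (inl A) (inr A) (kleisli_of R P (A, B, Fs) v)"
      using poly_partial_eq[OF kv] by simp
  qed
  finally show ?thesis by (simp add: psubst_partial[OF s])
qed

context
  fixes X A :: nat and Gs Hs Ks Ls
  assumes G: "length Gs = A" "set Gs \<subseteq> carrier (SR X)" and H: "length Hs = A" "set Hs \<subseteq> carrier (SR X)"
    and K: "length Ks = A" "set Ks \<subseteq> carrier (SR X)" and L: "length Ls = A" "set Ls \<subseteq> carrier (SR X)"
begin

private lemma GHKL:
  "length (Gs @ Hs) = A + A" "set (Gs @ Hs) \<subseteq> carrier (SR X)" "length (Ks @ Ls) = A + A" "set (Ks @ Ls) \<subseteq> carrier (SR X)"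
  "length ((Gs @ Hs) @ (Ks @ Ls)) = A + A + (A + A)" "set ((Gs @ Hs) @ (Ks @ Ls)) \<subseteq> carrier (SR X)"
  using G H K L by simp_all

text \<open>The outer inclusion selects a pair, the inner one a component of it. In
  \<open>bind_deriv_deriv_elt\<close>, with f and f' the first inclusions and g and g' the second,
  the blocks \<open>Gs\<close>, \<open>Hs\<close>, \<open>Ks\<close>, \<open>Ls\<close> thus belong
  to f'f, f'g, g'f and g'g; \<open>Hs\<close> and \<open>Ks\<close> are the mixed ones.\<close>

lemma kleisli_of_quadruple:
  assumes v: "v \<in> carrier (Rpow R A)"
  shows "kleisli_of R P (X, A + A + (A + A), (Gs @ Hs) @ (Ks @ Ls)) (inl (A + A) (inl A v)) = kleisli_of R P (X, A, Gs) v"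
    and "kleisli_of R P (X, A + A + (A + A), (Gs @ Hs) @ (Ks @ Ls)) (inl (A + A) (inr A v)) = kleisli_of R P (X, A, Hs) v"
    and "kleisli_of R P (X, A + A + (A + A), (Gs @ Hs) @ (Ks @ Ls)) (inr (A + A) (inl A v)) = kleisli_of R P (X, A, Ks) v"
    and "kleisli_of R P (X, A + A + (A + A), (Gs @ Hs) @ (Ks @ Ls)) (inr (A + A) (inr A v)) = kleisli_of R P (X, A, Ls) v"
  unfolding kleisli_of_inl[OF GHKL(1-4) is_lin_closed[OF is_lin_inl v]] kleisli_of_inl[OF GHKL(1-4) is_lin_closed[OF is_lin_inr v]]
    kleisli_of_inr[OF GHKL(1-4) is_lin_closed[OF is_lin_inl v]] kleisli_of_inr[OF GHKL(1-4) is_lin_closed[OF is_lin_inr v]]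
  by (rule kleisli_of_inl[OF G H v] kleisli_of_inr[OF G H v] kleisli_of_inl[OF K L v] kleisli_of_inr[OF K L v])+

lemmas is_lin_kleisli_of_quadruple = is_lin_kleisli_of[OF GHKL(5,6)]

lemma quadruple_POLY:
  "tuple (POLY R P) X [Prod (POLY R P) [A, A], Prod (POLY R P) [A, A]]
     [tuple (POLY R P) X [A, A] [(X, A, Gs), (X, A, Hs)], tuple (POLY R P) X [A, A] [(X, A, Ks), (X, A, Ls)]]
   = (X, A + A + (A + A), (Gs @ Hs) @ (Ks @ Ls))"
  using pair_POLY[OF GHKL(1-4)] by (simp add: pair_POLY[OF G H] pair_POLY[OF K L] POLY_simps(3))

end

lemma psubst_partial_add:
  assumes G: "length Gs = A" "set Gs \<subseteq> carrier (SR X)" and H: "length Hs = A" "set Hs \<subseteq> carrier (SR X)"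
    and K: "length Ks = A" "set Ks \<subseteq> carrier (SR X)" and s: "s \<in> carrier (SR A)"
  shows "psubst X (A + A) (Gs @ map2 (add (SR X)) Hs Ks) (poly_partial R P A s)
    = psubst X (A + A) (Gs @ Hs) (poly_partial R P A s) \<oplus>\<^bsub>SR X\<^esub> psubst X (A + A) (Gs @ Ks) (poly_partial R P A s)"
proof -
  have HK: "length (map2 (add (SR X)) Hs Ks) = A" "set (map2 (add (SR X)) Hs Ks) \<subseteq> carrier (SR X)"
    using map2_add_closed[OF H(2) K(2)] H K by simp_all
  have l: "is_lin R (Rpow R (A + A)) (SR X) (kleisli_of R P (X, A + A, Gs @ Qs))"
    if "length Qs = A" "set Qs \<subseteq> carrier (SR X)" for Qs
    using that G by (intro is_lin_kleisli_of) simp_all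
  show ?thesis
    unfolding psubst_partial[OF s]
    by (rule bind_deriv_add[OF Rpow_is_module Rpow_is_module Rpow_is_module is_lin_inl is_lin_inr l[OF HK] l[OF H] l[OF K] _ _ _ s])
      (simp_all only: kleisli_of_inl[OF G HK] kleisli_of_inl[OF G H] kleisli_of_inl[OF G K]
        kleisli_of_inr[OF G HK] kleisli_of_inr[OF G H] kleisli_of_inr[OF G K] kleisli_of_add[OF H K])
qed

lemma psubst_partial_zero:
  assumes G: "length Gs = A" "set Gs \<subseteq> carrier (SR X)" and s: "s \<in> carrier (SR A)"
  shows "psubst X (A + A) (Gs @ replicate A \<zero>\<^bsub>SR X\<^esub>) (poly_partial R P A s) = \<zero>\<^bsub>SR X\<^esub>"
proof -
  have Z: "length (replicate A \<zero>\<^bsub>SR X\<^esub>) = A" by simp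
  have "is_lin R (Rpow R (A + A)) (SR X) (kleisli_of R P (X, A + A, Gs @ replicate A \<zero>\<^bsub>SR X\<^esub>))"
    using G zeros_closed[of A X] by (intro is_lin_kleisli_of) simp_all
  then show ?thesis
    unfolding psubst_partial[OF s]
    by (rule bind_deriv_zero[OF Rpow_is_module Rpow_is_module Rpow_is_module is_lin_inl is_lin_inr _ _ s])
      (simp add: kleisli_of_inr[OF G Z zeros_closed] kleisli_of_zero)
qed

text \<open>The zero blocks are exactly the mixed ones, so \<open>bind_deriv_deriv_diagonal\<close>
  applies; the outer blocks \<open>Gs\<close> and \<open>Hs\<close> are what remains for the first
  derivative.\<close>

lemma psubst_partial_partial_diagonal:
  assumes G: "length Gs = A" "set Gs \<subseteq> carrier (SR X)" and H: "length Hs = A" "set Hs \<subseteq> carrier (SR X)"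
    and s: "s \<in> carrier (SR A)"
  shows "psubst X (A + A + (A + A)) ((Gs @ replicate A \<zero>\<^bsub>SR X\<^esub>) @ (replicate A \<zero>\<^bsub>SR X\<^esub> @ Hs))
      (poly_partial R P (A + A) (poly_partial R P A s))
    = psubst X (A + A) (Gs @ Hs) (poly_partial R P A s)"
proof -
  have Z: "length (replicate A \<zero>\<^bsub>SR X\<^esub>) = A" by simp
  have l: "is_lin R (Rpow R (A + A)) (SR X) (kleisli_of R P (X, A + A, Gs @ Hs))"
    using G H by (intro is_lin_kleisli_of) simp_all
  note q = kleisli_of_quadruple[OF G Z zeros_closed Z zeros_closed H]
  show ?thesis
    unfolding psubst_partial[OF s] psubst_partial_partial[OF s]
    by (rule bind_deriv_deriv_diagonal[OF Rpow_is_module Rpow_is_module Rpow_is_module is_lin_inl is_lin_inr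
          Rpow_is_module is_lin_inl is_lin_inr is_lin_kleisli_of_quadruple[OF G Z zeros_closed Z zeros_closed H] _ _ l _ _ s])
      (simp_all only: q kleisli_of_zero kleisli_of_inl[OF G H] kleisli_of_inr[OF G H])
qed

text \<open>Exchanging the middle blocks exchanges the two mixed composites of inclusions, as
  \<open>bind_deriv_deriv_swap\<close> requires.\<close>

lemma psubst_partial_partial_swap:
  assumes G: "length Gs = A" "set Gs \<subseteq> carrier (SR X)" and H: "length Hs = A" "set Hs \<subseteq> carrier (SR X)"
    and K: "length Ks = A" "set Ks \<subseteq> carrier (SR X)" and L: "length Ls = A" "set Ls \<subseteq> carrier (SR X)"
    and s: "s \<in> carrier (SR A)"
  shows "psubst X (A + A + (A + A)) ((Gs @ Hs) @ (Ks @ Ls)) (poly_partial R P (A + A) (poly_partial R P A s))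
    = psubst X (A + A + (A + A)) ((Gs @ Ks) @ (Hs @ Ls)) (poly_partial R P (A + A) (poly_partial R P A s))"
  unfolding psubst_partial_partial[OF s]
  by (rule bind_deriv_deriv_swap[OF Rpow_is_module Rpow_is_module Rpow_is_module is_lin_inl is_lin_inr
        Rpow_is_module is_lin_inl is_lin_inr is_lin_kleisli_of_quadruple[OF G H K L] is_lin_kleisli_of_quadruple[OF G K H L] _ _ _ _ s])
    (simp_all only: kleisli_of_quadruple[OF G H K L] kleisli_of_quadruple[OF G K H L])

lemma POLY_homE:
  assumes "f \<in> Hom (POLY R P) n m"
  obtains Ps where "f = (n, m, Ps)" "length Ps = m" "set Ps \<subseteq> carrier (SR n)"
  using assms by (auto simp: POLY_simps(2) elim: poly_homE)

abbreviation (input) DP :: "('r, 'p) poly_map \<Rightarrow> ('r, 'p) poly_map" where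
  "DP \<equiv> \<lambda>(n, m, Ps). (n + n, m, map (poly_partial R P n) Ps)"

lemma differential_category_POLY:
  "cartesian_differential_category (POLY R P) (\<lambda>(n, m, Ps). (n + n, m, map (poly_partial R P n) Ps))"
proof (intro cartesian_differential_category.intro left_additive_POLY cartesian_differential_category_axioms.intro)
  fix A B and f :: "('r, 'p) poly_map"
  assume "f \<in> Hom (POLY R P) A B"
  then show "DP f \<in> Hom (POLY R P) (Prod (POLY R P) [A, A]) B"
    using poly_partial_map_closed by (auto simp: POLY_simps poly_hom_iff elim!: poly_homE)
next
  fix A B and f g :: "('r, 'p) poly_map"
  assume "f \<in> Hom (POLY R P) A B" "g \<in> Hom (POLY R P) A B"
  then obtain Fs Gs where f: "f = (A, B, Fs)" "length Fs = B" "set Fs \<subseteq> carrier (SR A)"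
    and g: "g = (A, B, Gs)" "length Gs = B" "set Gs \<subseteq> carrier (SR A)"
    by (elim POLY_homE)
  have c: "Fs ! i \<in> carrier (SR A)" "Gs ! i \<in> carrier (SR A)" if "i < B" for i using f g that by auto
  show "DP (Add (POLY R P) f g) = Add (POLY R P) (DP f) (DP g)"
    using f(1,2) g(1,2) c by (auto simp: POLY_simps is_lin_add[OF is_lin_poly_partial] intro!: nth_equalityI)
next
  fix A B
  show "DP (Zero (POLY R P) A B) = Zero (POLY R P) (Prod (POLY R P) [A, A]) B"
    using is_lin_zero[OF is_lin_poly_partial Rpow_schur_is_module Rpow_schur_is_module, of A]
    by (simp add: POLY_simps)
next
  fix X A B and f g h k :: "('r, 'p) poly_map"
  assume "f \<in> Hom (POLY R P) A B" "g \<in> Hom (POLY R P) X A" "h \<in> Hom (POLY R P) X A" "k \<in> Hom (POLY R P) X A"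
  then obtain Fs Gs Hs Ks where f: "f = (A, B, Fs)" "length Fs = B" "set Fs \<subseteq> carrier (SR A)"
    and g: "g = (X, A, Gs)" and G: "length Gs = A" "set Gs \<subseteq> carrier (SR X)"
    and h: "h = (X, A, Hs)" and H: "length Hs = A" "set Hs \<subseteq> carrier (SR X)"
    and k: "k = (X, A, Ks)" and K: "length Ks = A" "set Ks \<subseteq> carrier (SR X)"
    by (elim POLY_homE)
  have HK: "length (map2 (add (SR X)) Hs Ks) = A" "set (map2 (add (SR X)) Hs Ks) \<subseteq> carrier (SR X)"
    using map2_add_closed[OF H(2) K(2)] H K by simp_all
  have c: "Fs ! i \<in> carrier (SR A)" if "i < B" for i using f that by auto
  show "Comp (POLY R P) (DP f) (tuple (POLY R P) X [A, A] [g, Add (POLY R P) h k])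
      = Add (POLY R P) (Comp (POLY R P) (DP f) (tuple (POLY R P) X [A, A] [g, h]))
          (Comp (POLY R P) (DP f) (tuple (POLY R P) X [A, A] [g, k]))"
    unfolding f(1) g h k POLY_simps(6) pair_POLY[OF G HK] pair_POLY[OF G H] pair_POLY[OF G K] prod.case POLY_simps(8)
    using f(2) c by (auto simp: psubst_partial_add[OF G H K] intro!: nth_equalityI)
next
  fix X A B and f g :: "('r, 'p) poly_map"
  assume "f \<in> Hom (POLY R P) A B" "g \<in> Hom (POLY R P) X A"
  then obtain Fs Gs where f: "f = (A, B, Fs)" "length Fs = B" "set Fs \<subseteq> carrier (SR A)"
    and g: "g = (X, A, Gs)" and G: "length Gs = A" "set Gs \<subseteq> carrier (SR X)"
    by (elim POLY_homE)
  have c: "Fs ! i \<in> carrier (SR A)" if "i < B" for i using f that by auto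
  have Z: "length (replicate A \<zero>\<^bsub>SR X\<^esub>) = A" by simp
  show "Comp (POLY R P) (DP f) (tuple (POLY R P) X [A, A] [g, Zero (POLY R P) X A]) = Zero (POLY R P) X B"
    unfolding f(1) g POLY_simps(7) pair_POLY[OF G Z zeros_closed] prod.case POLY_simps(8)
    using f(2) c by (auto simp: psubst_partial_zero[OF G] intro!: nth_equalityI)
next
  fix A
  \<comment> \<open>Differentiation replaces variable \<open>i\<close> by variable
    \<open>A + i\<close>, so the list of all variables becomes the second block of
    variables.\<close>
  show "DP (Id (POLY R P) A) = Proj (POLY R P) [A, A] 1"
    by (simp add: POLY_simps poly_partial_var)
next
  fix As j assume j: "j < length (As :: nat list)"
  let ?N = "sum_list As"
  have P1: "Proj (POLY R P) [?N, ?N] 1 = (?N + ?N, ?N, map (\<lambda>i. poly_var R P (?N + ?N) (?N + i)) [0..<?N])"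
    by (simp add: POLY_simps)
  have c: "set (map (\<lambda>i. poly_var R P (?N + ?N) (?N + i)) [0..<?N]) \<subseteq> carrier (SR (?N + ?N))"
    using poly_var_closed by auto
  show "DP (Proj (POLY R P) As j) = Comp (POLY R P) (Proj (POLY R P) As j) (Proj (POLY R P) [Prod (POLY R P) As, Prod (POLY R P) As] 1)"
    \<comment> \<open>The inner projection is rewritten by \<open>P1\<close> before the general
      equation for projections is unfolded, since that equation would rewrite both projections at
      once.\<close>
    unfolding POLY_simps(3) P1 unfolding POLY_simps(5) prod.case POLY_simps(8)
    using sum_list_take_nth_le[OF j] c by (auto simp: poly_partial_var psubst_var)
next
  fix X As and fs :: "('r, 'p) poly_map list"
  assume fs: "list_all2 (\<lambda>f A. f \<in> Hom (POLY R P) X A) fs As"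
  have Df: "DP f \<in> Hom (POLY R P) (X + X) A" if "f \<in> Hom (POLY R P) X A" for f A
    using that poly_partial_map_closed by (auto simp: POLY_simps poly_hom_iff elim!: poly_homE)
  have "list_all2 (\<lambda>f A. f \<in> Hom (POLY R P) (X + X) A) (map DP fs) As"
    unfolding list_all2_map1 by (rule list_all2_mono[OF fs Df])
  moreover have "concat (map (snd \<circ> snd) (map DP fs)) = map (poly_partial R P X) (concat (map (snd \<circ> snd) fs))"
    using fs by (induct rule: list_all2_induct) (auto elim!: POLY_homE)
  ultimately show "DP (tuple (POLY R P) X As fs) = tuple (POLY R P) (Prod (POLY R P) [X, X]) As (map DP fs)"
    by (simp add: tuple_POLY fs POLY_simps(3))
next
  fix A B E and f g :: "('r, 'p) poly_map"
  assume "f \<in> Hom (POLY R P) A B" "g \<in> Hom (POLY R P) B E"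
  then obtain Fs Gs where f: "f = (A, B, Fs)" and F: "length Fs = B" "set Fs \<subseteq> carrier (SR A)"
    and g: "g = (B, E, Gs)" "length Gs = E" "set Gs \<subseteq> carrier (SR B)"
    by (elim POLY_homE)
  let ?V = "map (poly_var R P (A + A)) [0..<A]"
  have V: "length ?V = A" "set ?V \<subseteq> carrier (SR (A + A))" using poly_var_closed by auto
  have P0: "Proj (POLY R P) [A, A] 0 = (A + A, A, ?V)" by (simp add: POLY_simps)
  have PA: "Prod (POLY R P) [A, A] = A + A" by (simp add: POLY_simps)
  have 1: "length (map (psubst (A + A) A ?V) Fs) = B" "set (map (psubst (A + A) A ?V) Fs) \<subseteq> carrier (SR (A + A))"
    using psubst_map_closed[OF V F(2)] F by simp_all
  have 2: "length (map (poly_partial R P A) Fs) = B" "set (map (poly_partial R P A) Fs) \<subseteq> carrier (SR (A + A))"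
    using poly_partial_map_closed[OF F(2)] F by simp_all
  show "DP (Comp (POLY R P) g f) = Comp (POLY R P) (DP g) (tuple (POLY R P) (Prod (POLY R P) [A, A]) [B, B]
      [Comp (POLY R P) f (Proj (POLY R P) [A, A] 0), DP f])"
    unfolding PA P0 f g(1) prod.case POLY_simps(8) pair_POLY[OF 1 2]
    using g(3) by (auto simp: poly_partial_psubst[OF F])
next
  fix X A B and f g h :: "('r, 'p) poly_map"
  assume "f \<in> Hom (POLY R P) A B" "g \<in> Hom (POLY R P) X A" "h \<in> Hom (POLY R P) X A"
  then obtain Fs Gs Hs where f: "f = (A, B, Fs)" "length Fs = B" "set Fs \<subseteq> carrier (SR A)"
    and g: "g = (X, A, Gs)" and G: "length Gs = A" "set Gs \<subseteq> carrier (SR X)"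
    and h: "h = (X, A, Hs)" and H: "length Hs = A" "set Hs \<subseteq> carrier (SR X)"
    by (elim POLY_homE)
  have Z: "length (replicate A \<zero>\<^bsub>SR X\<^esub>) = A" by simp
  show "Comp (POLY R P) (DP (DP f)) (tuple (POLY R P) X [Prod (POLY R P) [A, A], Prod (POLY R P) [A, A]]
         [tuple (POLY R P) X [A, A] [g, Zero (POLY R P) X A], tuple (POLY R P) X [A, A] [Zero (POLY R P) X A, h]])
      = Comp (POLY R P) (DP f) (tuple (POLY R P) X [A, A] [g, h])"
    unfolding f(1) g h POLY_simps(7) quadruple_POLY[OF G Z zeros_closed Z zeros_closed H] pair_POLY[OF G H] prod.case POLY_simps(8)
    \<comment> \<open>The bracketing of the four blocks into two pairs must be kept for the rewrite
      rule to match, hence the removal of \<open>append_assoc\<close>.\<close>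
    using f(3) by (auto simp del: append_assoc simp: psubst_partial_partial_diagonal[OF G H])
next
  fix X A B and f g h k l :: "('r, 'p) poly_map"
  assume "f \<in> Hom (POLY R P) A B" "g \<in> Hom (POLY R P) X A" "h \<in> Hom (POLY R P) X A"
    "k \<in> Hom (POLY R P) X A" "l \<in> Hom (POLY R P) X A"
  then obtain Fs Gs Hs Ks Ls where f: "f = (A, B, Fs)" "length Fs = B" "set Fs \<subseteq> carrier (SR A)"
    and g: "g = (X, A, Gs)" and G: "length Gs = A" "set Gs \<subseteq> carrier (SR X)"
    and h: "h = (X, A, Hs)" and H: "length Hs = A" "set Hs \<subseteq> carrier (SR X)"
    and k: "k = (X, A, Ks)" and K: "length Ks = A" "set Ks \<subseteq> carrier (SR X)"
    and l: "l = (X, A, Ls)" and L: "length Ls = A" "set Ls \<subseteq> carrier (SR X)"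
    by (elim POLY_homE)
  show "Comp (POLY R P) (DP (DP f)) (tuple (POLY R P) X [Prod (POLY R P) [A, A], Prod (POLY R P) [A, A]]
         [tuple (POLY R P) X [A, A] [g, h], tuple (POLY R P) X [A, A] [k, l]])
      = Comp (POLY R P) (DP (DP f)) (tuple (POLY R P) X [Prod (POLY R P) [A, A], Prod (POLY R P) [A, A]]
         [tuple (POLY R P) X [A, A] [g, k], tuple (POLY R P) X [A, A] [h, l]])"
    unfolding f(1) g h k l quadruple_POLY[OF G H K L] quadruple_POLY[OF G K H L] prod.case POLY_simps(8)
    using f(3) by (auto simp del: append_assoc intro!: psubst_partial_partial_swap[OF G H K L])
qed

end

theorem proposition4p2p2:
  fixes R :: "'r ring" and P :: "('r, 'p) operad_data"
  assumes "cring R" and "operad R P"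
  shows "cartesian_differential_category (POLY R P)
           (\<lambda>(n, m, Ps). (n + n, m, map (poly_partial R P n) Ps))"
  using assms(2) by (rule operad.differential_category_POLY)

end
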